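(* Let $n\ge 3$ and let $(M=[0,L]\times\mathbb{S}^{n-1},g)$ be an $n$-dimensional hypersurface of revolution in Euclidean space with boundary consisting of two spheres, of radii $R_1$ and $R_2$. Put $$L_1=\frac{-R_1+R_2+L}{2},\qquad \alpha=\frac{Q_1}{Q_1+Q_2},\qquad \beta=\frac{Q_2}{Q_1+Q_2},$$ $$Q_i=R_i^{n-1}\Big(R_i+\frac{1}{(n-1)2^n}(R_1+R_2+L)^nR_i^{1-n}\Big)^2,\qquad i=1,2.$$ Then the first Steklov eigenvalue $\sigma_1(M,g)$ has the upper bound $$\sigma_1(M,g)<\min\Big\{\alpha\,\sigma_1^N(A(R_1,L_1))+\beta\,\sigma_1^N(A(R_2,L-L_1)),\ \frac{1}{1+(R_1/R_2)^{n-1}}\sigma_0^D(A(R_1,L_1))+\frac{1}{1+(R_2/R_1)^{n-1}}\sigma_0^D(A(R_2,L-L_1))\Big\}.$$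
   Context: $g_0$ denotes the canonical metric on the unit sphere $\mathbb{S}^{n-1}$. An $n$-dimensional compact hypersurface of revolution in Euclidean space with boundary consisting of two components isometric to spheres of radii $R_1$ and $R_2$ means the manifold $M=[0,L]\times\mathbb{S}^{n-1}$ with a metric $g(r,p)=dr^2+h^2(r)g_0(p)$, where $h:[0,L]\to(0,\infty)$ is smooth, $h(0)=R_1$, $h(L)=R_2$, and $|h'(r)|\le 1$ for all $r\in[0,L]$. For a compact Riemannian manifold $(M,g)$ with boundary $\Sigma$, the Steklov eigenvalues are the eigenvalues of the Dirichlet-to-Neumann operator $f\mapsto\partial_\nu\hat f$ on $C^\infty(\Sigma)$, where $\hat f$ is the harmonic extension of $f$ to the interior of $M$ and $\nu$ is the outward unit normal. They form a sequence $0=\sigma_0\le\sigma_1\le\dots\to+\infty$, repeated according to multiplicity; $\sigma_k(M,g)$ denotes the $k$-th one. $A(R,\ell)=\mathbb{B}^n_{R+\ell}\setminus\overline{\mathbb{B}}{}^n_{R}\subset\mathbb{R}^n$ denotes the spherical shell with inner radius $R$ and outer radius $R+\ell$ (balls centered at the origin, flat metric), and $\nu$ its outward unit normal. The numbers $\sigma_k^D(A(R,\ell))$, $k=0,1,2,\dots$, are the eigenvalues, in nondecreasing order and repeated according to multiplicity, of the mixed Steklov-Dirichlet problem: $\Delta f=0$ in $A(R,\ell)$, $f=0$ on $\partial\mathbb{B}_{R+\ell}$, $\partial_\nu f=\sigma f$ on $\partial\mathbb{B}_R$. The numbers $\sigma_k^N(A(R,\ell))$, $k=0,1,2,\dots$,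 are the eigenvalues, in nondecreasing order and repeated according to multiplicity (so $\sigma_0^N=0$), of the mixed Steklov-Neumann problem: $\Delta f=0$ in $A(R,\ell)$, $\partial_\nu f=0$ on $\partial\mathbb{B}_{R+\ell}$, $\partial_\nu f=\sigma f$ on $\partial\mathbb{B}_R$. *)

theory Defs
  imports "HOL-Analysis.Analysis"
begin

section \<open>Smooth functions\<close>

primrec Ck_on :: "nat \<Rightarrow> 'a::real_normed_vector set \<Rightarrow> ('a \<Rightarrow> 'b::real_normed_vector) \<Rightarrow> bool"
where
  "Ck_on 0 U f \<longleftrightarrow> continuous_on U f"
| "Ck_on (Suc k) U f \<longleftrightarrow> (\<forall>x\<in>U. f differentiable (at x)) \<and>
     (\<forall>v. Ck_on k U (\<lambda>x. frechet_derivative f (at x) v))"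

text \<open>Smoothness on a closed set \<open>X\<close>, up to its boundary. A smooth function on a closed interval
  or a closed shell is represented by one of its smooth extensions to a neighbourhood; nothing below
  depends on which one is taken.\<close>

definition smooth_near :: "'a::real_normed_vector set \<Rightarrow> ('a \<Rightarrow> 'b::real_normed_vector) \<Rightarrow> bool"
where
  "smooth_near X f \<longleftrightarrow> (\<exists>U. open U \<and> X \<subseteq> U \<and> (\<forall>k. Ck_on k U f))"

section \<open>The \<open>k\<close>-th eigenvalue, counted with multiplicity\<close>

text \<open>\<open>E s\<close> is the eigenspace of \<open>s\<close>, whose elements are functions on \<open>X\<close>; their values
  outside \<open>X\<close> are irrelevant.\<close>

definition lin_indep_upto :: "'x set \<Rightarrow> nat \<Rightarrow> (nat \<Rightarrow> 'x \<Rightarrow> real) \<Rightarrow> bool"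
where
  "lin_indep_upto X k f \<longleftrightarrow>
     (\<forall>c. (\<forall>x\<in>X. (\<Sum>i\<le>k. c i * f i x) = 0) \<longrightarrow> (\<forall>i\<le>k. c i = (0::real)))"

text \<open>The least \<open>s\<close> such that the eigenspaces of the eigenvalues \<open>\<le> s\<close> contain \<open>k + 1\<close> linearly
  independent functions, i.e.\ such that these eigenvalues have total multiplicity greater than
  \<open>k\<close>. It is \<open>\<infinity>\<close> if there is no such \<open>s\<close>.\<close>

definition kth_eigenvalue :: "'x set \<Rightarrow> (real \<Rightarrow> ('x \<Rightarrow> real) set) \<Rightarrow> nat \<Rightarrow> ereal"
where
  "kth_eigenvalue X E k =
     Inf {ereal s | s. \<exists>t f. (\<forall>i\<le>k. t i \<le> s \<and> f i \<in> E (t i)) \<and> lin_indep_upto X k f}"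

section \<open>Laplace operators\<close>

definition pderiv_at :: "'n::finite \<Rightarrow> (real^'n \<Rightarrow> real) \<Rightarrow> real^'n \<Rightarrow> real"
where
  "pderiv_at i f x = frechet_derivative f (at x) (axis i 1)"

definition laplacian :: "(real^'n::finite \<Rightarrow> real) \<Rightarrow> real^'n \<Rightarrow> real"
where
  "laplacian f x = (\<Sum>i\<in>UNIV. pderiv_at i (pderiv_at i f) x)"

text \<open>The Laplace--Beltrami operator in coordinates, for a metric with matrix \<open>G\<close>.\<close>

definition laplace_beltrami ::
  "(real^'n::finite \<Rightarrow> real^'n^'n) \<Rightarrow> (real^'n \<Rightarrow> real) \<Rightarrow> real^'n \<Rightarrow> real"
where
  "laplace_beltrami G u x = 1 / sqrt (det (G x)) *
     (\<Sum>i\<in>UNIV. pderiv_at i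
        (\<lambda>y. sqrt (det (G y)) * (\<Sum>j\<in>UNIV. matrix_inv (G y) $ i $ j * pderiv_at j u y)) x)"

section \<open>Hypersurfaces of revolution\<close>

definition hypersurface_of_revolution ::
  "real \<Rightarrow> (real \<Rightarrow> real) \<Rightarrow> real \<Rightarrow> real \<Rightarrow> bool"
where
  "hypersurface_of_revolution L h R1 R2 \<longleftrightarrow> 0 < L \<and> smooth_near {0..L} h \<and>
     (\<forall>r\<in>{0..L}. 0 < h r) \<and> h 0 = R1 \<and> h L = R2 \<and> (\<forall>r\<in>{0..L}. \<bar>deriv h r\<bar> \<le> 1)"

definition cyl_interior :: "real \<Rightarrow> (real \<times> (real^'n::finite)) set"
where "cyl_interior L = {0<..<L} \<times> sphere 0 1"

definition cyl_boundary :: "real \<Rightarrow> (real \<times> (real^'n::finite)) set"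
where "cyl_boundary L = {0, L} \<times> sphere 0 1"

text \<open>The metric \<open>dr\<^sup>2 + h\<^sup>2(r) g\<^sub>0\<close> at \<open>q = (r, p)\<close>, on tangent vectors \<open>(s, v)\<close> with \<open>v\<close> orthogonal
  to \<open>p\<close>; the round metric \<open>g\<^sub>0\<close> is the restriction of the Euclidean inner product.\<close>

definition revolution_metric ::
  "(real \<Rightarrow> real) \<Rightarrow> real \<times> (real^'n::finite) \<Rightarrow> real \<times> (real^'n) \<Rightarrow> real \<times> (real^'n) \<Rightarrow> real"
where
  "revolution_metric h q a b = fst a * fst b + (h (fst q))\<^sup>2 * (snd a \<bullet> snd b)"

text \<open>A global chart: \<open>polar\<close> maps the closed shell \<open>1 \<le> |x| \<le> 1 + L\<close> diffeomorphically onto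
  \<open>[0,L] \<times> S\<^sup>n\<^sup>-\<^sup>1\<close>, with inverse \<open>polar_inv\<close>. Smoothness on the manifold and its
  Laplace--Beltrami operator are read in this chart.\<close>

definition polar :: "real^'n::finite \<Rightarrow> real \<times> (real^'n)"
where "polar x = (norm x - 1, x /\<^sub>R norm x)"

definition polar_inv :: "real \<times> (real^'n::finite) \<Rightarrow> real^'n"
where "polar_inv q = (1 + fst q) *\<^sub>R snd q"

definition pullback_metric :: "(real \<Rightarrow> real) \<Rightarrow> real^'n::finite \<Rightarrow> real^'n^'n"
where
  "pullback_metric h x = (\<chi> i j. revolution_metric h (polar x)
      (frechet_derivative polar (at x) (axis i 1))
      (frechet_derivative polar (at x) (axis j 1)))"

definition smooth_on_cyl :: "real \<Rightarrow> (real \<times> (real^'n::finite) \<Rightarrow> real) \<Rightarrow> bool"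
where
  "smooth_on_cyl L u \<longleftrightarrow> smooth_near {x. 1 \<le> norm x \<and> norm x \<le> 1 + L} (u \<circ> polar)"

definition revolution_laplacian ::
  "(real \<Rightarrow> real) \<Rightarrow> (real \<times> (real^'n::finite) \<Rightarrow> real) \<Rightarrow> real \<times> (real^'n) \<Rightarrow> real"
where
  "revolution_laplacian h u q =
     laplace_beltrami (pullback_metric h) (u \<circ> polar) (polar_inv q)"

text \<open>The outward unit normal is \<open>-\<partial>\<^sub>r\<close> on \<open>{0} \<times> S\<^sup>n\<^sup>-\<^sup>1\<close> and \<open>\<partial>\<^sub>r\<close> on \<open>{L} \<times> S\<^sup>n\<^sup>-\<^sup>1\<close>.\<close>

definition cyl_normal_deriv ::
  "(real \<times> (real^'n::finite) \<Rightarrow> real) \<Rightarrow> real \<times> (real^'n) \<Rightarrow> real"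
where
  "cyl_normal_deriv u q =
     (if fst q = 0 then -1 else 1) * deriv (\<lambda>r. u (r, snd q)) (fst q)"

definition harmonic_extension ::
  "real \<Rightarrow> (real \<Rightarrow> real) \<Rightarrow> (real \<times> (real^'n::finite) \<Rightarrow> real) \<Rightarrow> (real \<times> (real^'n) \<Rightarrow> real) \<Rightarrow> bool"
where
  "harmonic_extension L h f u \<longleftrightarrow> smooth_on_cyl L u \<and>
     (\<forall>q\<in>cyl_interior L. revolution_laplacian h u q = 0) \<and> (\<forall>q\<in>cyl_boundary L. u q = f q)"

text \<open>The Dirichlet-to-Neumann operator as a graph: \<open>DtN L h f \<phi>\<close> says that it sends \<open>f\<close> to \<open>\<phi>\<close>.
  The existence of \<open>u\<close> implies that \<open>f\<close> is smooth on the boundary.\<close>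

definition DtN ::
  "real \<Rightarrow> (real \<Rightarrow> real) \<Rightarrow> (real \<times> (real^'n::finite) \<Rightarrow> real) \<Rightarrow> (real \<times> (real^'n) \<Rightarrow> real) \<Rightarrow> bool"
where
  "DtN L h f \<phi> \<longleftrightarrow>
     (\<exists>u. harmonic_extension L h f u \<and> (\<forall>q\<in>cyl_boundary L. \<phi> q = cyl_normal_deriv u q))"

definition steklov_eigenspace ::
  "real \<Rightarrow> (real \<Rightarrow> real) \<Rightarrow> real \<Rightarrow> (real \<times> (real^'n::finite) \<Rightarrow> real) set"
where
  "steklov_eigenspace L h s = {f. DtN L h f (\<lambda>q. s * f q)}"

definition steklov_eigenvalue ::
  "'n::finite itself \<Rightarrow> real \<Rightarrow> (real \<Rightarrow> real) \<Rightarrow> nat \<Rightarrow> ereal"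
where
  "steklov_eigenvalue _ L h =
     kth_eigenvalue (cyl_boundary L :: (real \<times> (real^'n)) set) (steklov_eigenspace L h)"

section \<open>Mixed problems on spherical shells\<close>

definition shell :: "real \<Rightarrow> real \<Rightarrow> (real^'n::finite) set"
where "shell R l = ball 0 (R + l) - cball 0 R"

text \<open>For \<open>l > 0\<close> this is the closure of \<open>shell R l\<close>. For \<open>l = 0\<close> it is the sphere of radius \<open>R\<close>,
  and then the two eigenvalue problems below degenerate to \<open>\<sigma>\<^sub>k\<^sup>D = \<infinity>\<close> and \<open>\<sigma>\<^sub>k\<^sup>N = 0\<close>, which are the
  limits as \<open>l\<close> tends to \<open>0\<close>.\<close>

definition closed_shell :: "real \<Rightarrow> real \<Rightarrow> (real^'n::finite) set"
where "closed_shell R l = cball 0 (R + l) - ball 0 R"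

definition radial_deriv :: "(real^'n::finite \<Rightarrow> real) \<Rightarrow> real^'n \<Rightarrow> real"
where "radial_deriv f x = frechet_derivative f (at x) (x /\<^sub>R norm x)"

text \<open>The outward normal of the shell is \<open>-x / |x|\<close> on the inner sphere and \<open>x / |x|\<close> on the outer
  one.\<close>

definition steklov_dirichlet_eigenspace ::
  "real \<Rightarrow> real \<Rightarrow> real \<Rightarrow> (real^'n::finite \<Rightarrow> real) set"
where
  "steklov_dirichlet_eigenspace R l s =
     {f. smooth_near (closed_shell R l) f \<and>
         (\<forall>x\<in>shell R l. laplacian f x = 0) \<and>
         (\<forall>x\<in>sphere 0 (R + l). f x = 0) \<and>
         (\<forall>x\<in>sphere 0 R. - radial_deriv f x = s * f x)}"

definition steklov_neumann_eigenspace ::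
  "real \<Rightarrow> real \<Rightarrow> real \<Rightarrow> (real^'n::finite \<Rightarrow> real) set"
where
  "steklov_neumann_eigenspace R l s =
     {f. smooth_near (closed_shell R l) f \<and>
         (\<forall>x\<in>shell R l. laplacian f x = 0) \<and>
         (\<forall>x\<in>sphere 0 (R + l). radial_deriv f x = 0) \<and>
         (\<forall>x\<in>sphere 0 R. - radial_deriv f x = s * f x)}"

definition sigmaD :: "'n::finite itself \<Rightarrow> real \<Rightarrow> real \<Rightarrow> nat \<Rightarrow> ereal"
where
  "sigmaD _ R l =
     kth_eigenvalue (closed_shell R l :: (real^'n) set) (steklov_dirichlet_eigenspace R l)"

definition sigmaN :: "'n::finite itself \<Rightarrow> real \<Rightarrow> real \<Rightarrow> nat \<Rightarrow> ereal"
where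
  "sigmaN _ R l =
     kth_eigenvalue (closed_shell R l :: (real^'n) set) (steklov_neumann_eigenspace R l)"

end

theory Submission
  imports Defs
begin

text \<open>Both bounds compare a function on \<open>M\<close> with its counterparts on the two shells. Put
  \<open>B = (R\<^sub>1 + R\<^sub>2 + L) / 2\<close>, so that \<open>B = R\<^sub>1 + L\<^sub>1 = R\<^sub>2 + (L - L\<^sub>1)\<close>: both shells have outer radius
  \<open>B\<close>. As \<open>|h'| \<le> 1\<close>, the profile \<open>h\<close> lies below the cones \<open>R\<^sub>1 + r\<close> and \<open>R\<^sub>2 + L - r\<close>, which meet at
  \<open>r = L\<^sub>1\<close> and are the profiles of the two shells. A smooth \<open>h\<close> cannot have the kink of the union
  of the cones, and for nondegenerate shells this is where the inequality becomes strict.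

  The right-hand side needs only lower bounds of the mixed eigenvalues. They come from a comparison
  principle (\<open>barrier_comparison\<close>), without integration. For the Dirichlet problem the barrier is the
  radial function \<open>r\<^sup>-\<^sup>(\<^sup>n\<^sup>-\<^sup>2\<^sup>) - B\<^sup>-\<^sup>(\<^sup>n\<^sup>-\<^sup>2\<^sup>)\<close>. For the Neumann problem the principle is applied to the
  difference of an eigenfunction and its mirror image, on a half shell, with the barrier
  \<open>a(r) cos \<theta>\<close>, where \<open>a(r) = r + B\<^sup>n / ((n - 1) r\<^sup>n\<^sup>-\<^sup>1)\<close>: an eigenfunction whose eigenvalue is below
  \<open>- a'(R) / a(R)\<close> is invariant under all reflections, hence radial, hence constant
  (\<open>steklov_neumann_below_constant\<close>).

  The left-hand side needs two eigenfunctions on \<open>M\<close>. The constants are one, and the other is found by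
  separation of variables (\<open>laplace_beltrami_polar_product\<close>, \<open>steklov_eigenfunction\<close>).

  For the Dirichlet bound it is radial, and its eigenvalue is
  \<open>(R\<^sub>1\<^sup>1\<^sup>-\<^sup>n + R\<^sub>2\<^sup>1\<^sup>-\<^sup>n) / I\<close> with \<open>I = \<integral> h\<^sup>1\<^sup>-\<^sup>n\<close>. The cones give \<open>I > J\<^sub>1 + J\<^sub>2\<close> for the corresponding
  integrals of the shells; if a shell is degenerate, the bound is infinite. As \<open>\<sigma>\<^sub>0\<^sup>D = R\<^sub>i\<^sup>1\<^sup>-\<^sup>n / J\<^sub>i\<close>, the rest is the Cauchy--Schwarz inequality.

  For the Neumann bound it is \<open>y(r) (p \<bullet> e)\<close>, where \<open>y\<close> solves a linear ordinary differential
  equation, and the eigenvalue is found by shooting from one end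
  (\<open>steklov_eigenvalue_less_zonal\<close>). The classical argument inserts the function that is \<open>a(R\<^sub>1 + r)\<close>
  before \<open>L\<^sub>1\<close> and \<open>a(R\<^sub>2 + L - r)\<close> after it into the Rayleigh quotient; the \<open>Q\<^sub>i\<close> are its boundary terms,
  and since \<open>a'(B) = 0\<close> the two pieces fit together. Here the Rayleigh quotient is
  replaced by its pointwise form, a Riccati inequality for \<open>h\<^sup>n\<^sup>-\<^sup>1 y' / y\<close> along the cones
  (\<open>riccati_comparison\<close>).

  In most statements \<open>n = m + 3\<close>, so that \<open>n - 1\<close> and \<open>n - 3\<close> are the exponents \<open>m + 2\<close> and \<open>m\<close>.\<close>

section \<open>Calculus of \<open>Ck_on\<close>\<close>

text \<open>\<open>Ck_on\<close> speaks of the derivative that is selected at each point. On an open set this derivative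
  depends on the values there only, so that any formula for it may be used.\<close>

lemma Ck_on_cong:
  assumes "open U" "\<And>x. x \<in> U \<Longrightarrow> f x = g x" "Ck_on k U f"
  shows "Ck_on k U g"
  using assms(2,3)
proof (induction k arbitrary: f g)
  case 0
  then show ?case by (simp cong: continuous_on_cong)
next
  case (Suc k)
  have der: "(g has_derivative frechet_derivative f (at x)) (at x)" if "x \<in> U" for x
  proof -
    have "(f has_derivative frechet_derivative f (at x)) (at x)"
      using Suc.prems(2) that frechet_derivative_works by auto
    then show ?thesis
      by (rule has_derivative_transform_within_open[OF _ \<open>open U\<close> that]) (use Suc.prems(1) in auto)
  qed
  have fd: "frechet_derivative g (at x) = frechet_derivative f (at x)" if "x \<in> U" for x
    using frechet_derivative_at[OF der[OF that]] by simp
  have "Ck_on k U (\<lambda>x. frechet_derivative g (at x) v)" for v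
  proof (rule Suc.IH)
    show "Ck_on k U (\<lambda>x. frechet_derivative f (at x) v)" using Suc.prems(2) by auto
  qed (simp add: fd)
  moreover have "g differentiable (at x)" if "x \<in> U" for x
    using der[OF that] by (rule differentiableI)
  ultimately show ?case by simp
qed

lemma Ck_on_SucI:
  assumes "open U" "\<And>x. x \<in> U \<Longrightarrow> (f has_derivative f' x) (at x)"
    and "\<And>v. Ck_on k U (\<lambda>x. f' x v)"
  shows "Ck_on (Suc k) U f"
proof -
  have fd: "frechet_derivative f (at x) = f' x" if "x \<in> U" for x
    using frechet_derivative_at[OF assms(2)[OF that]] by simp
  have "Ck_on k U (\<lambda>x. frechet_derivative f (at x) v)" for v
    by (rule Ck_on_cong[OF assms(1) _ assms(3)]) (simp add: fd)
  then show ?thesis using assms(2) by (auto intro: differentiableI)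
qed

lemma Ck_on_Suc_has_derivative:
  "Ck_on (Suc k) U f \<Longrightarrow> x \<in> U \<Longrightarrow> (f has_derivative frechet_derivative f (at x)) (at x)"
  using frechet_derivative_works by auto

lemma Ck_on_imp_continuous_on: "Ck_on k U f \<Longrightarrow> continuous_on U f"
  by (cases k) (auto intro!: continuous_at_imp_continuous_on differentiable_imp_continuous_within)

lemma Ck_on_SucD: "Ck_on (Suc k) U f \<Longrightarrow> Ck_on k U f"
proof (induction k arbitrary: f)
  case 0
  then show ?case using Ck_on_imp_continuous_on[of "Suc 0" U f] by simp
next
  case (Suc k)
  then have "\<forall>x\<in>U. f differentiable (at x)"
    and "\<And>v. Ck_on (Suc k) U (\<lambda>x. frechet_derivative f (at x) v)"
    by (simp_all only: Ck_on.simps(2)) blast+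
  with Suc.IH show ?case by (simp only: Ck_on.simps(2)) blast
qed

lemma Ck_on_subset: "Ck_on k U f \<Longrightarrow> V \<subseteq> U \<Longrightarrow> Ck_on k V f"
  by (induction k arbitrary: f) (auto intro: continuous_on_subset)

lemma Ck_on_const: "open U \<Longrightarrow> Ck_on k U (\<lambda>x. c)"
proof (induction k arbitrary: c)
  case (Suc k)
  then show ?case by (intro Ck_on_SucI[where f' = "\<lambda>x v. 0"]) auto
qed auto

lemma Ck_on_bounded_linear:
  assumes "bounded_linear f" "open U"
  shows "Ck_on k U f"
proof (cases k)
  case 0
  then show ?thesis using assms by (simp add: linear_continuous_on)
next
  case (Suc j)
  have "Ck_on (Suc j) U f"
    using assms bounded_linear_imp_has_derivative[OF assms(1)]
    by (intro Ck_on_SucI[where f' = "\<lambda>x v. f v"] Ck_on_const) auto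
  then show ?thesis using Suc by simp
qed

lemma Ck_on_add:
  "open U \<Longrightarrow> Ck_on k U f \<Longrightarrow> Ck_on k U g \<Longrightarrow> Ck_on k U (\<lambda>x. f x + g x)"
proof (induction k arbitrary: f g)
  case (Suc k)
  show ?case
  proof (rule Ck_on_SucI)
    show "((\<lambda>x. f x + g x) has_derivative
        (\<lambda>v. frechet_derivative f (at x) v + frechet_derivative g (at x) v)) (at x)"
      if "x \<in> U" for x
      using Suc.prems that by (intro has_derivative_add Ck_on_Suc_has_derivative)
    show "Ck_on k U (\<lambda>x. frechet_derivative f (at x) v + frechet_derivative g (at x) v)" for v
      using Suc.prems by (intro Suc.IH) auto
  qed (rule Suc.prems(1))
qed (auto intro: continuous_on_add)

lemma Ck_on_mult:
  fixes f g :: "'a::real_normed_vector \<Rightarrow> real"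
  shows "open U \<Longrightarrow> Ck_on k U f \<Longrightarrow> Ck_on k U g \<Longrightarrow> Ck_on k U (\<lambda>x. f x * g x)"
proof (induction k arbitrary: f g)
  case (Suc k)
  show ?case
  proof (rule Ck_on_SucI)
    show "((\<lambda>x. f x * g x) has_derivative
        (\<lambda>v. f x * frechet_derivative g (at x) v + frechet_derivative f (at x) v * g x)) (at x)"
      if "x \<in> U" for x
      using Suc.prems that by (intro has_derivative_mult Ck_on_Suc_has_derivative)
    show "Ck_on k U (\<lambda>x. f x * frechet_derivative g (at x) v + frechet_derivative f (at x) v * g x)"
      for v
      using Suc.prems Ck_on_SucD[OF Suc.prems(2)] Ck_on_SucD[OF Suc.prems(3)]
      by (intro Ck_on_add Suc.IH) auto
  qed (rule Suc.prems(1))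
qed (auto intro: continuous_on_mult)

lemma Ck_on_diff:
  fixes f g :: "'a::real_normed_vector \<Rightarrow> real"
  assumes "open U" "Ck_on k U f" "Ck_on k U g"
  shows "Ck_on k U (\<lambda>x. f x - g x)"
  using Ck_on_add[OF assms(1,2) Ck_on_mult[OF assms(1) Ck_on_const[OF assms(1), of k "-1"] assms(3)]]
  by simp

lemma Ck_on_power:
  fixes f :: "'a::real_normed_vector \<Rightarrow> real"
  assumes "open U" "Ck_on k U f"
  shows "Ck_on k U (\<lambda>x. f x ^ m)"
  by (induction m) (use assms in \<open>auto intro: Ck_on_const Ck_on_mult\<close>)

lemma Ck_on_inverse:
  fixes f :: "'a::real_normed_vector \<Rightarrow> real"
  shows "open U \<Longrightarrow> (\<And>x. x \<in> U \<Longrightarrow> f x \<noteq> 0) \<Longrightarrow> Ck_on k U f \<Longrightarrow> Ck_on k U (\<lambda>x. inverse (f x))"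
proof (induction k)
  case (Suc k)
  show ?case
  proof (rule Ck_on_SucI)
    show "((\<lambda>x. inverse (f x)) has_derivative
        (\<lambda>v. (- 1) * (inverse (f x) * (inverse (f x) * frechet_derivative f (at x) v)))) (at x)"
      if "x \<in> U" for x
      using Suc.prems that Ck_on_Suc_has_derivative[OF Suc.prems(3) that]
      by (auto intro!: derivative_eq_intros)
    show "Ck_on k U (\<lambda>x. (- 1) * (inverse (f x) * (inverse (f x) * frechet_derivative f (at x) v)))"
      for v
      using Suc.prems Suc.IH Ck_on_SucD[OF Suc.prems(3)]
      by (intro Ck_on_mult Ck_on_const) auto
  qed (rule Suc.prems(1))
qed (auto intro: continuous_on_inverse)

lemma has_derivative_imp_deriv_mult:
  fixes \<phi> :: "real \<Rightarrow> real"
  assumes "\<phi> differentiable (at t)"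
  shows "(\<phi> has_derivative (\<lambda>v. v * frechet_derivative \<phi> (at t) 1)) (at t)"
proof -
  have "(\<phi> has_derivative frechet_derivative \<phi> (at t)) (at t)"
    using assms frechet_derivative_works by blast
  moreover have "frechet_derivative \<phi> (at t) = (\<lambda>v. v * frechet_derivative \<phi> (at t) 1)"
  proof
    fix v
    have "linear (frechet_derivative \<phi> (at t))" using assms by (rule linear_frechet_derivative)
    then show "frechet_derivative \<phi> (at t) v = v * frechet_derivative \<phi> (at t) 1"
      using linear_scale[of "frechet_derivative \<phi> (at t)" v 1] by simp
  qed
  ultimately show ?thesis by simp
qed

lemma Ck_on_compose:
  fixes \<phi> :: "real \<Rightarrow> real" and f :: "'a::real_normed_vector \<Rightarrow> real"
  shows "open U \<Longrightarrow> f ` U \<subseteq> V \<Longrightarrow> Ck_on k V \<phi> \<Longrightarrow> Ck_on k U f \<Longrightarrow> Ck_on k U (\<lambda>x. \<phi> (f x))"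
proof (induction k arbitrary: \<phi>)
  case 0
  then show ?case by (auto intro: continuous_on_compose2)
next
  case (Suc k)
  show ?case
  proof (rule Ck_on_SucI)
    show "((\<lambda>x. \<phi> (f x)) has_derivative
        (\<lambda>v. frechet_derivative f (at x) v * frechet_derivative \<phi> (at (f x)) 1)) (at x)"
      if "x \<in> U" for x
    proof (rule has_derivative_compose[OF Ck_on_Suc_has_derivative[OF Suc.prems(4) that]])
      show "(\<phi> has_derivative (\<lambda>v. v * frechet_derivative \<phi> (at (f x)) 1)) (at (f x))"
        using Suc.prems(2,3) that by (intro has_derivative_imp_deriv_mult) auto
    qed
    show "Ck_on k U (\<lambda>x. frechet_derivative f (at x) v * frechet_derivative \<phi> (at (f x)) 1)" for v
    proof (rule Ck_on_mult[OF Suc.prems(1)])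
      show "Ck_on k U (\<lambda>x. frechet_derivative f (at x) v)" using Suc.prems(4) by simp
      show "Ck_on k U (\<lambda>x. frechet_derivative \<phi> (at (f x)) 1)"
        using Suc.prems(3) Ck_on_SucD[OF Suc.prems(4)]
        by (intro Suc.IH[where \<phi> = "\<lambda>t. frechet_derivative \<phi> (at t) 1"] Suc.prems(1,2)) auto
    qed
  qed (rule Suc.prems(1))
qed

lemma Ck_on_compose_linear:
  fixes f :: "'b::real_normed_vector \<Rightarrow> 'c::real_normed_vector" and A :: "'a::real_normed_vector \<Rightarrow> 'b"
  assumes "bounded_linear A" "open U"
  shows "Ck_on k U f \<Longrightarrow> Ck_on k (A -` U) (\<lambda>x. f (A x))"
proof (induction k arbitrary: f)
  case 0
  then show ?case
    using linear_continuous_on[OF assms(1)] by (auto intro: continuous_on_compose2)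
next
  case (Suc k)
  show ?case
  proof (rule Ck_on_SucI)
    show "open (A -` U)"
      using assms by (simp add: continuous_open_vimage linear_continuous_at)
    show "((\<lambda>x. f (A x)) has_derivative (\<lambda>v. frechet_derivative f (at (A x)) (A v))) (at x)"
      if "x \<in> A -` U" for x
      using Suc.prems that
      by (intro has_derivative_compose[OF bounded_linear_imp_has_derivative[OF assms(1)]]
          Ck_on_Suc_has_derivative[OF Suc.prems]) auto
    show "Ck_on k (A -` U) (\<lambda>x. frechet_derivative f (at (A x)) (A v))" for v
      using Suc.prems by (intro Suc.IH[where f = "\<lambda>y. frechet_derivative f (at y) (A v)"]) auto
  qed
qed

text \<open>The derivative of the norm is again expressed by the norm, which makes the induction work.\<close>

lemma Ck_on_norm: "Ck_on k (- {0}) (norm :: 'a::real_inner \<Rightarrow> real)"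
proof (induction k)
  case 0
  then show ?case by (simp add: continuous_on_norm_id)
next
  case (Suc k)
  have op: "open (- {0::'a})" by auto
  show ?case
  proof (rule Ck_on_SucI[OF op])
    show "(norm has_derivative (\<lambda>v. inverse (norm x) * (v \<bullet> x))) (at x)" if "x \<in> - {0}" for x :: 'a
      using that has_derivative_norm[of x] by (simp add: sgn_div_norm inner_commute)
    show "Ck_on k (- {0}) (\<lambda>x::'a. inverse (norm x) * (v \<bullet> x))" for v
      using op by (intro Ck_on_mult Ck_on_inverse Suc Ck_on_bounded_linear bounded_linear_inner_right) auto
  qed
qed

lemma Ck_on_real_SucI:
  fixes f :: "real \<Rightarrow> real"
  assumes "open U" "\<And>x. x \<in> U \<Longrightarrow> (f has_real_derivative f' x) (at x)" "Ck_on k U f'"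
  shows "Ck_on (Suc k) U f"
  by (rule Ck_on_SucI[where f' = "\<lambda>x v. f' x * v"])
    (use assms in \<open>auto simp: has_field_derivative_def intro: Ck_on_mult Ck_on_const\<close>)

section \<open>Gradients, divergence and the Laplacian\<close>

definition divergence :: "(real^'n::finite \<Rightarrow> real^'n) \<Rightarrow> real^'n \<Rightarrow> real"
where
  "divergence V x = (\<Sum>i\<in>UNIV. pderiv_at i (\<lambda>y. V y $ i) x)"

definition has_gradient :: "(real^'n::finite \<Rightarrow> real) \<Rightarrow> real^'n \<Rightarrow> real^'n \<Rightarrow> bool"
where
  "has_gradient f g x \<longleftrightarrow> (f has_derivative (\<lambda>v. g \<bullet> v)) (at x)"

lemma pderiv_at_eq: "(f has_derivative f') (at x) \<Longrightarrow> pderiv_at i f x = f' (axis i 1)"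
  unfolding pderiv_at_def using frechet_derivative_at by metis

lemma has_gradientI:
  "(f has_derivative D) (at x) \<Longrightarrow> (\<And>v. D v = g \<bullet> v) \<Longrightarrow> has_gradient f g x"
  unfolding has_gradient_def by (metis (no_types, lifting) ext)

lemma pderiv_at_has_gradient: "has_gradient f g x \<Longrightarrow> pderiv_at i f x = g $ i"
  unfolding has_gradient_def by (simp add: pderiv_at_eq inner_axis)

lemma pderiv_at_cong:
  assumes "open U" "x \<in> U" "\<And>y. y \<in> U \<Longrightarrow> f y = g y"
  shows "pderiv_at i f x = pderiv_at i g x"
proof -
  have "(f has_derivative D) (at x) \<longleftrightarrow> (g has_derivative D) (at x)" for D
    using has_derivative_transform_within_open[OF _ assms(1,2), of f D UNIV g]
      has_derivative_transform_within_open[OF _ assms(1,2), of g D UNIV f] assms(3) by auto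
  then show ?thesis unfolding pderiv_at_def frechet_derivative_def by simp
qed

lemma divergence_has_derivative:
  assumes "(V has_derivative V') (at x)"
  shows "divergence V x = (\<Sum>i\<in>UNIV. V' (axis i 1) $ i)"
  unfolding divergence_def
  by (intro sum.cong pderiv_at_eq[OF bounded_linear.has_derivative[OF bounded_linear_vec_nth assms]]) auto

lemma divergence_add:
  assumes "V differentiable (at x)" "W differentiable (at x)"
  shows "divergence (\<lambda>y. V y + W y) x = divergence V x + divergence W x"
proof -
  from assms obtain V' W' where *: "(V has_derivative V') (at x)" "(W has_derivative W') (at x)"
    unfolding differentiable_def by auto
  show ?thesis
    by (simp add: divergence_has_derivative[OF has_derivative_add[OF *]]
        divergence_has_derivative[OF *(1)] divergence_has_derivative[OF *(2)] sum.distrib)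
qed

lemma divergence_scaleR:
  assumes \<phi>: "has_gradient \<phi> g x" and "V differentiable (at x)"
  shows "divergence (\<lambda>y. \<phi> y *\<^sub>R V y) x = \<phi> x * divergence V x + g \<bullet> V x"
proof -
  from assms obtain V' where V': "(V has_derivative V') (at x)"
    unfolding differentiable_def by auto
  have "((\<lambda>y. \<phi> y *\<^sub>R V y) has_derivative (\<lambda>v. \<phi> x *\<^sub>R V' v + (g \<bullet> v) *\<^sub>R V x)) (at x)"
    using has_derivative_scaleR[OF \<phi>[unfolded has_gradient_def] V'] .
  then show ?thesis
    by (simp add: divergence_has_derivative divergence_has_derivative[OF V'] sum.distrib
        sum_distrib_left inner_axis) (simp add: inner_vec_def)
qed

lemma divergence_id: "divergence (\<lambda>y. y) (x :: real^'n::finite) = real CARD('n)"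
  by (simp add: divergence_has_derivative[OF has_derivative_ident])

lemma divergence_const: "divergence (\<lambda>y. c) x = 0"
  by (simp add: divergence_has_derivative[OF has_derivative_const])

lemma laplacian_eq_divergence:
  assumes "open U" "x \<in> U" "\<And>y. y \<in> U \<Longrightarrow> has_gradient f (G y) y"
  shows "laplacian f x = divergence G x"
  unfolding laplacian_def divergence_def
  by (intro sum.cong pderiv_at_cong[OF assms(1,2)] refl pderiv_at_has_gradient assms(3))

lemma has_gradient_imp_differentiable: "has_gradient f g x \<Longrightarrow> f differentiable (at x)"
  unfolding has_gradient_def by (rule differentiableI)

lemma has_gradient_mult:
  assumes "has_gradient f g x" "has_gradient f2 g2 x"
  shows "has_gradient (\<lambda>y. f y * f2 y) (f x *\<^sub>R g2 + f2 x *\<^sub>R g) x"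
  by (rule has_gradientI[OF has_derivative_mult[OF assms[unfolded has_gradient_def]]])
    (simp add: inner_add_left)

lemma has_gradient_compose:
  assumes "has_gradient f g x" "(\<phi> has_real_derivative \<phi>') (at (f x))"
  shows "has_gradient (\<lambda>y. \<phi> (f y)) (\<phi>' *\<^sub>R g) x"
  by (rule has_gradientI[OF has_derivative_compose[OF assms(1)[unfolded has_gradient_def]
      assms(2)[unfolded has_field_derivative_def]]]) simp

lemma has_gradient_inner: "has_gradient (\<lambda>y. y \<bullet> e) e x"
  by (rule has_gradientI[OF bounded_linear_imp_has_derivative[OF bounded_linear_inner_left]])
    (simp add: inner_commute)

lemma has_gradient_norm: "x \<noteq> 0 \<Longrightarrow> has_gradient norm (x /\<^sub>R norm x) x"
  by (rule has_gradientI[OF has_derivative_norm]) (simp_all add: sgn_div_norm inner_commute)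

lemma has_gradient_radial:
  assumes "x \<noteq> 0" "(F has_real_derivative F') (at (norm x))"
  shows "has_gradient (\<lambda>y. F (norm y)) ((F' / norm x) *\<^sub>R x) x"
  using has_gradient_compose[OF has_gradient_norm[OF assms(1)] assms(2)] by (simp add: divide_inverse)

text \<open>In polar coordinates, the field \<open>C Z x + B \<nabla>Z\<close> with radial \<open>C\<close>, \<open>B\<close> and a function \<open>Z\<close> of the
  direction only: the gradient of \<open>Z\<close> is tangential, so the cross terms vanish. Both the flat
  gradient and the metric gradient of a product \<open>y(|x|) Z(x)\<close> have this form.\<close>

lemma divergence_polar_field:
  fixes x :: "real^'n::finite"
  assumes x: "x \<noteq> 0"
    and C: "(C has_real_derivative C') (at (norm x))" and B: "(B has_real_derivative B') (at (norm x))"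
    and Z: "has_gradient Z (g x) x" and g: "g differentiable (at x)" and orth: "g x \<bullet> x = 0"
  shows "divergence (\<lambda>y. (C (norm y) * Z y) *\<^sub>R y + B (norm y) *\<^sub>R g y) x =
    (norm x * C' + real CARD('n) * C (norm x)) * Z x + B (norm x) * divergence g x"
proof -
  note gC = has_gradient_radial[OF x C] and gB = has_gradient_radial[OF x B]
  note gCZ = has_gradient_mult[OF gC Z]
  have d: "(\<lambda>y. (C (norm y) * Z y) *\<^sub>R y) differentiable (at x)"
    "(\<lambda>y. B (norm y) *\<^sub>R g y) differentiable (at x)"
    using has_gradient_imp_differentiable[OF gCZ] has_gradient_imp_differentiable[OF gB] g
    by auto
  have "x \<bullet> x = norm x * norm x" by (simp add: dot_square_norm power2_eq_square)
  then have "divergence (\<lambda>y. (C (norm y) * Z y) *\<^sub>R y) x =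
      C (norm x) * Z x * real CARD('n) + Z x * (C' * norm x)"
    using x by (subst divergence_scaleR[OF gCZ]) (auto simp: divergence_id inner_add_left orth)
  moreover have "divergence (\<lambda>y. B (norm y) *\<^sub>R g y) x = B (norm x) * divergence g x"
    using orth by (subst divergence_scaleR[OF gB g]) (simp add: inner_commute)
  ultimately show ?thesis
    by (subst divergence_add[OF d]) (simp add: algebra_simps)
qed

lemma has_gradient_polar_product:
  assumes "x \<noteq> 0" "(F has_real_derivative F') (at (norm x))" "has_gradient Z (g x) x"
  shows "has_gradient (\<lambda>y. F (norm y) * Z y) ((F' / norm x * Z x) *\<^sub>R x + F (norm x) *\<^sub>R g x) x"
  using has_gradient_mult[OF has_gradient_radial[OF assms(1,2)] assms(3)]
  by (simp add: add.commute mult.commute)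

text \<open>A function \<open>Z\<close> of the direction only: its gradient \<open>g\<close> is tangential. \<open>D\<close> is its Laplacian, stated
  as the divergence of \<open>g\<close>.\<close>

definition angular ::
  "(real^'n::finite \<Rightarrow> real) \<Rightarrow> (real^'n \<Rightarrow> real^'n) \<Rightarrow> (real^'n \<Rightarrow> real) \<Rightarrow> bool"
where
  "angular Z g D \<longleftrightarrow> (\<forall>x. x \<noteq> 0 \<longrightarrow> has_gradient Z (g x) x \<and> g differentiable (at x) \<and>
     g x \<bullet> x = 0 \<and> divergence g x = D x)"

lemma laplacian_polar_product:
  fixes x :: "real^'n::finite"
  assumes x: "x \<noteq> 0" and Z: "angular Z g D"
    and F: "\<And>r. 0 < r \<Longrightarrow> (F has_real_derivative F' r) (at r)"
    and F': "(F' has_real_derivative F'') (at (norm x))"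
  shows "laplacian (\<lambda>y. F (norm y) * Z y) x =
    (F'' + (real CARD('n) - 1) / norm x * F' (norm x)) * Z x + F (norm x) * D x"
proof -
  have "laplacian (\<lambda>y. F (norm y) * Z y) x =
      divergence (\<lambda>y. (F' (norm y) / norm y * Z y) *\<^sub>R y + F (norm y) *\<^sub>R g y) x"
  proof (rule laplacian_eq_divergence[where U = "- {0}"])
    show "has_gradient (\<lambda>y. F (norm y) * Z y)
        ((F' (norm y) / norm y * Z y) *\<^sub>R y + F (norm y) *\<^sub>R g y) y" if "y \<in> - {0}" for y
      using that Z by (intro has_gradient_polar_product F) (auto simp: angular_def)
  qed (use x in auto)
  also have "\<dots> = (norm x * ((F'' * norm x - F' (norm x)) / (norm x)\<^sup>2) +
      real CARD('n) * (F' (norm x) / norm x)) * Z x + F (norm x) * divergence g x"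
  proof (rule divergence_polar_field[OF x])
    show "((\<lambda>r. F' r / r) has_real_derivative (F'' * norm x - F' (norm x)) / (norm x)\<^sup>2) (at (norm x))"
      using x by (auto intro!: derivative_eq_intros F' simp: power2_eq_square field_simps)
    show "(F has_real_derivative F' (norm x)) (at (norm x))" using x by (intro F) simp
  qed (use x Z in \<open>auto simp: angular_def\<close>)
  also have "norm x * ((F'' * norm x - F' (norm x)) / (norm x)\<^sup>2) +
      real CARD('n) * (F' (norm x) / norm x) = F'' + (real CARD('n) - 1) / norm x * F' (norm x)"
    using x by (simp add: power2_eq_square field_simps)
  finally show ?thesis
    using x Z by (simp add: angular_def)
qed

lemma angular_one: "angular (\<lambda>x. 1) (\<lambda>x. 0) (\<lambda>x. 0)"
  unfolding angular_def by (auto simp: divergence_const intro!: has_gradientI[OF has_derivative_const])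

text \<open>The cosine of the angle between \<open>x\<close> and \<open>e\<close>, for a unit vector \<open>e\<close>.\<close>

definition zonal :: "real^'n::finite \<Rightarrow> real^'n \<Rightarrow> real"
where "zonal e x = (x \<bullet> e) / norm x"

definition zonal_gradient :: "real^'n::finite \<Rightarrow> real^'n \<Rightarrow> real^'n"
where "zonal_gradient e x = (1 / norm x) *\<^sub>R e - ((x \<bullet> e) / norm x ^ 3) *\<^sub>R x"

lemma has_gradient_zonal:
  assumes x: "x \<noteq> 0"
  shows "has_gradient (zonal e) (zonal_gradient e x) x"
proof -
  have "has_gradient (\<lambda>y. (y \<bullet> e) * (1 / norm y))
      ((x \<bullet> e) *\<^sub>R ((- 1 / (norm x)\<^sup>2 / norm x) *\<^sub>R x) + (1 / norm x) *\<^sub>R e) x"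
    using x by (intro has_gradient_mult has_gradient_inner has_gradient_radial)
      (auto intro!: derivative_eq_intros simp: power2_eq_square field_simps)
  moreover have "(\<lambda>y. (y \<bullet> e) * (1 / norm y)) = zonal e" by (auto simp: zonal_def)
  moreover have "(x \<bullet> e) *\<^sub>R ((- 1 / (norm x)\<^sup>2 / norm x) *\<^sub>R x) + (1 / norm x) *\<^sub>R e = zonal_gradient e x"
    by (simp add: zonal_gradient_def power2_eq_square power3_eq_cube)
  ultimately show ?thesis by simp
qed

lemma divergence_zonal_gradient:
  fixes x e :: "real^'n::finite"
  assumes x: "x \<noteq> 0"
  shows "zonal_gradient e differentiable (at x)"
    and "divergence (zonal_gradient e) x = - (real CARD('n) - 1) / (norm x)\<^sup>2 * zonal e x"
proof -
  let ?a = "\<lambda>y::real^'n. 1 / norm y" and ?b = "\<lambda>y::real^'n. (y \<bullet> e) * (- 1 / norm y ^ 3)"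
  have zg: "zonal_gradient e = (\<lambda>y. ?a y *\<^sub>R e + ?b y *\<^sub>R y)"
    by (auto simp: zonal_gradient_def)
  have a: "has_gradient ?a ((- 1 / (norm x)\<^sup>2 / norm x) *\<^sub>R x) x"
    using x by (intro has_gradient_radial)
      (auto intro!: derivative_eq_intros simp: power2_eq_square field_simps)
  have b: "has_gradient ?b ((x \<bullet> e) *\<^sub>R ((3 / norm x ^ 4 / norm x) *\<^sub>R x) + (- 1 / norm x ^ 3) *\<^sub>R e) x"
    using x by (intro has_gradient_mult has_gradient_inner has_gradient_radial)
      (auto intro!: derivative_eq_intros simp: power2_eq_square power3_eq_cube power4_eq_xxxx field_simps)
  have d: "(\<lambda>y. ?a y *\<^sub>R e) differentiable (at x)" "(\<lambda>y. ?b y *\<^sub>R y) differentiable (at x)"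
    by (rule differentiable_scaleR[OF has_gradient_imp_differentiable[OF a] differentiable_const],
        rule differentiable_scaleR[OF has_gradient_imp_differentiable[OF b] differentiable_ident])
  show "zonal_gradient e differentiable (at x)"
    unfolding zg using d by (rule differentiable_add)
  have xx: "x \<bullet> x = norm x * norm x" by (simp add: dot_square_norm power2_eq_square)
  have da: "divergence (\<lambda>y. ?a y *\<^sub>R e) x = (- 1 / (norm x)\<^sup>2 / norm x) * (x \<bullet> e)"
    by (subst divergence_scaleR[OF a]) (simp_all add: divergence_const)
  have db: "divergence (\<lambda>y. ?b y *\<^sub>R y) x = ?b x * real CARD('n) +
      ((x \<bullet> e) * ((3 / norm x ^ 4 / norm x) * (norm x * norm x)) + (- 1 / norm x ^ 3) * (x \<bullet> e))"
    by (subst divergence_scaleR[OF b]) (simp_all add: divergence_id inner_add_left inner_diff_left xx inner_commute[of e])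
  show "divergence (zonal_gradient e) x = - (real CARD('n) - 1) / (norm x)\<^sup>2 * zonal e x"
    unfolding zg divergence_add[OF d] da db using x
    by (simp add: zonal_def power2_eq_square power3_eq_cube power4_eq_xxxx field_simps)
qed

lemma zonal_gradient_inner_self: "x \<noteq> 0 \<Longrightarrow> zonal_gradient e x \<bullet> x = 0"
  by (simp add: zonal_gradient_def inner_diff_left dot_square_norm power2_eq_square power3_eq_cube
      inner_commute[of e])

text \<open>The coordinate functions restricted to the unit sphere are eigenfunctions of the spherical
  Laplacian for the eigenvalue \<open>n - 1\<close>.\<close>

lemma angular_zonal:
  fixes e :: "real^'n::finite"
  shows "angular (zonal e) (zonal_gradient e) (\<lambda>x. - (real CARD('n) - 1) / (norm x)\<^sup>2 * zonal e x)"
  unfolding angular_def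
  by (auto simp: has_gradient_zonal divergence_zonal_gradient zonal_gradient_inner_self)

lemma norm_zonal_gradient:
  assumes "x \<noteq> 0" "norm e = 1"
  shows "zonal_gradient e x \<bullet> zonal_gradient e x = (1 - (zonal e x)\<^sup>2) / (norm x)\<^sup>2"
proof -
  have "e \<bullet> e = 1" "x \<bullet> x = norm x * norm x"
    using assms(2) by (simp_all add: dot_square_norm power2_eq_square)
  then show ?thesis
    using assms(1)
    by (simp add: zonal_gradient_def zonal_def inner_diff_left inner_diff_right inner_commute
        power2_eq_square power3_eq_cube field_simps)
qed

lemma angular_compose_zonal:
  fixes e :: "real^'n::finite"
  assumes e: "norm e = 1" and \<kappa>: "\<And>z. (\<kappa> has_real_derivative \<kappa>' z) (at z)"
    and \<kappa>': "\<And>z. (\<kappa>' has_real_derivative \<kappa>'' z) (at z)"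
  shows "angular (\<lambda>x. \<kappa> (zonal e x)) (\<lambda>x. \<kappa>' (zonal e x) *\<^sub>R zonal_gradient e x)
    (\<lambda>x. ((1 - (zonal e x)\<^sup>2) * \<kappa>'' (zonal e x) - (real CARD('n) - 1) * zonal e x * \<kappa>' (zonal e x))
       / (norm x)\<^sup>2)"
  unfolding angular_def
proof (intro allI impI conjI)
  fix x :: "real^'n" assume x: "x \<noteq> 0"
  note gz = has_gradient_zonal[OF x, of e]
  note g' = has_gradient_compose[OF gz \<kappa>']
  show "has_gradient (\<lambda>x. \<kappa> (zonal e x)) (\<kappa>' (zonal e x) *\<^sub>R zonal_gradient e x) x"
    by (rule has_gradient_compose[OF gz \<kappa>])
  show "(\<lambda>x. \<kappa>' (zonal e x) *\<^sub>R zonal_gradient e x) differentiable (at x)"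
    using has_gradient_imp_differentiable[OF g'] divergence_zonal_gradient(1)[OF x]
    by (rule differentiable_scaleR)
  show "(\<kappa>' (zonal e x) *\<^sub>R zonal_gradient e x) \<bullet> x = 0"
    by (simp add: zonal_gradient_inner_self[OF x])
  show "divergence (\<lambda>x. \<kappa>' (zonal e x) *\<^sub>R zonal_gradient e x) x =
      ((1 - (zonal e x)\<^sup>2) * \<kappa>'' (zonal e x) - (real CARD('n) - 1) * zonal e x * \<kappa>' (zonal e x))
       / (norm x)\<^sup>2"
    using x by (subst divergence_scaleR[OF g' divergence_zonal_gradient(1)[OF x]])
      (simp add: divergence_zonal_gradient(2) norm_zonal_gradient[OF x e] field_simps)
qed

lemma abs_zonal_le_1: "norm e = 1 \<Longrightarrow> \<bar>zonal e x\<bar> \<le> 1"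
  using Cauchy_Schwarz_ineq2[of x e] by (cases "x = 0") (auto simp: zonal_def)

section \<open>The Laplace--Beltrami operator of a metric of revolution\<close>

text \<open>The symmetric matrix with eigenvalue \<open>1\<close> in the direction of a unit vector \<open>u\<close> and
  eigenvalue \<open>c\<close> on the orthogonal complement.\<close>

definition axial_matrix :: "real \<Rightarrow> real^'n::finite \<Rightarrow> real^'n^'n"
where "axial_matrix c u = (\<chi> i j. c * (if i = j then 1 else 0) + (1 - c) * (u $ i * u $ j))"

lemma axial_matrix_mult_vec:
  "axial_matrix c u *v w = c *\<^sub>R w + ((1 - c) * (u \<bullet> w)) *\<^sub>R u"
proof -
  have "(\<Sum>j\<in>UNIV. (c * (if i = j then 1 else 0) + (1 - c) * (u $ i * u $ j)) * w $ j)
      = c * w $ i + (1 - c) * (u \<bullet> w) * u $ i" for i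
  proof -
    have "(\<Sum>j\<in>UNIV. (c * (if i = j then 1 else 0) + (1 - c) * (u $ i * u $ j)) * w $ j)
        = (\<Sum>j\<in>UNIV. (if i = j then c * w $ j else 0) + (1 - c) * (u $ j * w $ j) * u $ i)"
      by (intro sum.cong) (auto simp: algebra_simps)
    then show ?thesis
      by (simp add: sum.distrib sum_distrib_right[symmetric] sum_distrib_left[symmetric] inner_vec_def)
  qed
  then show ?thesis by (simp add: axial_matrix_def matrix_vector_mult_def vec_eq_iff)
qed

lemma axial_matrix_mult:
  assumes "norm u = 1"
  shows "axial_matrix c u ** axial_matrix d u = axial_matrix (c * d) u"
proof -
  have "u \<bullet> u = 1" using assms by (simp add: dot_square_norm)
  then show ?thesis
    unfolding matrix_eq
    by (simp add: matrix_vector_mul_assoc[symmetric] axial_matrix_mult_vec inner_add_right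
        algebra_simps)
qed

lemma axial_matrix_one: "axial_matrix 1 u = mat 1"
  unfolding matrix_eq by (simp add: axial_matrix_mult_vec)

lemma matrix_inv_eqI:
  fixes A B :: "real^'n^'n"
  assumes "A ** B = mat 1" "B ** A = mat 1"
  shows "matrix_inv A = B"
  unfolding matrix_inv_def
proof (rule some_equality)
  fix B' assume "A ** B' = mat 1 \<and> B' ** A = mat 1"
  then show "B' = B" using assms by (metis matrix_mul_assoc matrix_mul_lid matrix_mul_rid)
qed (use assms in auto)

lemma matrix_inv_axial_matrix:
  assumes "norm u = 1" "c \<noteq> 0"
  shows "matrix_inv (axial_matrix c u) = axial_matrix (1 / c) u"
  using assms by (intro matrix_inv_eqI) (simp_all add: axial_matrix_mult axial_matrix_one)

text \<open>An orthogonal matrix that takes a coordinate axis to \<open>u\<close> makes the matrix diagonal.\<close>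

lemma det_axial_matrix:
  fixes u :: "real^'n::finite"
  assumes u: "norm u = 1"
  shows "det (axial_matrix c u) = c ^ (CARD('n) - 1)"
proof -
  obtain k :: 'n where True by simp
  obtain A where A: "orthogonal_matrix A" "A *v axis k 1 = u"
    using orthogonal_matrix_exists_basis[OF u] by metis
  let ?D = "axial_matrix c (axis k 1 :: real^'n)"
  have inner: "u \<bullet> (A *v w) = axis k 1 \<bullet> w" for w
    using A by (metis orthogonal_transformation_def orthogonal_transformation_matrix
        matrix_of_matrix_vector_mul matrix_vector_mul_linear)
  have "axial_matrix c u ** A = A ** ?D"
    unfolding matrix_eq
    by (simp add: matrix_vector_mul_assoc[symmetric] axial_matrix_mult_vec inner A(2)
        matrix_vector_right_distrib matrix_vector_mult_scaleR)
  then have "det (axial_matrix c u) * det A = det A * det ?D" by (metis det_mul)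
  moreover have "det A \<noteq> 0"
    using det_orthogonal_matrix[OF A(1)] by auto
  ultimately have "det (axial_matrix c u) = det ?D" by simp
  also have "\<dots> = (\<Prod>i\<in>UNIV. ?D $ i $ i)"
    by (rule det_diagonal) (auto simp: axial_matrix_def axis_def)
  also have "\<dots> = ?D $ k $ k * (\<Prod>i\<in>UNIV - {k}. ?D $ i $ i)"
    by (simp add: prod.remove[of _ k])
  also have "(\<Prod>i\<in>UNIV - {k}. ?D $ i $ i) = (\<Prod>i\<in>UNIV - {k}. c)"
    by (intro prod.cong) (auto simp: axial_matrix_def axis_def)
  finally show ?thesis by (simp add: axial_matrix_def card_Diff_singleton)
qed

lemma polar_has_derivative:
  fixes x :: "real^'n::finite"
  assumes "x \<noteq> 0"
  shows "(polar has_derivative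
    (\<lambda>v. ((x \<bullet> v) / norm x, (1 / norm x) *\<^sub>R v - ((x \<bullet> v) / norm x ^ 3) *\<^sub>R x))) (at x)"
proof -
  have n: "(norm has_derivative (\<lambda>v. (x \<bullet> v) / norm x)) (at x)"
    using has_gradient_norm[OF assms] by (simp add: has_gradient_def divide_inverse mult.commute)
  have "has_gradient (\<lambda>y. inverse (norm y)) ((- (1 / (norm x)\<^sup>2) / norm x) *\<^sub>R x) x"
    using assms by (intro has_gradient_radial) (auto intro!: derivative_eq_intros simp: field_simps power2_eq_square)
  then have i: "((\<lambda>y. inverse (norm y)) has_derivative (\<lambda>v. - (x \<bullet> v) / norm x ^ 3)) (at x)"
    by (simp add: has_gradient_def power2_eq_square power3_eq_cube)
  have "polar = (\<lambda>y::real^'n. (norm y - 1, inverse (norm y) *\<^sub>R y))"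
    by (auto simp: polar_def)
  moreover have "((\<lambda>y. (norm y - 1, inverse (norm y) *\<^sub>R y)) has_derivative
      (\<lambda>v. ((x \<bullet> v) / norm x, (1 / norm x) *\<^sub>R v - ((x \<bullet> v) / norm x ^ 3) *\<^sub>R x))) (at x)"
  proof (rule has_derivative_eq_rhs)
    show "((\<lambda>y. (norm y - 1, inverse (norm y) *\<^sub>R y)) has_derivative
        (\<lambda>v. ((x \<bullet> v) / norm x - 0, inverse (norm x) *\<^sub>R v + (- (x \<bullet> v) / norm x ^ 3) *\<^sub>R x))) (at x)"
      by (intro has_derivative_Pair has_derivative_diff has_derivative_scaleR n i has_derivative_ident
          has_derivative_const)
  qed (simp add: divide_inverse)
  ultimately show ?thesis by simp
qed

text \<open>In the chart, radial lengths are kept and tangential lengths are scaled by \<open>h / |x|\<close>.\<close>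

lemma pullback_metric_eq:
  fixes x :: "real^'n::finite"
  assumes x: "x \<noteq> 0"
  shows "pullback_metric h x = axial_matrix ((h (norm x - 1) / norm x)\<^sup>2) (x /\<^sub>R norm x)"
proof -
  let ?r = "norm x"
  have fd: "frechet_derivative polar (at x) =
      (\<lambda>v. ((x \<bullet> v) / ?r, (1 / ?r) *\<^sub>R v - ((x \<bullet> v) / ?r ^ 3) *\<^sub>R x))"
    using frechet_derivative_at[OF polar_has_derivative[OF x]] by simp
  have xx: "x \<bullet> x = ?r * ?r" by (simp add: dot_square_norm power2_eq_square)
  have axis_inner: "axis i (1::real) \<bullet> axis j 1 = (if i = j then 1 else 0)" for i j :: 'n
    by (simp add: inner_axis_axis)
  have E: "((1 / ?r) *\<^sub>R axis i 1 - (x $ i / ?r ^ 3) *\<^sub>R x) \<bullet> ((1 / ?r) *\<^sub>R axis j 1 - (x $ j / ?r ^ 3) *\<^sub>R x)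
      = (if i = j then 1 else 0) / ?r\<^sup>2 - x $ i * x $ j / ?r ^ 4" for i j
    using x by (simp add: inner_diff_left inner_diff_right axis_inner inner_axis[of x] inner_axis'[of _ _ x] xx
        power2_eq_square power3_eq_cube power4_eq_xxxx field_simps)
  have "pullback_metric h x $ i $ j = axial_matrix ((h (?r - 1) / ?r)\<^sup>2) (x /\<^sub>R ?r) $ i $ j" for i j
  proof -
    have "pullback_metric h x $ i $ j = x $ i / ?r * (x $ j / ?r) +
        (h (?r - 1))\<^sup>2 * ((if i = j then 1 else 0) / ?r\<^sup>2 - x $ i * x $ j / ?r ^ 4)"
      unfolding E[symmetric] by (simp add: pullback_metric_def revolution_metric_def fd inner_axis polar_def)
    also have "\<dots> = axial_matrix ((h (?r - 1) / ?r)\<^sup>2) (x /\<^sub>R ?r) $ i $ j"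
      using x by (simp add: axial_matrix_def power2_eq_square power4_eq_xxxx field_simps)
    finally show ?thesis .
  qed
  then show ?thesis by (simp add: vec_eq_iff)
qed

text \<open>Separation of variables: on products of a function of \<open>r\<close> and an angular eigenfunction, the
  equation \<open>\<Delta>u = 0\<close> becomes the Sturm--Liouville equation
  \<open>(h\<^sup>n\<^sup>-\<^sup>1 y')' = \<mu> h\<^sup>n\<^sup>-\<^sup>3 y\<close>, written here as a first-order system for \<open>y\<close> and the flux
  \<open>z = h\<^sup>n\<^sup>-\<^sup>1 y'\<close>.\<close>

lemma laplace_beltrami_polar_product:
  fixes x :: "real^'n::finite"
  assumes n: "CARD('n) = m + 3" and V: "open V" and x: "x \<noteq> 0" "norm x - 1 \<in> V"
    and h: "\<And>t. t \<in> V \<Longrightarrow> 0 < h t" "\<And>t. t \<in> V \<Longrightarrow> h differentiable (at t)"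
    and y: "\<And>t. t \<in> V \<Longrightarrow> (y has_real_derivative z t / h t ^ (m + 2)) (at t)"
    and z: "\<And>t. t \<in> V \<Longrightarrow> (z has_real_derivative \<mu> * h t ^ m * y t) (at t)"
    and Z: "angular Z g (\<lambda>x. - \<mu> / (norm x)\<^sup>2 * Z x)"
  shows "laplace_beltrami (pullback_metric h) (\<lambda>x. y (norm x - 1) * Z x) x = 0"
proof -
  define U where "U = {x::real^'n. x \<noteq> 0 \<and> norm x - 1 \<in> V}"
  define u where "u = (\<lambda>x::real^'n. y (norm x - 1) * Z x)"
  define C where "C r = z (r - 1) / r ^ (m + 3)" for r
  define B where "B r = h (r - 1) ^ m * y (r - 1) / r ^ m" for r
  have "open ((\<lambda>x::real^'n. norm x - 1) -` V)"
    by (rule open_vimage[OF V]) (intro continuous_intros)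
  moreover have "U = - {0} \<inter> (\<lambda>x::real^'n. norm x - 1) -` V" by (auto simp: U_def)
  ultimately have U: "open U" "x \<in> U" using x by (auto simp: U_def)
  have shift: "((\<lambda>r. f (r - 1)) has_real_derivative D) (at s)"
    if "(f has_real_derivative D) (at (s - 1))" for f D and s :: real
    using that DERIV_shift[of f D s "- 1"] by simp
  have field: "sqrt (det (pullback_metric h w)) *
      (\<Sum>j\<in>UNIV. matrix_inv (pullback_metric h w) $ i $ j * pderiv_at j u w)
      = ((C (norm w) * Z w) *\<^sub>R w + B (norm w) *\<^sub>R g w) $ i" if "w \<in> U" for w i
  proof -
    let ?r = "norm w" and ?h = "h (norm w - 1)"
    have w: "w \<noteq> 0" "?r - 1 \<in> V" and hp: "?h > 0" and wr: "norm (w /\<^sub>R ?r) = 1"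
      using that h by (auto simp: U_def)
    let ?c = "(?h / ?r)\<^sup>2"
    define G where "G = (z (?r - 1) / ?h ^ (m + 2) / ?r * Z w) *\<^sub>R w + y (?r - 1) *\<^sub>R g w"
    have "has_gradient u G w"
      unfolding u_def G_def using Z w(1)
      by (intro has_gradient_polar_product[where F = "\<lambda>r. y (r - 1)"] shift[OF y[OF w(2)]])
        (auto simp: angular_def)
    then have pd: "pderiv_at j u w = G $ j" for j by (rule pderiv_at_has_gradient)
    have gw: "g w \<bullet> w = 0" using Z w by (auto simp: angular_def)
    have wG: "w \<bullet> G = z (?r - 1) / ?h ^ (m + 2) * Z w * ?r"
      using w gw unfolding G_def
      by (simp add: inner_add_right inner_commute[of w] dot_square_norm power2_eq_square)
    have "matrix_inv (pullback_metric h w) *v G = (1 / ?c) *\<^sub>R G + ((1 - 1 / ?c) * (w \<bullet> G) / ?r\<^sup>2) *\<^sub>R w"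
      using w hp by (simp add: pullback_metric_eq[OF w(1)] matrix_inv_axial_matrix[OF wr]
          axial_matrix_mult_vec power2_eq_square divide_inverse mult_ac)
    also have "\<dots> = (z (?r - 1) / ?h ^ (m + 2) / ?r * Z w) *\<^sub>R w + (y (?r - 1) / ?c) *\<^sub>R g w"
      unfolding wG unfolding G_def scaleR_add_right scaleR_scaleR
      using w hp by (simp add: scaleR_left_distrib[symmetric] power2_eq_square field_simps)
    finally have inv: "matrix_inv (pullback_metric h w) *v G = \<dots>" .
    have "det (pullback_metric h w) = ((?h / ?r) ^ (m + 2))\<^sup>2"
    proof -
      have "CARD('n) - 1 = m + 2" using n by simp
      then have "det (pullback_metric h w) = ?c ^ (m + 2)"
        by (simp only: pullback_metric_eq[OF w(1)] det_axial_matrix[OF wr])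
      then show ?thesis by (simp only: power_mult[symmetric] mult.commute)
    qed
    then have sq: "sqrt (det (pullback_metric h w)) = (?h / ?r) ^ (m + 2)"
      using hp w by (simp add: real_sqrt_abs)
    have "(\<Sum>j\<in>UNIV. matrix_inv (pullback_metric h w) $ i $ j * pderiv_at j u w)
        = (matrix_inv (pullback_metric h w) *v G) $ i"
      by (simp add: matrix_vector_mult_def pd)
    then have "sqrt (det (pullback_metric h w)) *
        (\<Sum>j\<in>UNIV. matrix_inv (pullback_metric h w) $ i $ j * pderiv_at j u w)
      = ((?h / ?r) ^ (m + 2) * (z (?r - 1) / ?h ^ (m + 2) / ?r * Z w)) * w $ i
        + ((?h / ?r) ^ (m + 2) * (y (?r - 1) / ?c)) * g w $ i"
      unfolding sq inv by (simp add: distrib_left)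
    also have "(?h / ?r) ^ (m + 2) * (z (?r - 1) / ?h ^ (m + 2) / ?r * Z w) = C ?r * Z w"
      using hp w by (simp add: C_def power_divide power_add power2_eq_square power3_eq_cube field_simps)
    also have "(?h / ?r) ^ (m + 2) * (y (?r - 1) / ?c) = B ?r"
      using hp w by (simp add: B_def power_divide power_add power2_eq_square field_simps)
    finally show ?thesis by simp
  qed
  let ?t = "norm x - 1"
  obtain h' where h': "(h has_real_derivative h') (at ?t)"
    using h(2)[OF x(2)] real_differentiable_def by blast
  have C': "(C has_real_derivative (\<mu> * h ?t ^ m * y ?t * norm x ^ (m + 3) - z ?t * (real (m + 3) * norm x ^ (m + 2)))
      / (norm x ^ (m + 3))\<^sup>2) (at (norm x))"
    unfolding C_def using x
    by (auto intro!: derivative_eq_intros shift[OF z[OF x(2)]] simp: power2_eq_square)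
  have "\<exists>B'. (B has_real_derivative B') (at (norm x))"
    unfolding B_def using x
    by (auto intro!: exI derivative_eq_intros shift[OF y[OF x(2)]] shift[OF h'])
  then obtain B' where B': "(B has_real_derivative B') (at (norm x))" by blast
  have "laplace_beltrami (pullback_metric h) u x = 1 / sqrt (det (pullback_metric h x)) *
      divergence (\<lambda>w. (C (norm w) * Z w) *\<^sub>R w + B (norm w) *\<^sub>R g w) x"
    unfolding laplace_beltrami_def divergence_def
    by (intro arg_cong2[where f = "(*)"] sum.cong pderiv_at_cong[OF U] refl field)
  also have "divergence (\<lambda>w. (C (norm w) * Z w) *\<^sub>R w + B (norm w) *\<^sub>R g w) x = 0"
  proof -
    have "norm x * ((\<mu> * h ?t ^ m * y ?t * norm x ^ (m + 3) - z ?t * (real (m + 3) * norm x ^ (m + 2)))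
      / (norm x ^ (m + 3))\<^sup>2) + real (m + 3) * C (norm x) = \<mu> * B (norm x) / (norm x)\<^sup>2"
      using x by (simp add: B_def C_def power_add power2_eq_square power3_eq_cube field_simps)
    moreover have "has_gradient Z (g x) x" "g differentiable (at x)" "g x \<bullet> x = 0"
      "divergence g x = - \<mu> / (norm x)\<^sup>2 * Z x"
      using Z x by (auto simp: angular_def)
    ultimately show ?thesis
      by (subst divergence_polar_field[OF x(1) C' B']) (simp_all only: n, simp add: field_simps)
  qed
  finally show ?thesis unfolding u_def by simp
qed

section \<open>Linear first-order systems with continuous coefficients\<close>

lemma antiderivative_exists:
  fixes f :: "real \<Rightarrow> real"
  assumes "continuous_on UNIV f"
  shows "\<exists>F. F 0 = 0 \<and> (\<forall>r. (F has_real_derivative f r) (at r))"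
proof (intro exI conjI allI)
  let ?F = "\<lambda>u::real. LBINT s=0..u. f s"
  show "?F 0 = 0" by (simp add: zero_ereal_def)
  fix r :: real
  let ?T = "\<bar>r\<bar> + 1"
  have "(?F has_vector_derivative f r) (at r within {- ?T..?T})"
    using interval_integral_FTC2[of "- ?T" 0 ?T f r] continuous_on_subset[OF assms]
    by (auto simp: zero_ereal_def)
  then show "(?F has_real_derivative f r) (at r)"
    by (simp add: has_real_derivative_iff_has_vector_derivative at_within_Icc_at)
qed

text \<open>The step from one Picard iterate to the next in the bound \<open>C (M |r|)\<^sup>k / k!\<close>.\<close>

lemma abs_le_power_of_derivative:
  fixes F :: "real \<Rightarrow> real"
  assumes F0: "F 0 = 0" and F: "\<And>s. (F has_real_derivative f s) (at s)"
    and f: "\<And>s. \<bar>f s\<bar> \<le> K * \<bar>s\<bar> ^ k"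
  shows "\<bar>F r\<bar> \<le> K * \<bar>r\<bar> ^ Suc k / real (Suc k)"
proof -
  have pos: "G r \<le> K * r ^ Suc k / real (Suc k)"
    if G0: "G 0 = 0" and G: "\<And>s. (G has_real_derivative g s) (at s)"
      and g: "\<And>s. \<bar>g s\<bar> \<le> K * \<bar>s\<bar> ^ k" and r: "0 \<le> r" for G g r
  proof -
    have "K * 0 ^ Suc k / real (Suc k) - G 0 \<le> K * r ^ Suc k / real (Suc k) - G r"
    proof (rule DERIV_nonneg_imp_nondecreasing[OF r])
      fix s assume s: "0 \<le> s" "s \<le> r"
      have "((\<lambda>s. K * s ^ Suc k / real (Suc k) - G s) has_real_derivative
          K * (real (Suc k) * s ^ k) / real (Suc k) - g s) (at s)"
        using DERIV_power[OF DERIV_ident, of "Suc k" s UNIV]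
        by (intro DERIV_diff DERIV_cdivide DERIV_cmult G) simp
      moreover have "0 \<le> K * (real (Suc k) * s ^ k) / real (Suc k) - g s"
        using g[of s] s by (simp del: of_nat_Suc)
      ultimately show "\<exists>D. ((\<lambda>s. K * s ^ Suc k / real (Suc k) - G s) has_real_derivative D) (at s) \<and> 0 \<le> D"
        by blast
    qed
    then show ?thesis using G0 by simp
  qed
  have neg: "((\<lambda>s. - H s) has_real_derivative - D s) (at s)"
    "((\<lambda>s. H (- s)) has_real_derivative - D (- s)) (at s)"
    if "\<And>s. (H has_real_derivative D s) (at s)" for H D and s :: real
    using that[of s] that[of "- s"] DERIV_mirror[of H "D (- s)" "s"] by (auto intro: DERIV_minus)
  note F' = neg[OF F] and F'' = neg(1)[OF neg(2)[OF F]]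
  show ?thesis
  proof (cases "0 \<le> r")
    case True
    then show ?thesis
      using pos[OF F0 F f True] pos[of "\<lambda>s. - F s", OF _ F'(1) _ True] F0 f by (auto simp: abs_le_iff)
  next
    case False
    then have "0 \<le> - r" by simp
    moreover have "\<bar>f (- s)\<bar> \<le> K * \<bar>s\<bar> ^ k" for s using f[of "- s"] by simp
    ultimately show ?thesis
      using False pos[of "\<lambda>s. F (- s)", OF _ F'(2), of "- r"]
        pos[of "\<lambda>s. - F (- s)", OF _ F'', of "- r"] F0
      by (simp add: abs_le_iff)
  qed
qed

text \<open>The iterates are bounded by the terms of an exponential series, hence the series of their
  derivatives converges uniformly on bounded intervals and may be summed termwise.\<close>

lemma picard_series_derivative:
  fixes Y Z :: "nat \<Rightarrow> real \<Rightarrow> real"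
  assumes Y0: "Y 0 = (\<lambda>_. A)" and Y: "\<And>k r. (Y (Suc k) has_real_derivative p r * Z k r) (at r)"
    and p: "\<And>r. \<bar>p r\<bar> \<le> M"
    and bY: "\<And>k r. \<bar>Y k r\<bar> \<le> C * (M * \<bar>r\<bar>) ^ k / fact k"
    and bZ: "\<And>k r. \<bar>Z k r\<bar> \<le> C * (M * \<bar>r\<bar>) ^ k / fact k"
  shows "((\<lambda>r. \<Sum>k. Y k r) has_real_derivative p r * (\<Sum>k. Z k r)) (at r)"
proof -
  define T where "T = \<bar>r\<bar> + 1"
  define f' where "f' n s = (case n of 0 \<Rightarrow> 0 | Suc k \<Rightarrow> p s * Z k s)" for n s
  define bnd where "bnd n = (case n of 0 \<Rightarrow> 0 | Suc k \<Rightarrow> M * (C * (M * T) ^ k / fact k))" for n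
  have M: "0 \<le> M" using p[of 0] by linarith
  have C: "0 \<le> C" using bY[of 0 0] by simp
  have sums: "summable (\<lambda>k. C * (M * t) ^ k / fact k)" for t :: real
    using summable_mult[OF summable_exp[of "M * t"], of C] by (simp add: divide_inverse mult_ac)
  have sZ: "summable (\<lambda>k. Z k s)" and sY: "summable (\<lambda>k. Y k s)" for s
    by (rule summable_comparison_test'[OF sums[of "\<bar>s\<bar>"], of 0], simp add: bZ bY)+
  have "summable (\<lambda>n. bnd (Suc n))"
    using summable_mult[OF sums[of T], of M] by (simp add: bnd_def)
  then have sb: "summable bnd" by (simp add: summable_Suc_iff)
  have der: "(Y n has_real_derivative f' n s) (at s within {- T..T})" for n s
    by (cases n) (auto simp: f'_def Y0 intro: has_field_derivative_at_within[OF Y])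
  have uc: "uniformly_convergent_on {- T..T} (\<lambda>n s. \<Sum>i<n. f' i s)"
  proof (rule Weierstrass_m_test'[OF _ sb])
    fix n s assume s: "s \<in> {- T..T}"
    show "norm (f' n s) \<le> bnd n"
    proof (cases n)
      case (Suc k)
      have "C * (M * \<bar>s\<bar>) ^ k / fact k \<le> C * (M * T) ^ k / fact k"
        using s M C by (intro divide_right_mono mult_left_mono power_mono) auto
      then have "\<bar>p s\<bar> * \<bar>Z k s\<bar> \<le> M * (C * (M * T) ^ k / fact k)"
        using bZ[of k s] p[of s] M by (intro mult_mono) auto
      then show ?thesis using Suc by (simp add: f'_def bnd_def abs_mult)
    qed (simp add: f'_def bnd_def)
  qed
  have "((\<lambda>s. \<Sum>n. Y n s) has_real_derivative (\<Sum>n. f' n r)) (at r)"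
    by (rule has_field_derivative_series'(2)[OF convex_real_interval(5) der uc _ sY, of 0])
      (auto simp: T_def)
  moreover have "(\<Sum>n. f' n r) = p r * (\<Sum>k. Z k r)"
  proof -
    have s1: "summable (\<lambda>n. f' (Suc n) r)" using summable_mult[OF sZ[of r], of "p r"] by (simp add: f'_def)
    then have "summable (\<lambda>n. f' n r)" by (rule summable_Suc_iff[THEN iffD1])
    from suminf_split_head[OF this] have "(\<Sum>n. f' n r) = (\<Sum>n. f' (Suc n) r)" by (simp add: f'_def)
    also have "\<dots> = p r * (\<Sum>k. Z k r)" using suminf_mult[OF sZ[of r], of "p r"] by (simp add: f'_def)
    finally show ?thesis .
  qed
  ultimately show ?thesis by simp
qed

lemma linear_system_solution_bounded:
  fixes p q :: "real \<Rightarrow> real"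
  assumes cont: "continuous_on UNIV p" "continuous_on UNIV q"
    and bound: "\<And>r. \<bar>p r\<bar> \<le> M" "\<And>r. \<bar>q r\<bar> \<le> M"
  shows "\<exists>y z. y 0 = A \<and> z 0 = B \<and> (\<forall>r. (y has_real_derivative p r * z r) (at r)) \<and>
     (\<forall>r. (z has_real_derivative q r * y r) (at r))"
proof -
  obtain I where I: "I f 0 = 0" "(I f has_real_derivative f r) (at r)"
    if "continuous_on UNIV f" for f :: "real \<Rightarrow> real" and r
    using antiderivative_exists by metis
  define P where "P = rec_nat ((\<lambda>r::real. A), (\<lambda>r::real. B))
    (\<lambda>k YZ. (I (\<lambda>s. p s * snd YZ s), I (\<lambda>s. q s * fst YZ s)))"
  define Y where "Y k = fst (P k)" for k
  define Z where "Z k = snd (P k)" for k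
  have Y0: "Y 0 = (\<lambda>r. A)" and Z0: "Z 0 = (\<lambda>r. B)" by (simp_all add: Y_def Z_def P_def)
  have YS: "Y (Suc k) = I (\<lambda>s. p s * Z k s)" and ZS: "Z (Suc k) = I (\<lambda>s. q s * Y k s)" for k
    by (simp_all add: Y_def Z_def P_def)
  have cI: "continuous_on UNIV (I f)" if "continuous_on UNIV f" for f
    using I(2)[OF that] by (intro continuous_at_imp_continuous_on) (auto intro: DERIV_isCont)
  have cYZ: "continuous_on UNIV (Y k) \<and> continuous_on UNIV (Z k)" for k
  proof (induction k)
    case (Suc k)
    then show ?case unfolding YS ZS by (intro conjI cI continuous_on_mult cont) auto
  qed (simp add: Y0 Z0)
  have cp: "continuous_on UNIV (\<lambda>s. p s * Z k s)" "continuous_on UNIV (\<lambda>s. q s * Y k s)" for k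
    using cYZ cont by (auto intro: continuous_on_mult)
  have dY: "(Y (Suc k) has_real_derivative p r * Z k r) (at r)"
    and dZ: "(Z (Suc k) has_real_derivative q r * Y k r) (at r)"
    and YS0: "Y (Suc k) 0 = 0" and ZS0: "Z (Suc k) 0 = 0" for k r
    unfolding YS ZS using I[OF cp(1)] I[OF cp(2)] by auto
  have M: "0 \<le> M" using bound(1)[of 0] by linarith
  define C where "C = \<bar>A\<bar> + \<bar>B\<bar>"
  have step: "\<bar>F r\<bar> \<le> C * (M * \<bar>r\<bar>) ^ Suc k / fact (Suc k)"
    if F0: "F 0 = 0" and F: "\<And>s. (F has_real_derivative c s * G s) (at s)"
      and c: "\<And>s. \<bar>c s\<bar> \<le> M" and G: "\<And>s. \<bar>G s\<bar> \<le> C * (M * \<bar>s\<bar>) ^ k / fact k"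
    for F G c :: "real \<Rightarrow> real" and r k
  proof -
    have "\<bar>c s * G s\<bar> \<le> (C * M ^ Suc k / fact k) * \<bar>s\<bar> ^ k" for s
    proof -
      have "\<bar>c s\<bar> * \<bar>G s\<bar> \<le> M * (C * (M * \<bar>s\<bar>) ^ k / fact k)"
        using c[of s] G[of s] M by (intro mult_mono) auto
      then show ?thesis by (simp add: abs_mult power_mult_distrib mult_ac)
    qed
    from abs_le_power_of_derivative[OF F0 F this, of r] show ?thesis
      by (simp add: power_mult_distrib mult_ac)
  qed
  have b: "(\<forall>r. \<bar>Y k r\<bar> \<le> C * (M * \<bar>r\<bar>) ^ k / fact k) \<and> (\<forall>r. \<bar>Z k r\<bar> \<le> C * (M * \<bar>r\<bar>) ^ k / fact k)" for k
  proof (induction k)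
    case 0
    then show ?case by (simp add: Y0 Z0 C_def)
  next
    case (Suc k)
    then show ?case
      using step[OF YS0 dY bound(1)] step[OF ZS0 dZ bound(2)] by blast
  qed
  then have bY: "\<bar>Y k r\<bar> \<le> C * (M * \<bar>r\<bar>) ^ k / fact k" and bZ: "\<bar>Z k r\<bar> \<le> C * (M * \<bar>r\<bar>) ^ k / fact k" for k r
    by auto
  have at0: "(\<Sum>k. X k 0) = X 0 0" if "\<And>k. X (Suc k) 0 = 0" for X :: "nat \<Rightarrow> real \<Rightarrow> real"
  proof -
    have "(\<lambda>k. X k 0) sums (\<Sum>k\<in>{0}. X k 0)"
      by (rule sums_finite) (use that gr0_conv_Suc in auto)
    then show ?thesis by (simp add: sums_iff)
  qed
  show ?thesis
  proof (intro exI conjI allI)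
    show "(\<Sum>k. Y k 0) = A" using at0[of Y, OF YS0] by (simp add: Y0)
    show "(\<Sum>k. Z k 0) = B" using at0[of Z, OF ZS0] by (simp add: Z0)
    show "((\<lambda>r. \<Sum>k. Y k r) has_real_derivative p r * (\<Sum>k. Z k r)) (at r)" for r
      by (rule picard_series_derivative[OF Y0 dY bound(1) bY bZ])
    show "((\<lambda>r. \<Sum>k. Z k r) has_real_derivative q r * (\<Sum>k. Y k r)) (at r)" for r
      by (rule picard_series_derivative[OF Z0 dZ bound(2) bZ bY])
  qed
qed

text \<open>Coefficients on a compact interval are continued by constants, which makes them bounded.\<close>

lemma linear_system_solution:
  fixes p q :: "real \<Rightarrow> real"
  assumes ab: "a < b" and cont: "continuous_on {a..b} p" "continuous_on {a..b} q"
  shows "\<exists>y z. y 0 = A \<and> z 0 = B \<and>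
     (\<forall>r\<in>{a<..<b}. (y has_real_derivative p r * z r) (at r) \<and> (z has_real_derivative q r * y r) (at r))"
proof -
  define cl where "cl r = max a (min b r)" for r
  have cl: "cl r \<in> {a..b}" "r \<in> {a<..<b} \<Longrightarrow> cl r = r" for r using ab by (auto simp: cl_def)
  have ccl: "continuous_on UNIV cl" unfolding cl_def by (intro continuous_intros)
  have cp: "continuous_on UNIV (\<lambda>r. p (cl r))" "continuous_on UNIV (\<lambda>r. q (cl r))"
    by (rule continuous_on_compose2[OF cont(1) ccl], use cl(1) in blast)
      (rule continuous_on_compose2[OF cont(2) ccl], use cl(1) in blast)
  have "bounded (p ` {a..b})" "bounded (q ` {a..b})"
    using cont by (auto intro!: compact_imp_bounded compact_continuous_image)
  then obtain Mp Mq where "\<forall>y\<in>p ` {a..b}. \<bar>y\<bar> \<le> Mp" "\<forall>y\<in>q ` {a..b}. \<bar>y\<bar> \<le> Mq"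
    unfolding bounded_iff real_norm_def by blast
  then have M: "\<bar>p r\<bar> \<le> Mp" "\<bar>q r\<bar> \<le> Mq" if "r \<in> {a..b}" for r
    using that by auto
  have "\<bar>p (cl r)\<bar> \<le> max Mp Mq" "\<bar>q (cl r)\<bar> \<le> max Mp Mq" for r
    using M(1)[OF cl(1), of r] M(2)[OF cl(1), of r] by auto
  from linear_system_solution_bounded[OF cp this, of A B] show ?thesis
    using cl(2) by metis
qed

lemma Ck_on_linear_system_solution:
  fixes p q y z :: "real \<Rightarrow> real"
  assumes V: "open V" and p: "\<And>k. Ck_on k V p" and q: "\<And>k. Ck_on k V q"
    and y: "\<And>r. r \<in> V \<Longrightarrow> (y has_real_derivative p r * z r) (at r)"
    and z: "\<And>r. r \<in> V \<Longrightarrow> (z has_real_derivative q r * y r) (at r)"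
  shows "Ck_on k V y \<and> Ck_on k V z"
proof (induction k)
  case 0
  then show ?case
    using y z by (auto intro!: continuous_at_imp_continuous_on DERIV_isCont)
next
  case (Suc k)
  then show ?case
    using Ck_on_real_SucI[OF V y Ck_on_mult[OF V p]] Ck_on_real_SucI[OF V z Ck_on_mult[OF V q]] by blast
qed

section \<open>A comparison principle on spherical shells\<close>

lemma mem_closed_shell: "x \<in> closed_shell R l \<longleftrightarrow> R \<le> norm x \<and> norm x \<le> R + l"
  by (auto simp: closed_shell_def)

lemma mem_shell: "x \<in> shell R l \<longleftrightarrow> R < norm x \<and> norm x < R + l"
  by (auto simp: shell_def)

lemma compact_closed_shell: "compact (closed_shell R l)"
  unfolding closed_shell_def by (intro compact_diff) auto

lemma open_shell: "open (shell R l)"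
  unfolding shell_def by (intro open_Diff) auto

lemma Ck_on_2D:
  assumes "Ck_on 2 U f" "x \<in> U"
  shows "f differentiable (at x)" "pderiv_at i f differentiable (at x)"
  using assms by (simp_all add: numeral_2_eq_2 pderiv_at_def[abs_def])

lemma pderiv_at_lincomb:
  assumes "f differentiable (at x)" "g differentiable (at x)"
  shows "pderiv_at i (\<lambda>y. a * f y + b * g y) x = a * pderiv_at i f x + b * pderiv_at i g x"
proof -
  have *: "(f has_derivative frechet_derivative f (at x)) (at x)"
    "(g has_derivative frechet_derivative g (at x)) (at x)"
    using assms frechet_derivative_works by auto
  have "((\<lambda>y. a * f y + b * g y) has_derivative
      (\<lambda>v. a * frechet_derivative f (at x) v + b * frechet_derivative g (at x) v)) (at x)"
    by (intro has_derivative_add has_derivative_mult_right *)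
  then show ?thesis by (simp add: pderiv_at_eq) (simp add: pderiv_at_def)
qed

lemma laplacian_lincomb:
  assumes U: "open U" "x \<in> U" and f: "Ck_on 2 U f" and g: "Ck_on 2 U g"
  shows "laplacian (\<lambda>y. a * f y + b * g y) x = a * laplacian f x + b * laplacian g x"
proof -
  have "pderiv_at i (pderiv_at i (\<lambda>y. a * f y + b * g y)) x =
      a * pderiv_at i (pderiv_at i f) x + b * pderiv_at i (pderiv_at i g) x" for i
  proof -
    have "pderiv_at i (pderiv_at i (\<lambda>y. a * f y + b * g y)) x =
        pderiv_at i (\<lambda>y. a * pderiv_at i f y + b * pderiv_at i g y) x"
      by (rule pderiv_at_cong[OF U]) (rule pderiv_at_lincomb[OF Ck_on_2D(1)[OF f] Ck_on_2D(1)[OF g]])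
    then show ?thesis
      by (simp only: pderiv_at_lincomb[OF Ck_on_2D(2)[OF f U(2)] Ck_on_2D(2)[OF g U(2)]])
  qed
  then show ?thesis by (simp only: laplacian_def sum.distrib sum_distrib_left)
qed

lemma radial_deriv_lincomb:
  assumes "f differentiable (at x)" "g differentiable (at x)"
  shows "radial_deriv (\<lambda>y. a * f y + b * g y) x = a * radial_deriv f x + b * radial_deriv g x"
proof -
  have *: "(f has_derivative frechet_derivative f (at x)) (at x)"
    "(g has_derivative frechet_derivative g (at x)) (at x)"
    using assms frechet_derivative_works by auto
  have "((\<lambda>y. a * f y + b * g y) has_derivative
      (\<lambda>v. a * frechet_derivative f (at x) v + b * frechet_derivative g (at x) v)) (at x)"
    by (intro has_derivative_add has_derivative_mult_right *)
  from fun_cong[OF frechet_derivative_at[OF this], of "x /\<^sub>R norm x"] show ?thesis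
    by (simp add: radial_deriv_def)
qed

lemma Ck_on_lincomb:
  fixes f g :: "'a::real_normed_vector \<Rightarrow> real"
  assumes "open U" "Ck_on k U f" "Ck_on k U g"
  shows "Ck_on k U (\<lambda>y. a * f y + b * g y)"
  using assms by (intro Ck_on_add Ck_on_mult Ck_on_const) auto

lemma has_real_derivative_along_line:
  fixes f :: "real^'n::finite \<Rightarrow> real"
  assumes "f differentiable (at (x + s *\<^sub>R v))"
  shows "((\<lambda>s. f (x + s *\<^sub>R v)) has_real_derivative frechet_derivative f (at (x + s *\<^sub>R v)) v) (at s)"
proof -
  let ?D = "frechet_derivative f (at (x + s *\<^sub>R v))"
  have f: "(f has_derivative ?D) (at (x + s *\<^sub>R v))"
    using assms frechet_derivative_works by auto
  have "((\<lambda>s. x + s *\<^sub>R v) has_derivative (\<lambda>t. t *\<^sub>R v)) (at s)"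
    by (auto intro!: derivative_eq_intros)
  from has_derivative_compose[OF this f]
  have "((\<lambda>s. f (x + s *\<^sub>R v)) has_derivative (\<lambda>t. ?D (t *\<^sub>R v))) (at s)" .
  moreover have "?D (t *\<^sub>R v) = ?D v * t" for t
    using linear_scale[OF linear_frechet_derivative[OF assms]] by (simp add: mult.commute)
  ultimately show ?thesis by (simp add: has_field_derivative_def)
qed

lemma second_derivative_nonneg_at_min:
  fixes \<phi> :: "real \<Rightarrow> real"
  assumes d: "0 < d" and \<phi>: "\<And>s. \<bar>s\<bar> < d \<Longrightarrow> (\<phi> has_real_derivative \<phi>' s) (at s)"
    and D: "(\<phi>' has_real_derivative D) (at 0)" and min: "\<And>s. \<bar>s\<bar> < d \<Longrightarrow> \<phi> 0 \<le> \<phi> s"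
  shows "0 \<le> D"
proof (rule ccontr)
  assume "\<not> 0 \<le> D"
  have "\<phi>' 0 = 0"
    by (rule DERIV_local_min[OF \<phi> d]) (use d min in auto)
  with DERIV_neg_dec_right[OF D] \<open>\<not> 0 \<le> D\<close> obtain d' where d': "0 < d'" "\<And>s. 0 < s \<Longrightarrow> s < d' \<Longrightarrow> \<phi>' s < 0"
    by auto
  define s where "s = min d d' / 2"
  have s: "0 < s" "s < d" "s < d'" using d d' by (auto simp: s_def)
  obtain \<xi> where \<xi>: "0 < \<xi>" "\<xi> < s" "\<phi> s - \<phi> 0 = (s - 0) * \<phi>' \<xi>"
    using MVT2[OF s(1), of \<phi> \<phi>'] \<phi> s by auto
  then have "\<phi> s - \<phi> 0 < 0" using d'(2)[of \<xi>] s by (simp add: mult_pos_neg)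
  then show False using min[of s] s by simp
qed

lemma laplacian_nonneg_at_min:
  fixes f :: "real^'n::finite \<Rightarrow> real"
  assumes U: "open U" "x \<in> U" and f: "Ck_on 2 U f" and min: "\<And>y. y \<in> U \<Longrightarrow> f x \<le> f y"
  shows "0 \<le> laplacian f x"
  unfolding laplacian_def
proof (rule sum_nonneg)
  fix i :: 'n
  let ?e = "axis i (1::real)"
  obtain d where d: "0 < d" "ball x d \<subseteq> U" using openE[OF U] .
  have line: "x + s *\<^sub>R ?e \<in> U" if "\<bar>s\<bar> < d" for s
  proof -
    have "x + s *\<^sub>R ?e \<in> ball x d" using that by (simp add: dist_norm)
    then show ?thesis using d(2) by blast
  qed
  show "0 \<le> pderiv_at i (pderiv_at i f) x"
  proof (rule second_derivative_nonneg_at_min[OF d(1)])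
    show "((\<lambda>s. f (x + s *\<^sub>R ?e)) has_real_derivative pderiv_at i f (x + s *\<^sub>R ?e)) (at s)"
      if "\<bar>s\<bar> < d" for s
      unfolding pderiv_at_def using Ck_on_2D(1)[OF f line[OF that]]
      by (rule has_real_derivative_along_line)
    have "pderiv_at i f differentiable (at (x + 0 *\<^sub>R ?e))" using Ck_on_2D(2)[OF f U(2)] by simp
    from has_real_derivative_along_line[OF this]
    show "((\<lambda>s. pderiv_at i f (x + s *\<^sub>R ?e)) has_real_derivative pderiv_at i (pderiv_at i f) x) (at 0)"
      by (simp add: pderiv_at_def[of i "pderiv_at i f"])
    show "f (x + 0 *\<^sub>R ?e) \<le> f (x + s *\<^sub>R ?e)" if "\<bar>s\<bar> < d" for s
      using min[OF line[OF that]] by simp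
  qed
qed

text \<open>At a point where \<open>g / W\<close> attains a positive maximum \<open>m\<close>, the function \<open>m W - g \<ge> 0\<close>
  vanishes. In the interior this contradicts \<open>\<Delta>(m W - g) < 0\<close>, and on the two boundary spheres it
  contradicts the sign of the radial derivative. The open set \<open>N\<close> marks points
  of \<open>D\<close> around which \<open>D\<close> is all of the shell; at the other points of \<open>D\<close>, \<open>g\<close> is not positive.\<close>

lemma barrier_comparison:
  fixes g W :: "real^'n::finite \<Rightarrow> real"
  assumes R: "0 < R" "0 < l"
    and D: "compact D" "D \<subseteq> closed_shell R l" and N: "open N" "closed_shell R l \<inter> N \<subseteq> D"
    and pos: "\<And>x. x \<in> D \<Longrightarrow> 0 < g x \<Longrightarrow> x \<in> N"
    and U: "open U" "closed_shell R l \<subseteq> U" and g: "Ck_on 2 U g" and W: "Ck_on 2 U W"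
    and Wpos: "\<And>x. x \<in> D \<Longrightarrow> 0 < W x"
    and harm: "\<And>x. x \<in> shell R l \<Longrightarrow> laplacian g x = 0"
    and super: "\<And>x. x \<in> shell R l \<Longrightarrow> x \<in> N \<Longrightarrow> laplacian W x < 0"
    and inner: "\<And>x. x \<in> D \<Longrightarrow> norm x = R \<Longrightarrow> 0 < g x \<Longrightarrow> g x * radial_deriv W x < W x * radial_deriv g x"
    and outer: "\<And>x. x \<in> D \<Longrightarrow> norm x = R + l \<Longrightarrow> 0 < g x \<Longrightarrow>
      W x * radial_deriv g x < g x * radial_deriv W x"
    and x: "x \<in> D"
  shows "g x \<le> 0"
proof (rule ccontr)
  assume "\<not> g x \<le> 0"
  then have gx: "0 < g x" by simp
  have "continuous_on D g" "continuous_on D W"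
    by (rule continuous_on_subset[OF Ck_on_imp_continuous_on[OF g] order_trans[OF D(2) U(2)]])
      (rule continuous_on_subset[OF Ck_on_imp_continuous_on[OF W] order_trans[OF D(2) U(2)]])
  then have "continuous_on D (\<lambda>y. g y / W y)"
    using Wpos by (intro continuous_on_divide) (auto simp: less_imp_neq[symmetric])
  from continuous_attains_sup[OF D(1) _ this] x
  obtain p where p: "p \<in> D" "\<And>y. y \<in> D \<Longrightarrow> g y / W y \<le> g p / W p" by auto
  define m where "m = g p / W p"
  have "0 < g x / W x" using gx Wpos[OF x] by simp
  then have m: "0 < m" using p(2)[OF x] by (simp add: m_def)
  have Wp: "0 < W p" by (rule Wpos[OF p(1)])
  have gp: "g p = m * W p" "0 < g p" using Wp m by (auto simp: m_def zero_less_divide_iff)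
  define \<phi> where "\<phi> y = m * W y + (- 1) * g y" for y
  have \<phi>0: "\<phi> p = 0" by (simp add: \<phi>_def gp)
  have \<phi>D: "0 \<le> \<phi> y" if "y \<in> D" for y
    using p(2)[OF that] Wpos[OF that] by (simp add: \<phi>_def m_def pos_divide_le_eq)
  have pN: "p \<in> N" by (rule pos[OF p(1) gp(2)])
  have pU: "p \<in> U" and pS: "p \<in> closed_shell R l" using p(1) D U by auto
  have Ck\<phi>: "Ck_on 2 U \<phi>" unfolding \<phi>_def[abs_def] by (rule Ck_on_lincomb[OF U(1) W g])
  have p0: "p \<noteq> 0" using pS R by (auto simp: mem_closed_shell)
  define u where "u = p /\<^sub>R norm p"
  have norm_u: "norm u = 1" using p0 by (simp add: u_def)
  have norm_line: "norm (p + s *\<^sub>R u) = norm p + s" if "- norm p \<le> s" for s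
  proof -
    have "norm p *\<^sub>R u = p" using p0 by (simp add: u_def)
    then have "p + s *\<^sub>R u = (norm p + s) *\<^sub>R u" by (metis scaleR_left_distrib)
    moreover note norm_u
    ultimately show ?thesis using that by simp
  qed
  obtain d where d: "0 < d" "ball p d \<subseteq> N" using openE[OF N(1) pN] .
  have lineN: "p + s *\<^sub>R u \<in> N" if "\<bar>s\<bar> < d" for s
  proof -
    have "p + s *\<^sub>R u \<in> ball p d" using that norm_u by (simp add: dist_norm)
    then show ?thesis using d(2) by blast
  qed
  define r where "r = m * radial_deriv W p + (- 1) * radial_deriv g p"
  have dline: "((\<lambda>s. \<phi> (p + s *\<^sub>R u)) has_real_derivative r) (at 0)"
  proof -
    have "r = radial_deriv \<phi> p"
      unfolding r_def \<phi>_def[abs_def]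
      by (rule radial_deriv_lincomb[symmetric]) (rule Ck_on_2D(1)[OF W pU] Ck_on_2D(1)[OF g pU])+
    then show ?thesis
      using has_real_derivative_along_line[of \<phi> p 0 u] Ck_on_2D(1)[OF Ck\<phi> pU]
      unfolding radial_deriv_def u_def[symmetric] by simp
  qed
  consider "norm p = R" | "norm p = R + l" | "p \<in> shell R l"
    using pS by (force simp: mem_shell mem_closed_shell)
  then show False
  proof cases
    case 1
    have "W p * r < 0"
      using inner[OF p(1) 1 gp(2)] by (simp add: r_def gp(1) algebra_simps)
    then have "r < 0" using Wp by (simp add: mult_less_0_iff)
    from DERIV_neg_dec_right[OF dline this] obtain d' where d': "0 < d'"
      "\<And>s. 0 < s \<Longrightarrow> s < d' \<Longrightarrow> \<phi> (p + s *\<^sub>R u) < 0" using \<phi>0 by auto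
    define s where "s = min (min d d') l / 2"
    have s: "0 < s" "s < d" "s < d'" "s \<le> l" using d d' R by (auto simp: s_def)
    then have "p + s *\<^sub>R u \<in> D"
      using N(2) lineN[of s] norm_line[of s] 1 R by (auto simp: mem_closed_shell)
    then show False using \<phi>D[of "p + s *\<^sub>R u"] d'(2)[of s] s by simp
  next
    case 2
    have "0 < W p * r"
      using outer[OF p(1) 2 gp(2)] by (simp add: r_def gp(1) algebra_simps)
    then have "0 < r" using Wp by (simp add: zero_less_mult_iff)
    from DERIV_pos_inc_left[OF dline this] obtain d' where d': "0 < d'"
      "\<And>s. 0 < s \<Longrightarrow> s < d' \<Longrightarrow> \<phi> (p + (- s) *\<^sub>R u) < 0" using \<phi>0 by auto
    define s where "s = min (min d d') l / 2"
    have s: "0 < s" "s < d" "s < d'" "s \<le> l" using d d' R by (auto simp: s_def)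
    then have "p + (- s) *\<^sub>R u \<in> D"
      using N(2) lineN[of "- s"] norm_line[of "- s"] 2 R by (auto simp: mem_closed_shell)
    then show False using \<phi>D[of "p + (- s) *\<^sub>R u"] d'(2)[of s] s by simp
  next
    case 3
    have "0 \<le> laplacian \<phi> p"
    proof (rule laplacian_nonneg_at_min[where U = "shell R l \<inter> N"])
      show "Ck_on 2 (shell R l \<inter> N) \<phi>"
        by (rule Ck_on_subset[OF Ck\<phi>]) (use U in \<open>auto simp: mem_shell mem_closed_shell subset_iff\<close>)
      show "\<phi> p \<le> \<phi> y" if "y \<in> shell R l \<inter> N" for y
        using that N(2) \<phi>D[of y] by (auto simp: \<phi>0 mem_shell mem_closed_shell subset_iff)
    qed (use 3 pN N(1) open_shell in auto)
    moreover have "laplacian \<phi> p = m * laplacian W p + (- 1) * laplacian g p"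
      unfolding \<phi>_def[abs_def] by (rule laplacian_lincomb[OF U(1) pU W g])
    ultimately show False
      using super[OF 3 pN] harm[OF 3] m by (simp add: zero_le_mult_iff)
  qed
qed

section \<open>Lower bounds for the mixed eigenvalues of shells\<close>

lemma Ck_on_norm_compose:
  fixes F :: "real \<Rightarrow> real"
  assumes "Ck_on k {0<..} F"
  shows "Ck_on k (- {0::'a::real_inner}) (\<lambda>x. F (norm x))"
  by (rule Ck_on_compose[OF _ _ assms Ck_on_norm]) auto

lemma Ck_on_inverse_power: "Ck_on k {0<..} (\<lambda>r::real. 1 / r ^ m)"
proof -
  have "Ck_on k {0<..} (\<lambda>r::real. inverse (r ^ m))"
    by (intro Ck_on_inverse Ck_on_power Ck_on_bounded_linear bounded_linear_ident) auto
  then show ?thesis by (simp add: inverse_eq_divide)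
qed

lemma Ck_on_zonal: "Ck_on k (- {0}) (zonal e)"
proof -
  have "Ck_on k (- {0}) (\<lambda>x. (x \<bullet> e) * inverse (norm x))"
    by (intro Ck_on_mult Ck_on_inverse Ck_on_norm Ck_on_bounded_linear bounded_linear_inner_left) auto
  then show ?thesis by (simp add: zonal_def[abs_def] divide_inverse)
qed

lemma radial_deriv_polar_product:
  assumes x: "x \<noteq> 0" and F: "(F has_real_derivative F') (at (norm x))" and Z: "angular Z g D"
  shows "radial_deriv (\<lambda>y. F (norm y) * Z y) x = F' * Z x"
proof -
  have gx: "has_gradient Z (g x) x" "g x \<bullet> x = 0" using Z x by (auto simp: angular_def)
  have "x \<bullet> x = norm x * norm x" by (simp add: dot_square_norm power2_eq_square)
  then show ?thesis
    using x gx(2) fun_cong[OF frechet_derivative_at[OF has_gradient_polar_product[where g = g, OF x F gx(1),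
          unfolded has_gradient_def]], of "x /\<^sub>R norm x"]
    by (simp add: radial_deriv_def inner_add_left field_simps)
qed

lemma exists_small_multiple_less:
  fixes c K :: real
  assumes "0 < c"
  obtains \<delta> where "0 < \<delta>" "\<delta> * K < c"
proof
  show "0 < c / (\<bar>K\<bar> + 1)" using assms by simp
  have "c * K < c * (\<bar>K\<bar> + 1)" using assms by (intro mult_strict_left_mono) auto
  then show "c / (\<bar>K\<bar> + 1) * K < c" by (simp add: field_simps)
qed

lemma DERIV_inverse_power:
  fixes r c :: real
  assumes "r \<noteq> 0"
  shows "((\<lambda>r. c / r ^ k) has_real_derivative - (real k * c) / r ^ Suc k) (at r)"
proof (cases k)
  case (Suc j)
  have "((\<lambda>r. r ^ Suc j) has_real_derivative real (Suc j) * r ^ j) (at r)"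
    using DERIV_power[OF DERIV_ident, of "Suc j" r UNIV] by simp
  from DERIV_divide[OF DERIV_const[of c] this] show ?thesis
    using assms unfolding Suc by (simp del: of_nat_Suc add: field_simps)
qed simp

text \<open>The eigenvalue that belongs to the radial function \<open>r\<^sup>-\<^sup>(\<^sup>n\<^sup>-\<^sup>2\<^sup>) - B\<^sup>-\<^sup>(\<^sup>n\<^sup>-\<^sup>2\<^sup>)\<close>, which is harmonic and
  vanishes at the outer radius \<open>B\<close>.\<close>

definition dirichlet_value :: "nat \<Rightarrow> real \<Rightarrow> real \<Rightarrow> real"
where
  "dirichlet_value n R B =
     (real n - 2) / R ^ (n - 1) / (1 / R ^ (n - 2) - 1 / B ^ (n - 2))"

text \<open>For an eigenvalue \<open>t\<close> below \<open>dirichlet_value\<close>, the radial function has room in its inner boundary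
  condition. Adding a small multiple of \<open>B\<^sup>2 + 1 - r\<^sup>2\<close> therefore turns it into a strict barrier.\<close>

lemma steklov_dirichlet_nonpos:
  fixes g :: "real^'n::finite \<Rightarrow> real"
  assumes n: "CARD('n) = m + 3" and R: "0 < R" "0 < l"
    and t: "t < dirichlet_value CARD('n) R (R + l)"
    and U: "open U" "closed_shell R l \<subseteq> U" and g: "Ck_on 2 U g"
    and harm: "\<And>x. x \<in> shell R l \<Longrightarrow> laplacian g x = 0"
    and outer: "\<And>x. norm x = R + l \<Longrightarrow> g x = 0"
    and inner: "\<And>x. norm x = R \<Longrightarrow> - radial_deriv g x = t * g x"
    and x: "x \<in> closed_shell R l"
  shows "g x \<le> 0"
proof -
  define B where "B = R + l"
  have B: "0 < B" "R < B" using R by (auto simp: B_def)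
  have RB: "1 / B ^ (m + 1) < 1 / R ^ (m + 1)"
    using R B by (intro divide_strict_left_mono power_strict_mono) auto
  have "t * (1 / R ^ (m + 1) - 1 / B ^ (m + 1)) < (real m + 1) / R ^ (m + 2)"
  proof -
    have e: "real CARD('n) - 2 = real m + 1" "CARD('n) - 1 = m + 2" "CARD('n) - 2 = m + 1"
      using n by auto
    show ?thesis
      using t RB unfolding dirichlet_value_def e B_def[symmetric] by (subst (asm) pos_less_divide_eq) auto
  qed
  then have c0: "0 < (real m + 1) / R ^ (m + 2) - t * (1 / R ^ (m + 1) - 1 / B ^ (m + 1))" by simp
  obtain \<delta> where \<delta>: "0 < \<delta>"
    "\<delta> * (t * (B\<^sup>2 + 1 - R\<^sup>2) - 2 * R) < (real m + 1) / R ^ (m + 2) - t * (1 / R ^ (m + 1) - 1 / B ^ (m + 1))"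
    using exists_small_multiple_less[OF c0] .
  define F where "F r = 1 / r ^ (m + 1) - 1 / B ^ (m + 1) + \<delta> * (B\<^sup>2 + 1 - r\<^sup>2)" for r
  define F' where "F' r = (- 1 - real m) / r ^ (m + 2) - 2 * \<delta> * r" for r
  have F: "(F has_real_derivative F' r) (at r)" if "0 < r" for r
  proof -
    have "((\<lambda>r. \<delta> * (B\<^sup>2 + 1 - r\<^sup>2)) has_real_derivative - (2 * \<delta> * r)) (at r)"
      by (auto intro!: derivative_eq_intros)
    from DERIV_add[OF DERIV_diff[OF DERIV_inverse_power[of r 1 "m + 1"] DERIV_const[of "1 / B ^ (m + 1)"]] this]
    show ?thesis using that by (simp add: F_def[abs_def] F'_def)
  qed
  have F': "(F' has_real_derivative - ((2 + real m) * (- 1 - real m)) / r ^ (m + 3) - 2 * \<delta>) (at r)"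
    if "0 < r" for r
  proof -
    have "((\<lambda>r. 2 * \<delta> * r) has_real_derivative 2 * \<delta>) (at r)"
      by (auto intro!: derivative_eq_intros)
    from DERIV_diff[OF DERIV_inverse_power[of r "- 1 - real m" "m + 2"] this]
    show ?thesis using that by (simp add: F'_def[abs_def] numeral_3_eq_3 mult.commute)
  qed
  define W where "W = (\<lambda>x::real^'n. F (norm x) * 1)"
  have CkF: "Ck_on 2 {0<..} F"
    unfolding F_def
    by (intro Ck_on_add Ck_on_diff Ck_on_mult Ck_on_const Ck_on_power Ck_on_inverse_power
        Ck_on_bounded_linear bounded_linear_ident) auto
  have CkW: "Ck_on 2 (U \<inter> - {0}) W"
    unfolding W_def mult_1_right by (rule Ck_on_subset[OF Ck_on_norm_compose[OF CkF]]) auto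
  show ?thesis
  proof (rule barrier_comparison[where D = "closed_shell R l" and N = UNIV and W = W and U = "U \<inter> - {0}"])
    show "open (U \<inter> - {0})" "closed_shell R l \<subseteq> U \<inter> - {0}"
      using U R by (auto simp: mem_closed_shell)
    show "Ck_on 2 (U \<inter> - {0}) g" using Ck_on_subset[OF g] by auto
    show "0 < W x" if "x \<in> closed_shell R l" for x
    proof -
      have r: "R \<le> norm x" "norm x \<le> B" using that by (auto simp: mem_closed_shell B_def)
      have "1 / B ^ (m + 1) \<le> 1 / norm x ^ (m + 1)"
        using r R by (intro frac_le zero_less_power power_mono) auto
      moreover have "(norm x)\<^sup>2 \<le> B\<^sup>2" using r by (intro power_mono) auto
      ultimately show ?thesis using \<delta>(1) by (auto simp: W_def F_def intro!: add_nonneg_pos)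
    qed
    show "laplacian W x < 0" if "x \<in> shell R l" for x
    proof -
      have x: "x \<noteq> 0" using that R by (auto simp: mem_shell)
      have "laplacian W x = - 2 * \<delta> * (real m + 3)"
        unfolding W_def using x
        by (subst laplacian_polar_product[OF _ angular_one F F'])
          (auto simp: n F'_def power_add power2_eq_square power3_eq_cube field_simps)
      then show ?thesis using \<delta>(1) by simp
    qed
    show "g x * radial_deriv W x < W x * radial_deriv g x" if "norm x = R" "0 < g x" for x
    proof -
      have x: "x \<noteq> 0" using that R by auto
      have rW: "radial_deriv W x = F' R"
        unfolding W_def using radial_deriv_polar_product[OF x F angular_one] that R by simp
      have "(- 1 - real m) / R ^ (m + 2) = - ((real m + 1) / R ^ (m + 2))"
        by (simp add: minus_divide_left)
      then have "F' R + t * F R < 0"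
        using \<delta>(2) unfolding F_def F'_def by (simp only: algebra_simps)
      then have "g x * (F' R + t * F R) < 0" using that by (simp add: mult_pos_neg)
      moreover have "radial_deriv g x = - (t * g x)" using inner[of x] that by simp
      moreover have "W x = F R" using that by (simp add: W_def)
      ultimately show ?thesis by (simp add: rW algebra_simps)
    qed
  qed (use R x harm outer CkW compact_closed_shell in \<open>auto simp: outer\<close>)
qed

definition reflection :: "real^'n::finite \<Rightarrow> real^'n \<Rightarrow> real^'n"
where "reflection e x = x - (2 * (x \<bullet> e)) *\<^sub>R e"

lemma orthogonal_transformation_reflection:
  assumes "norm e = 1"
  shows "orthogonal_transformation (reflection e)"
proof -
  have "e \<bullet> e = 1" using assms by (simp add: dot_square_norm)
  moreover have "linear (reflection e)"
    by (rule linearI) (auto simp: reflection_def inner_add_left algebra_simps)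
  ultimately show ?thesis
    unfolding orthogonal_transformation_def
    by (auto simp: reflection_def inner_diff_left inner_diff_right inner_commute algebra_simps)
qed

text \<open>The Laplacian is the trace of the second derivative, and a trace may be computed in any
  orthonormal basis.\<close>

lemma laplacian_compose_orthogonal:
  fixes f :: "real^'n::finite \<Rightarrow> real" and A :: "real^'n \<Rightarrow> real^'n"
  assumes A: "orthogonal_transformation A" and U: "open U" "A x \<in> U" and f: "Ck_on 2 U f"
  shows "laplacian (\<lambda>y. f (A y)) x = laplacian f (A x)"
proof -
  have lin: "bounded_linear A"
    using A by (simp add: orthogonal_transformation_def linear_conv_bounded_linear)
  have op: "open (A -` U)" using U lin by (simp add: continuous_open_vimage linear_continuous_at)
  define v where "v i = A (axis i 1)" for i
  have pd: "pderiv_at i (\<lambda>y. \<phi> (A y)) y = (\<Sum>j\<in>UNIV. v i $ j * pderiv_at j \<phi> (A y))"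
    if "\<phi> differentiable (at (A y))" for \<phi> i y
  proof -
    let ?D = "frechet_derivative \<phi> (at (A y))"
    have D: "(\<phi> has_derivative ?D) (at (A y))" using that frechet_derivative_works by blast
    have linD: "linear ?D" using that by (rule linear_frechet_derivative)
    have "pderiv_at i (\<lambda>y. \<phi> (A y)) y = ?D (v i)"
      using pderiv_at_eq[OF has_derivative_compose[OF bounded_linear_imp_has_derivative[OF lin] D]]
      by (simp add: v_def)
    also have "v i = (\<Sum>j\<in>UNIV. v i $ j *\<^sub>R axis j 1)"
      using basis_expansion[of "v i"] by (simp add: scalar_mult_eq_scaleR)
    then have "?D (v i) = ?D (\<Sum>j\<in>UNIV. v i $ j *\<^sub>R axis j 1)" by simp
    also have "\<dots> = (\<Sum>j\<in>UNIV. v i $ j * ?D (axis j 1))"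
      using linD by (simp add: linear_sum linear_scale)
    finally show ?thesis by (simp add: pderiv_at_def)
  qed
  have dA: "pderiv_at j f differentiable (at (A x))" for j using Ck_on_2D(2)[OF f U(2)] .
  have dcomp: "(\<lambda>y. pderiv_at j f (A y)) differentiable (at x)" for j
    using differentiable_chain_at[OF bounded_linear_imp_differentiable[OF lin] dA]
    by (simp add: o_def)
  have p2: "pderiv_at i (pderiv_at i (\<lambda>y. f (A y))) x =
      (\<Sum>j\<in>UNIV. \<Sum>k\<in>UNIV. v i $ j * v i $ k * pderiv_at k (pderiv_at j f) (A x))" for i
  proof -
    have "pderiv_at i (pderiv_at i (\<lambda>y. f (A y))) x =
        pderiv_at i (\<lambda>y. \<Sum>j\<in>UNIV. v i $ j * pderiv_at j f (A y)) x"
      by (rule pderiv_at_cong[OF op]) (use U Ck_on_2D(1)[OF f] in \<open>auto intro: pd\<close>)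
    also have "\<dots> = (\<Sum>j\<in>UNIV. v i $ j * pderiv_at i (\<lambda>y. pderiv_at j f (A y)) x)"
    proof -
      have "((\<lambda>y. \<Sum>j\<in>UNIV. v i $ j * pderiv_at j f (A y)) has_derivative
          (\<lambda>h. \<Sum>j\<in>UNIV. v i $ j * frechet_derivative (\<lambda>y. pderiv_at j f (A y)) (at x) h)) (at x)"
        using dcomp frechet_derivative_works
        by (intro has_derivative_sum has_derivative_mult_right) blast
      then show ?thesis by (simp add: pderiv_at_eq) (simp add: pderiv_at_def)
    qed
    finally show ?thesis by (simp add: pd[OF dA] sum_distrib_left mult.assoc)
  qed
  have "orthogonal_matrix (matrix A)" using A orthogonal_transformation_matrix by blast
  then have "matrix A ** transpose (matrix A) = mat 1" by (simp add: orthogonal_matrix_def)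
  then have "(matrix A ** transpose (matrix A)) $ j $ k = (mat 1 :: real^'n^'n) $ j $ k" for j k by simp
  then have orth: "(\<Sum>i\<in>UNIV. v i $ j * v i $ k) = (if j = k then 1 else 0)" for j k
    by (simp add: matrix_matrix_mult_def transpose_def matrix_def v_def mat_def)
  have "laplacian (\<lambda>y. f (A y)) x =
      (\<Sum>j\<in>UNIV. \<Sum>k\<in>UNIV. (\<Sum>i\<in>UNIV. v i $ j * v i $ k) * pderiv_at k (pderiv_at j f) (A x))"
    unfolding laplacian_def p2 sum_distrib_right
    by (subst sum.swap, rule sum.cong[OF refl], rule sum.swap)
  also have "\<dots> = laplacian f (A x)"
    by (simp add: orth laplacian_def if_distrib[of "\<lambda>c. c * _"] cong: if_cong)
  finally show ?thesis .
qed

lemma radial_deriv_compose_orthogonal: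
  fixes f :: "real^'n::finite \<Rightarrow> real" and A :: "real^'n \<Rightarrow> real^'n"
  assumes A: "orthogonal_transformation A" and f: "f differentiable (at (A x))"
  shows "radial_deriv (\<lambda>y. f (A y)) x = radial_deriv f (A x)"
proof -
  have lin: "bounded_linear A"
    using A by (simp add: orthogonal_transformation_def linear_conv_bounded_linear)
  have D: "(f has_derivative frechet_derivative f (at (A x))) (at (A x))"
    using f frechet_derivative_works by blast
  from fun_cong[OF frechet_derivative_at[OF has_derivative_compose[OF
        bounded_linear_imp_has_derivative[OF lin] D]], of "x /\<^sub>R norm x"]
  show ?thesis
    using A by (simp add: radial_deriv_def orthogonal_transformation_norm
        linear_scale[OF bounded_linear.linear[OF lin]])
qed

text \<open>The function \<open>a(r) = r + B\<^sup>n / ((n - 1) r\<^sup>n\<^sup>-\<^sup>1)\<close> is the radial part of the first nonconstant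
  eigenfunctions \<open>a(|x|) (x \<bullet> e) / |x|\<close> of the mixed Steklov--Neumann problem with outer radius \<open>B\<close>:
  it solves the radial equation and \<open>a'(B) = 0\<close>. The eigenvalue is \<open>- a'(R) / a(R)\<close>.\<close>

definition neumann_profile :: "nat \<Rightarrow> real \<Rightarrow> real \<Rightarrow> real"
where "neumann_profile n B r = r + B ^ n / (real n - 1) / r ^ (n - 1)"

definition neumann_value :: "nat \<Rightarrow> real \<Rightarrow> real \<Rightarrow> real"
where "neumann_value n R B = (B ^ n / R ^ n - 1) / neumann_profile n B R"

lemma neumann_profile_pos:
  assumes "2 \<le> n" "0 < r" "0 < B"
  shows "0 < neumann_profile n B r"
  unfolding neumann_profile_def using assms by (intro add_pos_pos divide_pos_pos) auto

lemma DERIV_neumann_profile: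
  assumes "2 \<le> n" "r \<noteq> 0"
  shows "(neumann_profile n B has_real_derivative 1 - B ^ n / r ^ n) (at r)"
proof -
  have e: "real (n - 1) * (B ^ n / (real n - 1)) = B ^ n" "Suc (n - 1) = n" using assms by auto
  from DERIV_add[OF DERIV_ident DERIV_inverse_power[OF assms(2), of "B ^ n / (real n - 1)" "n - 1", unfolded e]]
  show ?thesis by (simp add: neumann_profile_def[abs_def])
qed

text \<open>The difference \<open>f - f \<circ> reflection e\<close> vanishes on the equator \<open>x \<bullet> e = 0\<close>, so it can only be
  positive in the open half shell \<open>x \<bullet> e > 0\<close>. There \<open>a(r) cos \<theta>\<close> is positive and satisfies the boundary
  conditions for the eigenvalue \<open>neumann_value\<close>, which is larger than \<open>t\<close>. It vanishes on the equator
  as well, where it gives no control over the quotient of the two functions. The barrier is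
  therefore \<open>F(r) \<kappa>(cos \<theta>)\<close> with perturbations of both factors, where \<open>\<kappa>\<close> is positive on the closed
  half shell.\<close>

lemma steklov_neumann_reflection_le:
  fixes f :: "real^'n::finite \<Rightarrow> real"
  assumes n: "2 \<le> CARD('n)" and R: "0 < R" "0 < l"
    and t: "t < neumann_value CARD('n) R (R + l)" and e: "norm e = 1"
    and U: "open U" "closed_shell R l \<subseteq> U" and f: "Ck_on 2 U f"
    and harm: "\<And>x. x \<in> shell R l \<Longrightarrow> laplacian f x = 0"
    and outer: "\<And>x. norm x = R + l \<Longrightarrow> radial_deriv f x = 0"
    and inner: "\<And>x. norm x = R \<Longrightarrow> - radial_deriv f x = t * f x"
    and x: "x \<in> closed_shell R l" "0 \<le> x \<bullet> e"
  shows "f x \<le> f (reflection e x)"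
proof -
  define N where "N = real CARD('n)"
  define B where "B = R + l"
  define a where "a = neumann_profile CARD('n) B"
  have N: "2 \<le> N" using n by (simp add: N_def)
  have B: "0 < B" "R < B" using R by (auto simp: B_def)
  have apos: "0 < a r" if "0 < r" for r
    unfolding a_def using n that B(1) by (rule neumann_profile_pos)
  define K where "K = 2 * B + 1"
  \<comment> \<open>the perturbed radial profile: strictly superharmonic, with room in both boundary conditions\<close>
  have "t * a R < B ^ CARD('n) / R ^ CARD('n) - 1"
    using t apos[OF R(1)] by (simp add: neumann_value_def a_def B_def pos_less_divide_eq)
  then have c0: "0 < B ^ CARD('n) / R ^ CARD('n) - 1 - t * a R" by simp
  obtain \<epsilon> where \<epsilon>: "0 < \<epsilon>"
    "\<epsilon> * (K - 2 * R + t * (K * R - R\<^sup>2)) < B ^ CARD('n) / R ^ CARD('n) - 1 - t * a R"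
    using exists_small_multiple_less[OF c0] .
  define F where "F r = a r + \<epsilon> * (K * r - r\<^sup>2)" for r
  define F' where "F' r = 1 - B ^ CARD('n) / r ^ CARD('n) + \<epsilon> * (K - 2 * r)" for r
  have dv: "((\<lambda>r. \<epsilon> * (K * r - r\<^sup>2)) has_real_derivative \<epsilon> * (K - 2 * r)) (at r)" for r
    by (auto intro!: derivative_eq_intros)
  have F: "(F has_real_derivative F' r) (at r)" if "0 < r" for r
    using DERIV_add[OF DERIV_neumann_profile[OF n, of r B] dv[of r]] that
    by (simp add: F_def[abs_def] F'_def a_def)
  have F': "(F' has_real_derivative N * B ^ CARD('n) / r ^ Suc CARD('n) - 2 * \<epsilon>) (at r)" if "0 < r" for r
  proof -
    have "((\<lambda>r. \<epsilon> * (K - 2 * r)) has_real_derivative - (2 * \<epsilon>)) (at r)"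
      by (auto intro!: derivative_eq_intros)
    from DERIV_add[OF DERIV_diff[OF DERIV_const[of 1] DERIV_inverse_power[of r "B ^ CARD('n)" "CARD('n)"]] this]
    show ?thesis using that by (simp add: F'_def[abs_def] N_def)
  qed
  have Fpos: "0 < F r" if "0 < r" "r \<le> B" for r
  proof -
    have "0 < \<epsilon> * (r * (K - r))" using that \<epsilon> B by (intro mult_pos_pos) (auto simp: K_def)
    then show ?thesis using apos[OF that(1)] by (simp add: F_def power2_eq_square algebra_simps)
  qed
  have Feq: "(N * B ^ CARD('n) / r ^ Suc CARD('n) - 2 * \<epsilon>) + (N - 1) / r * F' r
      = (N - 1) * F r / r\<^sup>2 - \<epsilon> * (N + 1)" if "0 < r" for r
  proof -
    define q where "q = B ^ CARD('n) / r ^ CARD('n)"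
    have "r ^ CARD('n) = r * r ^ (CARD('n) - 1)" using n by (simp add: power_eq_if)
    then have q: "B ^ CARD('n) / r ^ Suc CARD('n) = q / r" "a r = r + q * r / (N - 1)"
      using that by (auto simp: q_def a_def neumann_profile_def N_def field_simps)
    have "N * B ^ CARD('n) / r ^ Suc CARD('n) = N * (q / r)"
      by (simp only: times_divide_eq_right[symmetric] q(1))
    then show ?thesis
      using that N by (simp add: F_def F'_def q(2) q_def[symmetric] power2_eq_square field_simps)
  qed
  \<comment> \<open>the loss of superharmonicity from \<open>\<kappa>\<close> is at most proportional to \<open>F / r\<^sup>2\<close>; \<open>C\<close> fixes how small \<open>\<delta>\<close> must be\<close>
  obtain C where C: "\<And>r. r \<in> {R..B} \<Longrightarrow> F r / r\<^sup>2 \<le> C"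
  proof -
    have "continuous_on {R..B} (\<lambda>r. F r / r\<^sup>2)"
      using R(1) by (intro continuous_on_divide continuous_at_imp_continuous_on ballI)
        (auto intro!: DERIV_isCont[OF F] continuous_intros)
    then have "\<exists>x\<in>{R..B}. \<forall>r\<in>{R..B}. F r / r\<^sup>2 \<le> F x / x\<^sup>2"
      using B by (intro continuous_attains_sup) auto
    then show ?thesis using that by blast
  qed
  have "0 < F R / R\<^sup>2" using Fpos[of R] R B by simp
  then have C0: "0 < C" using C[of R] B by simp
  define \<delta> where "\<delta> = \<epsilon> / (N * (\<epsilon> + C))"
  have "0 < N * (\<epsilon> + C)" using \<epsilon>(1) C0 N by (intro mult_pos_pos) auto
  then have "0 < \<delta>" "\<delta> * (N * (\<epsilon> + C)) = \<epsilon>" using \<epsilon>(1) by (auto simp: \<delta>_def)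
  then have \<delta>: "0 < \<delta>" "\<delta> * N * (\<epsilon> + C) = \<epsilon>" by (simp_all add: mult.assoc)
  \<comment> \<open>the perturbed angular profile: positive up to the equator\<close>
  define \<kappa> where "\<kappa> z = z + \<delta> * (1 - N * z\<^sup>2)" for z
  have \<kappa>: "(\<kappa> has_real_derivative 1 - 2 * \<delta> * N * z) (at z)"
    and \<kappa>': "((\<lambda>z. 1 - 2 * \<delta> * N * z) has_real_derivative - 2 * \<delta> * N) (at z)" for z
    unfolding \<kappa>_def by (auto intro!: derivative_eq_intros)
  have \<kappa>_lower: "C * \<delta> * N * z\<^sup>2 < \<epsilon> * \<kappa> z" and \<kappa>pos: "0 < \<kappa> z" if "0 \<le> z" "z \<le> 1" for z
  proof -
    have "\<epsilon> * \<kappa> z - C * \<delta> * N * z\<^sup>2 = \<epsilon> * z + \<epsilon> * \<delta> - (\<delta> * N * (\<epsilon> + C)) * z\<^sup>2"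
      by (simp add: \<kappa>_def algebra_simps)
    also have "\<dots> = \<epsilon> * (z * (1 - z)) + \<epsilon> * \<delta>" 
      unfolding \<delta>(2) by (simp add: power2_eq_square algebra_simps)
    also have "\<dots> > 0" using that \<epsilon> \<delta> by (intro add_nonneg_pos mult_nonneg_nonneg mult_pos_pos) auto
    finally show *: "C * \<delta> * N * z\<^sup>2 < \<epsilon> * \<kappa> z" by simp
    have "0 \<le> C * \<delta> * N * z\<^sup>2" using C0 \<delta> N by simp
    with * have "0 < \<epsilon> * \<kappa> z" by simp
    then show "0 < \<kappa> z" using \<epsilon> by (simp add: zero_less_mult_iff)
  qed
  note ang = angular_compose_zonal[OF e \<kappa> \<kappa>']
  define W where "W = (\<lambda>x::real^'n. F (norm x) * \<kappa> (zonal e x))"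
  have lapW: "laplacian W x < 0" if x: "0 < norm x" "R \<le> norm x" "norm x \<le> B" "0 \<le> zonal e x" for x
  proof -
    let ?r = "norm x" and ?z = "zonal e x"
    let ?q = "F ?r / ?r\<^sup>2"
    have z: "0 \<le> ?z" "?z \<le> 1" using x abs_zonal_le_1[OF e, of x] by auto
    have "laplacian W x = ((N * B ^ CARD('n) / ?r ^ Suc CARD('n) - 2 * \<epsilon>) + (N - 1) / ?r * F' ?r) * \<kappa> ?z
        + F ?r * (((1 - ?z\<^sup>2) * (- 2 * \<delta> * N) - (N - 1) * ?z * (1 - 2 * \<delta> * N * ?z)) / ?r\<^sup>2)"
      unfolding W_def N_def
      by (rule laplacian_polar_product[OF _ ang[unfolded N_def] F F'[unfolded N_def]]) (use x in auto)
    also have "\<dots> = (N + 1) * (?q * (\<delta> * (N * ?z\<^sup>2 - 1)) - \<epsilon> * \<kappa> ?z)"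
      unfolding Feq[OF x(1)] using x(1)
      by (simp add: \<kappa>_def field_simps power2_eq_square)
    also have "\<dots> < 0"
    proof (rule mult_pos_neg)
      have q: "0 < ?q" "?q \<le> C" using Fpos[OF x(1,3)] x C[of ?r] by auto
      have "?q * (\<delta> * (N * ?z\<^sup>2 - 1)) \<le> ?q * (\<delta> * N * ?z\<^sup>2)"
        using q \<delta> by (intro mult_left_mono) (auto simp: algebra_simps)
      also have "\<dots> \<le> C * (\<delta> * N * ?z\<^sup>2)"
        using q \<delta> N by (intro mult_right_mono) auto
      finally show "?q * (\<delta> * (N * ?z\<^sup>2 - 1)) - \<epsilon> * \<kappa> ?z < 0"
        using \<kappa>_lower[OF z] by (simp add: mult.assoc)
    qed (use N in simp)
    finally show ?thesis .
  qed
  let ?\<rho> = "reflection e"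
  have \<rho>: "orthogonal_transformation ?\<rho>" by (rule orthogonal_transformation_reflection[OF e])
  have n\<rho>: "norm (?\<rho> x) = norm x" for x using \<rho> by (simp add: orthogonal_transformation_norm)
  have lin\<rho>: "bounded_linear ?\<rho>"
    using \<rho> by (simp add: orthogonal_transformation_def linear_conv_bounded_linear)
  define V where "V = U \<inter> ?\<rho> -` U \<inter> - {0}"
  have "open (?\<rho> -` U)" using U lin\<rho> by (simp add: continuous_open_vimage linear_continuous_at)
  then have V: "open V" "closed_shell R l \<subseteq> V"
    using U R by (auto simp: V_def mem_closed_shell n\<rho> subset_iff)
  define g where "g x = 1 * f x + (- 1) * f (?\<rho> x)" for x
  have CkfV: "Ck_on 2 V f" "Ck_on 2 V (\<lambda>x. f (?\<rho> x))"
    using Ck_on_subset[OF f, of V] Ck_on_subset[OF Ck_on_compose_linear[OF lin\<rho> U(1) f], of V]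
    by (auto simp: V_def)
  have shellV: "x \<in> V" "?\<rho> x \<in> U" "x \<in> U" if "R \<le> norm x" "norm x \<le> B" for x
    using that V(2) by (auto simp: mem_closed_shell B_def V_def subset_iff)
  have zonal_iff: "0 \<le> zonal e x \<longleftrightarrow> 0 \<le> x \<bullet> e" if "x \<noteq> 0" for x
    using that by (simp add: zonal_def zero_le_divide_iff)
  have rad_g: "radial_deriv g x = radial_deriv f x - radial_deriv f (?\<rho> x)"
    if "R \<le> norm x" "norm x \<le> B" for x
    unfolding g_def[abs_def]
    using Ck_on_2D(1)[OF CkfV(1) shellV(1)[OF that]] Ck_on_2D(1)[OF CkfV(2) shellV(1)[OF that]]
      Ck_on_2D(1)[OF f shellV(2)[OF that]]
    by (simp add: radial_deriv_lincomb[of f x "\<lambda>x. f (?\<rho> x)" 1 "-1", simplified] radial_deriv_compose_orthogonal[OF \<rho>])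
  have rad_W: "radial_deriv W x = F' (norm x) * \<kappa> (zonal e x)" if "x \<noteq> 0" for x
    unfolding W_def using that by (intro radial_deriv_polar_product[OF _ F ang]) auto
  have CkF: "Ck_on 2 {0<..} F"
  proof -
    have "Ck_on 2 {0<..} (\<lambda>r. (r + B ^ CARD('n) / (real CARD('n) - 1) * (1 / r ^ (CARD('n) - 1)))
        + \<epsilon> * (K * r - r ^ 2))"
      by (intro Ck_on_add Ck_on_diff Ck_on_mult Ck_on_const Ck_on_power Ck_on_inverse_power
          Ck_on_bounded_linear bounded_linear_ident) auto
    then show ?thesis by (simp add: F_def[abs_def] a_def neumann_profile_def)
  qed
  have CkW: "Ck_on 2 V W"
  proof -
    have "Ck_on 2 (- {0}) (\<lambda>x. \<kappa> (zonal e x))"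
      unfolding \<kappa>_def
      by (intro Ck_on_add Ck_on_diff Ck_on_mult Ck_on_const Ck_on_power Ck_on_zonal) auto
    then have "Ck_on 2 (- {0}) W"
      unfolding W_def by (intro Ck_on_mult Ck_on_norm_compose[OF CkF]) auto
    then show ?thesis by (rule Ck_on_subset) (auto simp: V_def)
  qed
  have "g x \<le> 0"
  proof (rule barrier_comparison[where D = "closed_shell R l \<inter> {x. 0 \<le> x \<bullet> e}"
        and N = "{x. 0 < x \<bullet> e}" and W = W and U = V])
    have "closed {x. 0 \<le> x \<bullet> e}" by (intro closed_Collect_le continuous_intros)
    then show "compact (closed_shell R l \<inter> {x. 0 \<le> x \<bullet> e})"
      by (intro compact_Int_closed compact_closed_shell)
    show "open {x. 0 < x \<bullet> e}" by (intro open_Collect_less continuous_intros)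
    show "x \<in> {x. 0 < x \<bullet> e}" if "x \<in> closed_shell R l \<inter> {x. 0 \<le> x \<bullet> e}" "0 < g x" for x
    proof (cases "x \<bullet> e = 0")
      case True
      then have "?\<rho> x = x" by (simp add: reflection_def)
      then show ?thesis using that(2) by (simp add: g_def)
    qed (use that in auto)
    show "Ck_on 2 V g" unfolding g_def[abs_def] by (rule Ck_on_lincomb[OF V(1) CkfV])
    show "0 < W x" if "x \<in> closed_shell R l \<inter> {x. 0 \<le> x \<bullet> e}" for x
    proof -
      have x: "0 < norm x" "norm x \<le> B" "x \<noteq> 0" using that R by (auto simp: mem_closed_shell B_def)
      then show ?thesis
        unfolding W_def using that abs_zonal_le_1[OF e, of x]
        by (intro mult_pos_pos Fpos \<kappa>pos) (auto simp: zonal_iff)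
    qed
    show "laplacian g x = 0" if "x \<in> shell R l" for x
    proof -
      have x: "R \<le> norm x" "norm x \<le> B" and "?\<rho> x \<in> shell R l"
        using that by (auto simp: mem_shell B_def n\<rho>)
      then show ?thesis
        unfolding g_def[abs_def]
        by (subst laplacian_lincomb[OF V(1) shellV(1)[OF x] CkfV])
          (simp add: laplacian_compose_orthogonal[OF \<rho> U(1) _ f] shellV[OF x] harm that)
    qed
    show "laplacian W x < 0" if "x \<in> shell R l" "x \<in> {x. 0 < x \<bullet> e}" for x
    proof -
      have "x \<noteq> 0" using that R by (auto simp: mem_shell)
      then show ?thesis using that R by (intro lapW) (auto simp: mem_shell B_def zonal_iff)
    qed
    show "g x * radial_deriv W x < W x * radial_deriv g x"
      if "x \<in> closed_shell R l \<inter> {x. 0 \<le> x \<bullet> e}" "norm x = R" "0 < g x" for x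
    proof -
      have x: "x \<noteq> 0" "R \<le> norm x" "norm x \<le> B" using that R B by auto
      have "0 < \<kappa> (zonal e x)"
        using that x abs_zonal_le_1[OF e, of x] by (intro \<kappa>pos) (auto simp: zonal_iff)
      moreover have "F' R + t * F R < 0" using \<epsilon>(2) by (simp add: F_def F'_def algebra_simps)
      ultimately have "(g x * \<kappa> (zonal e x)) * (F' R + t * F R) < 0"
        using that by (intro mult_pos_neg mult_pos_pos)
      moreover have "radial_deriv g x = - (t * g x)"
        using inner[of x] inner[of "?\<rho> x"] that unfolding rad_g[OF x(2,3)] by (simp add: n\<rho> g_def algebra_simps)
      moreover have "W x = F R * \<kappa> (zonal e x)" "radial_deriv W x = F' R * \<kappa> (zonal e x)"
        using that rad_W[OF x(1)] by (simp_all add: W_def)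
      ultimately show ?thesis by (simp add: algebra_simps)
    qed
    show "W x * radial_deriv g x < g x * radial_deriv W x"
      if "x \<in> closed_shell R l \<inter> {x. 0 \<le> x \<bullet> e}" "norm x = R + l" "0 < g x" for x
    proof -
      have x: "x \<noteq> 0" "R \<le> norm x" "norm x \<le> B" "norm x = B" using that R by (auto simp: B_def)
      have "0 < \<kappa> (zonal e x)"
        using that x abs_zonal_le_1[OF e, of x] by (intro \<kappa>pos) (auto simp: zonal_iff)
      moreover have "F' B = \<epsilon>" using B by (simp add: F'_def K_def)
      moreover have "radial_deriv g x = 0"
        using outer[of x] outer[of "?\<rho> x"] that unfolding rad_g[OF x(2,3)] by (simp add: n\<rho>)
      ultimately show ?thesis using that \<epsilon> rad_W[OF x(1)] x(4) by simp
    qed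
  qed (use R V CkW x in auto)
  then show ?thesis by (simp add: g_def)
qed

text \<open>The barrier is \<open>A - r\<^sup>-\<^sup>(\<^sup>n\<^sup>-\<^sup>2\<^sup>)\<close>, which grows at the outer sphere, made strictly superharmonic by a small
  multiple of \<open>- r\<^sup>2\<close>. With \<open>g\<close> replaced by \<open>- g\<close>, it follows that harmonic functions with a constant
  Dirichlet value inside and a vanishing Neumann value outside are constant.\<close>

lemma shell_neumann_constant_le:
  fixes g :: "real^'n::finite \<Rightarrow> real"
  assumes n: "CARD('n) = m + 3" and R: "0 < R" "0 < l"
    and U: "open U" "closed_shell R l \<subseteq> U" and g: "Ck_on 2 U g"
    and harm: "\<And>x. x \<in> shell R l \<Longrightarrow> laplacian g x = 0"
    and outer: "\<And>x. norm x = R + l \<Longrightarrow> radial_deriv g x = 0"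
    and inner: "\<And>x. norm x = R \<Longrightarrow> g x = 0"
    and x: "x \<in> closed_shell R l"
  shows "g x \<le> 0"
proof -
  define B where "B = R + l"
  have B: "0 < B" "R < B" using R by (auto simp: B_def)
  define d where "d = 1 / (4 * B ^ (m + 3))"
  have d: "0 < d" using B by (simp add: d_def)
  define A where "A = 1 / R ^ (m + 1) + d * B\<^sup>2 + 1"
  define F where "F r = A - 1 / r ^ (m + 1) - d * r\<^sup>2" for r
  define F' where "F' r = (real m + 1) / r ^ (m + 2) - 2 * d * r" for r
  have F: "(F has_real_derivative F' r) (at r)" if "0 < r" for r
  proof -
    have "((\<lambda>r. d * r\<^sup>2) has_real_derivative 2 * d * r) (at r)"
      by (auto intro!: derivative_eq_intros)
    from DERIV_diff[OF DERIV_diff[OF DERIV_const[of A] DERIV_inverse_power[of r 1 "m + 1"]] this]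
    show ?thesis using that by (simp add: F_def[abs_def] F'_def minus_divide_left add.commute)
  qed
  have F': "(F' has_real_derivative - ((2 + real m) * (real m + 1)) / r ^ (m + 3) - 2 * d) (at r)"
    if "0 < r" for r
  proof -
    have "((\<lambda>r. 2 * d * r) has_real_derivative 2 * d) (at r)"
      by (auto intro!: derivative_eq_intros)
    from DERIV_diff[OF DERIV_inverse_power[of r "real m + 1" "m + 2"] this]
    show ?thesis using that by (simp add: F'_def[abs_def] numeral_3_eq_3 mult.commute)
  qed
  define W where "W = (\<lambda>x::real^'n. F (norm x) * 1)"
  have CkF: "Ck_on 2 {0<..} F"
    unfolding F_def
    by (intro Ck_on_diff Ck_on_mult Ck_on_const Ck_on_power Ck_on_inverse_power
        Ck_on_bounded_linear bounded_linear_ident) auto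
  have CkW: "Ck_on 2 (U \<inter> - {0}) W"
    unfolding W_def mult_1_right by (rule Ck_on_subset[OF Ck_on_norm_compose[OF CkF]]) auto
  show ?thesis
  proof (rule barrier_comparison[where D = "closed_shell R l" and N = UNIV and W = W and U = "U \<inter> - {0}"])
    show "open (U \<inter> - {0})" "closed_shell R l \<subseteq> U \<inter> - {0}"
      using U R by (auto simp: mem_closed_shell)
    show "Ck_on 2 (U \<inter> - {0}) g" using Ck_on_subset[OF g] by auto
    show "0 < W x" if "x \<in> closed_shell R l" for x
    proof -
      have r: "R \<le> norm x" "norm x \<le> B" using that by (auto simp: mem_closed_shell B_def)
      have "1 / norm x ^ (m + 1) \<le> 1 / R ^ (m + 1)"
        using r R by (intro frac_le zero_less_power power_mono) auto
      moreover have "d * (norm x)\<^sup>2 \<le> d * B\<^sup>2" using r d by (intro mult_left_mono power_mono) auto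
      ultimately show ?thesis unfolding W_def F_def A_def mult_1_right by linarith
    qed
    show "laplacian W x < 0" if "x \<in> shell R l" for x
    proof -
      have x: "x \<noteq> 0" using that R by (auto simp: mem_shell)
      have "laplacian W x = - 2 * d * (real m + 3)"
        unfolding W_def using x
        by (subst laplacian_polar_product[OF _ angular_one F F'])
          (auto simp: n F'_def power_add power2_eq_square power3_eq_cube field_simps)
      then show ?thesis using d by simp
    qed
    show "W x * radial_deriv g x < g x * radial_deriv W x" if "norm x = R + l" "0 < g x" for x
    proof -
      have x: "x \<noteq> 0" using that R by auto
      have rW: "radial_deriv W x = F' B"
        unfolding W_def using radial_deriv_polar_product[OF x F angular_one] that R by (simp add: B_def)
      have "2 * d * B = 1 / (2 * B ^ (m + 2))"
        using B by (simp add: d_def power_add power2_eq_square power3_eq_cube field_simps)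
      also have "\<dots> < (real m + 1) / B ^ (m + 2)" using B by (simp add: field_simps)
      finally have "0 < F' B" by (simp add: F'_def)
      then show ?thesis using that outer[of x] by (simp add: rW)
    qed
  qed (use R x harm inner CkW compact_closed_shell in \<open>auto simp: inner\<close>)
qed

text \<open>Any two points of equal norm are exchanged by a reflection. Hence \<open>f\<close> is radial, and in particular
  constant on the inner sphere.\<close>

lemma steklov_neumann_below_constant:
  fixes f :: "real^'n::finite \<Rightarrow> real"
  assumes n: "CARD('n) = m + 3" and R: "0 < R" "0 < l"
    and f: "f \<in> steklov_neumann_eigenspace R l t" and t: "t < neumann_value CARD('n) R (R + l)"
  shows "\<exists>c. \<forall>x\<in>closed_shell R l. f x = c"
proof -
  obtain U where U: "open U" "closed_shell R l \<subseteq> U" and Ck: "\<And>k. Ck_on k U f"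
    using f by (auto simp: steklov_neumann_eigenspace_def smooth_near_def)
  have harm: "\<And>x. x \<in> shell R l \<Longrightarrow> laplacian f x = 0"
    and outer: "\<And>x. norm x = R + l \<Longrightarrow> radial_deriv f x = 0"
    and inner: "\<And>x. norm x = R \<Longrightarrow> - radial_deriv f x = t * f x"
    using f by (auto simp: steklov_neumann_eigenspace_def)
  have le: "f x \<le> f y" if xy: "norm x = norm y" "x \<in> closed_shell R l" "x \<noteq> y" for x y
  proof -
    \<comment> \<open>the reflection that exchanges \<open>x\<close> and \<open>y\<close>\<close>
    define e where "e = (x - y) /\<^sub>R norm (x - y)"
    have e: "norm e = 1" using xy by (simp add: e_def)
    have yy: "y \<bullet> y = x \<bullet> x" using xy(1) by (simp add: dot_square_norm)
    have nn: "norm (x - y) * norm (x - y) = 2 * (x \<bullet> (x - y))"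
      by (simp add: dot_square_norm[symmetric] power2_eq_square[symmetric] yy inner_diff_left
          inner_diff_right inner_commute)
    have xe: "x \<bullet> e = norm (x - y) / 2"
    proof -
      have "x \<bullet> e = (x \<bullet> (x - y)) / norm (x - y)" by (simp add: e_def divide_inverse)
      also have "x \<bullet> (x - y) = norm (x - y) * norm (x - y) / 2" using nn by simp
      finally show ?thesis using xy(3) by simp
    qed
    have "reflection e x = y" using xy(3) by (simp add: reflection_def xe) (simp add: e_def)
    then show ?thesis
      using steklov_neumann_reflection_le[OF _ R t e U Ck harm outer inner xy(2)] n xe by simp
  qed
  have eq: "f x = f y" if "norm x = norm y" "x \<in> closed_shell R l" for x y
  proof (cases "x = y")
    case False
    then show ?thesis using le[of x y] le[of y x] that by (auto simp: mem_closed_shell)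
  qed simp
  obtain p :: "real^'n" where p: "norm p = R" using vector_choose_size[of R] R by auto
  define c where "c = f p"
  have sgn: "s * (f x - c) \<le> 0" if x: "x \<in> closed_shell R l" for x s
  proof -
    define g where "g = (\<lambda>y. s * f y + (- s * c) * 1)"
    have dU: "f differentiable (at y)" if "y \<in> closed_shell R l" for y
      using Ck_on_2D(1)[OF Ck] U that by auto
    have "g x \<le> 0"
    proof (rule shell_neumann_constant_le[OF n R U _ _ _ _ x])
      show "Ck_on 2 U g" unfolding g_def by (rule Ck_on_lincomb[OF U(1) Ck Ck_on_const[OF U(1)]])
      show "laplacian g y = 0" if "y \<in> shell R l" for y
      proof -
        have "y \<in> U" using that U by (auto simp: mem_shell mem_closed_shell subset_iff)
        moreover have "laplacian (\<lambda>y::real^'n. 1) y = 0"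
          by (simp add: laplacian_def pderiv_at_def[abs_def])
        ultimately show ?thesis
          unfolding g_def using laplacian_lincomb[OF U(1) _ Ck Ck_on_const[OF U(1)], of y s "- s * c" 1] harm[OF that]
          by simp
      qed
      show "radial_deriv g y = 0" if "norm y = R + l" for y
      proof -
        have "y \<in> closed_shell R l" using that R by (simp add: mem_closed_shell)
        moreover have "radial_deriv (\<lambda>y::real^'n. 1) y = 0" by (simp add: radial_deriv_def)
        ultimately show ?thesis
          unfolding g_def using radial_deriv_lincomb[OF dU, of y "\<lambda>y. 1" s "- s * c"] outer[OF that]
          by simp
      qed
      show "g y = 0" if "norm y = R" for y
        using eq[of y p] that p R by (simp add: g_def c_def mem_closed_shell)
    qed
    then show ?thesis by (simp add: g_def algebra_simps)
  qed
  have "\<forall>x\<in>closed_shell R l. f x = c" using sgn[of _ 1] sgn[of _ "-1"] by fastforce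
  then show ?thesis by blast
qed

lemma kth_eigenvalue_ge:
  assumes "\<And>s t f. (\<And>i. i \<le> k \<Longrightarrow> t i \<le> s \<and> f i \<in> E (t i)) \<Longrightarrow> lin_indep_upto X k f \<Longrightarrow> c \<le> ereal s"
  shows "c \<le> kth_eigenvalue X E k"
  unfolding kth_eigenvalue_def by (rule Inf_greatest) (use assms in auto)

lemma lin_indep_upto_not_zero:
  assumes "lin_indep_upto X k f" "i \<le> k"
  shows "\<exists>x\<in>X. f i x \<noteq> 0"
proof (rule ccontr)
  assume "\<not> ?thesis"
  then have "\<forall>x\<in>X. (\<Sum>j\<le>k. (if j = i then 1 else 0) * f j x) = 0"
    by (auto intro!: sum.neutral)
  from assms(1)[unfolded lin_indep_upto_def, rule_format, OF this[rule_format] assms(2)]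
  show False by simp
qed

lemma sigmaD_ge:
  assumes n: "CARD('n::finite) = m + 3" and R: "0 < R" "0 < l"
  shows "ereal (dirichlet_value CARD('n) R (R + l)) \<le> sigmaD TYPE('n) R l 0"
  unfolding sigmaD_def
proof (rule kth_eigenvalue_ge)
  fix s :: real and t :: "nat \<Rightarrow> real" and f :: "nat \<Rightarrow> real^'n \<Rightarrow> real"
  assume *: "\<And>i. i \<le> 0 \<Longrightarrow> t i \<le> s \<and> f i \<in> steklov_dirichlet_eigenspace R l (t i)"
    and ind: "lin_indep_upto (closed_shell R l) 0 f"
  have ts: "t 0 \<le> s" and f: "f 0 \<in> steklov_dirichlet_eigenspace R l (t 0)" using *[of 0] by auto
  show "ereal (dirichlet_value CARD('n) R (R + l)) \<le> ereal s"
  proof (rule ccontr)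
    assume "\<not> ?thesis"
    then have t: "t 0 < dirichlet_value CARD('n) R (R + l)" using ts by simp
    obtain U where U: "open U" "closed_shell R l \<subseteq> U" and Ck: "\<And>k. Ck_on k U (f 0)"
      using f by (auto simp: steklov_dirichlet_eigenspace_def smooth_near_def)
    have harm: "\<And>x. x \<in> shell R l \<Longrightarrow> laplacian (f 0) x = 0"
      and outer: "\<And>x. norm x = R + l \<Longrightarrow> f 0 x = 0"
      and inner: "\<And>x. norm x = R \<Longrightarrow> - radial_deriv (f 0) x = t 0 * f 0 x"
      using f by (auto simp: steklov_dirichlet_eigenspace_def)
    have "s * f 0 x \<le> 0" if x: "x \<in> closed_shell R l" for x s
    proof -
      define g where "g = (\<lambda>y. s * f 0 y + 0 * f 0 y)"
      have "g x \<le> 0"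
      proof (rule steklov_dirichlet_nonpos[OF n R t U _ _ _ _ x])
        show "Ck_on 2 U g" unfolding g_def by (rule Ck_on_lincomb[OF U(1) Ck Ck])
        show "laplacian g y = 0" if "y \<in> shell R l" for y
        proof -
          have "y \<in> U" using that U by (auto simp: mem_shell mem_closed_shell subset_iff)
          then show ?thesis unfolding g_def by (subst laplacian_lincomb[OF U(1) _ Ck Ck]) (simp_all add: harm that)
        qed
        show "- radial_deriv g y = t 0 * g y" if "norm y = R" for y
        proof -
          have "y \<in> closed_shell R l" using that R by (simp add: mem_closed_shell)
          then have "f 0 differentiable (at y)" using Ck_on_2D(1)[OF Ck] U by auto
          moreover have "radial_deriv (f 0) y = - (t 0 * f 0 y)" using inner[OF that] by linarith
          ultimately show ?thesis
            unfolding g_def by (subst radial_deriv_lincomb) simp_all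
        qed
      qed (simp add: g_def outer)
      then show ?thesis by (simp add: g_def)
    qed
    from this[of _ 1] this[of _ "-1"] have "f 0 x = 0" if "x \<in> closed_shell R l" for x
      using that by fastforce
    then show False using lin_indep_upto_not_zero[OF ind, of 0] by auto
  qed
qed

lemma sigmaD_degenerate:
  assumes "0 < R"
  shows "sigmaD TYPE('n::finite) R 0 0 = \<infinity>"
proof -
  have "\<infinity> \<le> sigmaD TYPE('n) R 0 0"
    unfolding sigmaD_def
  proof (rule kth_eigenvalue_ge)
    fix s :: real and t :: "nat \<Rightarrow> real" and f :: "nat \<Rightarrow> real^'n \<Rightarrow> real"
    assume *: "\<And>i. i \<le> 0 \<Longrightarrow> t i \<le> s \<and> f i \<in> steklov_dirichlet_eigenspace R 0 (t i)"
      and "lin_indep_upto (closed_shell R 0) 0 f"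
    from lin_indep_upto_not_zero[OF this(2), of 0] obtain x where "norm x = R" "f 0 x \<noteq> 0"
      by (auto simp: mem_closed_shell)
    then have False using *[of 0] by (auto simp: steklov_dirichlet_eigenspace_def)
    then show "\<infinity> \<le> ereal s" by simp
  qed
  then show ?thesis by simp
qed

lemma sigmaN_ge:
  assumes n: "CARD('n::finite) = m + 3" and R: "0 < R" "0 \<le> l"
  shows "ereal (neumann_value CARD('n) R (R + l)) \<le> sigmaN TYPE('n) R l 1"
  unfolding sigmaN_def
proof (rule kth_eigenvalue_ge)
  fix s :: real and t :: "nat \<Rightarrow> real" and f :: "nat \<Rightarrow> real^'n \<Rightarrow> real"
  assume *: "\<And>i. i \<le> 1 \<Longrightarrow> t i \<le> s \<and> f i \<in> steklov_neumann_eigenspace R l (t i)"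
    and ind: "lin_indep_upto (closed_shell R l) 1 f"
  show "ereal (neumann_value CARD('n) R (R + l)) \<le> ereal s"
  proof (rule ccontr)
    assume "\<not> ?thesis"
    then have s: "s < neumann_value CARD('n) R (R + l)" by simp
    show False
    proof (cases "l = 0")
      case True
      obtain x where x: "norm x = R" "f 0 x \<noteq> 0"
        using lin_indep_upto_not_zero[OF ind, of 0] True by (auto simp: mem_closed_shell)
      then have "radial_deriv (f 0) x = 0" "- radial_deriv (f 0) x = t 0 * f 0 x"
        using *[of 0] True by (auto simp: steklov_neumann_eigenspace_def)
      then have "t 0 = 0" using x by simp
      then show False using s *[of 0] R True by (simp add: neumann_value_def)
    next
      case False
      then have l: "0 < l" using R by simp
      have "\<exists>c. \<forall>x\<in>closed_shell R l. f i x = c" if "i \<le> 1" for i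
        using *[OF that] s by (intro steklov_neumann_below_constant[OF n R(1) l, of _ "t i"]) auto
      then obtain a b where ab: "\<And>x. x \<in> closed_shell R l \<Longrightarrow> f 0 x = a"
        "\<And>x. x \<in> closed_shell R l \<Longrightarrow> f 1 x = b"
        by (metis le_refl zero_le)
      obtain x where "x \<in> closed_shell R l" "f 0 x \<noteq> 0"
        using lin_indep_upto_not_zero[OF ind, of 0] by auto
      then have a: "a \<noteq> 0" using ab by auto
      \<comment> \<open>two constants are linearly dependent\<close>
      have "\<forall>x\<in>closed_shell R l. (\<Sum>i\<le>1. (if i = 0 then b else - a) * f i x) = 0"
        using ab by (simp add: atMost_Suc)
      from ind[unfolded lin_indep_upto_def, rule_format, OF this[rule_format], of 1] a
      show False by simp
    qed
  qed
qed

section \<open>Separated Steklov eigenfunctions\<close>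

lemma hypersurface_neighbourhood:
  assumes M: "hypersurface_of_revolution L h R1 R2"
  obtains a b where "a < 0" "L < b" "\<And>t. t \<in> {a..b} \<Longrightarrow> 0 < h t" "continuous_on {a..b} h"
    "\<And>k. Ck_on k {a<..<b} h"
proof -
  obtain U where U: "open U" "{0..L} \<subseteq> U" and Ck: "\<And>k. Ck_on k U h"
    using M by (auto simp: hypersurface_of_revolution_def smooth_near_def)
  define V where "V = U \<inter> h -` {0<..}"
  have cont: "continuous_on U h" by (rule Ck_on_imp_continuous_on[OF Ck])
  have V: "open V" unfolding V_def by (rule continuous_open_preimage[OF cont U(1)]) simp
  have L: "0 < L" and V0L: "{0..L} \<subseteq> V"
    using M U by (auto simp: hypersurface_of_revolution_def V_def)
  then have "0 \<in> V" "L \<in> V" by auto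
  then obtain d e where d: "0 < d" "cball 0 d \<subseteq> V" and e: "0 < e" "cball L e \<subseteq> V"
    using V unfolding open_contains_cball by metis
  have sub: "{- d..L + e} \<subseteq> V"
  proof
    fix t assume t: "t \<in> {- d..L + e}"
    consider "t \<in> cball 0 d" | "t \<in> cball L e" | "t \<in> {0..L}"
      using t by (fastforce simp: dist_real_def)
    then show "t \<in> V" using d e V0L by cases auto
  qed
  show thesis
  proof (rule that[of "- d" "L + e"])
    show "0 < h t" if "t \<in> {- d..L + e}" for t using sub that by (auto simp: V_def)
    show "continuous_on {- d..L + e} h" using continuous_on_subset[OF cont] sub by (auto simp: V_def)
    have "{- d<..<L + e} \<subseteq> U"
      using sub greaterThanLessThan_subseteq_atLeastAtMost_iff[of "- d" "L + e" "- d" "L + e"]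
      by (auto simp: V_def)
    then show "Ck_on k {- d<..<L + e} h" for k using Ck_on_subset[OF Ck] by blast
  qed (use d e in auto)
qed

text \<open>The separated equation as a first-order system; \<open>z\<close> is the flux \<open>h\<^sup>n\<^sup>-\<^sup>1 y'\<close>.\<close>

definition radial_solution ::
  "(real \<Rightarrow> real) \<Rightarrow> nat \<Rightarrow> real \<Rightarrow> real set \<Rightarrow> (real \<Rightarrow> real) \<Rightarrow> (real \<Rightarrow> real) \<Rightarrow> bool"
where
  "radial_solution h m \<mu> V y z \<longleftrightarrow> (\<forall>t\<in>V. (y has_real_derivative z t / h t ^ (m + 2)) (at t) \<and>
     (z has_real_derivative \<mu> * h t ^ m * y t) (at t))"

lemma radial_solution_lincomb:
  assumes "radial_solution h m \<mu> V y z" "radial_solution h m \<mu> V y' z'"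
  shows "radial_solution h m \<mu> V (\<lambda>t. c * y t + d * y' t) (\<lambda>t. c * z t + d * z' t)"
  unfolding radial_solution_def
proof (intro ballI conjI)
  fix t assume t: "t \<in> V"
  have D: "(y has_real_derivative z t / h t ^ (m + 2)) (at t)"
    "(z has_real_derivative \<mu> * h t ^ m * y t) (at t)"
    "(y' has_real_derivative z' t / h t ^ (m + 2)) (at t)"
    "(z' has_real_derivative \<mu> * h t ^ m * y' t) (at t)"
    using assms t by (auto simp: radial_solution_def)
  show "((\<lambda>t. c * y t + d * y' t) has_real_derivative (c * z t + d * z' t) / h t ^ (m + 2)) (at t)"
    using DERIV_add[OF DERIV_cmult[OF D(1), of c] DERIV_cmult[OF D(3), of d]]
    by (simp add: add_divide_distrib)
  show "((\<lambda>t. c * z t + d * z' t) has_real_derivative \<mu> * h t ^ m * (c * y t + d * y' t)) (at t)"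
    using DERIV_add[OF DERIV_cmult[OF D(2), of c] DERIV_cmult[OF D(4), of d]]
    by (simp add: algebra_simps)
qed

lemma radial_solution_exists:
  assumes "a < b" "\<And>t. t \<in> {a..b} \<Longrightarrow> 0 < h t" "continuous_on {a..b} h"
  obtains y z where "radial_solution h m \<mu> {a<..<b} y z" "y 0 = A" "z 0 = B"
proof -
  have "continuous_on {a..b} (\<lambda>t. 1 / h t ^ (m + 2))"
    using assms(2) by (intro continuous_intros assms(3)) (auto simp: less_imp_neq[symmetric])
  moreover have "continuous_on {a..b} (\<lambda>t. \<mu> * h t ^ m)" by (intro continuous_intros assms(3))
  ultimately show thesis
    using linear_system_solution[OF assms(1), of "\<lambda>t. 1 / h t ^ (m + 2)" "\<lambda>t. \<mu> * h t ^ m" A B] that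
    by (auto simp: radial_solution_def)
qed

lemma Ck_on_radial_solution:
  assumes V: "open V" and sol: "radial_solution h m \<mu> V y z"
    and h: "\<And>t. t \<in> V \<Longrightarrow> 0 < h t" "\<And>k. Ck_on k V h"
  shows "Ck_on k V y"
proof -
  have "Ck_on k V y \<and> Ck_on k V z"
  proof (rule Ck_on_linear_system_solution[OF V])
    have "Ck_on k V (\<lambda>t. inverse (h t ^ (m + 2)))" for k
      using h(1) by (intro Ck_on_inverse Ck_on_power V h(2)) (metis less_irrefl zero_less_power)
    then show "Ck_on k V (\<lambda>t. 1 / h t ^ (m + 2))" for k by (simp add: inverse_eq_divide)
    show "Ck_on k V (\<lambda>t. \<mu> * h t ^ m)" for k
      by (intro Ck_on_mult Ck_on_const Ck_on_power V h(2))
  qed (use sol in \<open>auto simp: radial_solution_def\<close>)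
  then show ?thesis by simp
qed

lemma steklov_eigenfunction:
  fixes Z :: "real^'n::finite \<Rightarrow> real"
  assumes n: "CARD('n) = m + 3" and ab: "a < 0" "0 < L" "L < b"
    and h: "\<And>t. t \<in> {a<..<b} \<Longrightarrow> 0 < h t" "\<And>k. Ck_on k {a<..<b} h"
    and sol: "radial_solution h m \<mu> {a<..<b} y z"
    and Z: "angular Z g (\<lambda>x. - \<mu> / (norm x)\<^sup>2 * Z x)" "\<And>k. Ck_on k (- {0}) Z"
      "\<And>x. Z (x /\<^sub>R norm x) = Z x"
    and bc: "- z 0 / h 0 ^ (m + 2) = s * y 0" "z L / h L ^ (m + 2) = s * y L"
  shows "(\<lambda>q. y (fst q) * Z (snd q)) \<in> steklov_eigenspace L h s"
proof -
  let ?V = "{a<..<b}" and ?u = "\<lambda>q. y (fst q) * Z (snd q)"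
  have up: "?u \<circ> polar = (\<lambda>x. y (norm x - 1) * Z x)" by (auto simp: polar_def Z(3))
  have dy: "(y has_real_derivative z t / h t ^ (m + 2)) (at t)" if "t \<in> ?V" for t
    using sol that by (auto simp: radial_solution_def)
  have smooth: "smooth_on_cyl L ?u"
    unfolding smooth_on_cyl_def smooth_near_def up
  proof (intro exI conjI allI)
    let ?W = "- {0::real^'n} \<inter> (\<lambda>x. norm x - 1) -` ?V"
    have "open ((\<lambda>x::real^'n. norm x - 1) -` ?V)"
      by (rule open_vimage) (auto intro!: continuous_intros)
    then show W: "open ?W" by auto
    show "{x. 1 \<le> norm x \<and> norm x \<le> 1 + L} \<subseteq> ?W" using ab by auto
    show "Ck_on k ?W (\<lambda>x. y (norm x - 1) * Z x)" for k
    proof (rule Ck_on_mult[OF W Ck_on_compose[OF W, where f = "\<lambda>x. norm x - 1" and V = ?V and \<phi> = y]])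
      show "Ck_on k ?V y" by (rule Ck_on_radial_solution[OF _ sol h]) auto
      have "Ck_on k ?W (norm :: real^'n \<Rightarrow> real)" by (rule Ck_on_subset[OF Ck_on_norm]) auto
      then show "Ck_on k ?W (\<lambda>x. norm x - 1)" by (rule Ck_on_diff[OF W _ Ck_on_const[OF W]])
      show "Ck_on k ?W Z" by (rule Ck_on_subset[OF Z(2)]) auto
    qed auto
  qed
  have hd: "h differentiable (at t)" if "t \<in> ?V" for t using h(2)[of "Suc 0"] that by auto
  have harm: "revolution_laplacian h ?u q = 0" if "q \<in> cyl_interior L" for q :: "real \<times> (real^'n)"
  proof -
    obtain t p where "q = (t, p)" by (cases q)
    then have q: "q = (t, p)" "0 < t" "t < L" "norm p = 1"
      using that by (auto simp: cyl_interior_def)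
    then have np: "norm (polar_inv q) = 1 + t" by (simp add: polar_inv_def)
    show ?thesis
      unfolding revolution_laplacian_def up
    proof (rule laplace_beltrami_polar_product[OF n _ _ _ h(1) hd])
      show "open ?V" by simp
      show "polar_inv q \<noteq> 0" using np q by auto
      show "norm (polar_inv q) - 1 \<in> ?V" unfolding np using q ab by simp
    qed (use sol Z(1) in \<open>auto simp: radial_solution_def\<close>)
  qed
  have bdry: "s * ?u q = cyl_normal_deriv ?u q" if "q \<in> cyl_boundary L" for q :: "real \<times> (real^'n)"
  proof -
    obtain t p where "q = (t, p)" by (cases q)
    then have q: "q = (t, p)" "t = 0 \<or> t = L" using that by (auto simp: cyl_boundary_def)
    then have "t \<in> ?V" using ab by auto
    from DERIV_imp_deriv[OF DERIV_cmult_right[OF dy[OF this], of "Z p"]]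
    have d: "deriv (\<lambda>r. y r * Z p) t = z t / h t ^ (m + 2) * Z p" .
    show ?thesis
      using q(2)
    proof
      assume "t = 0"
      have "- (z 0 / h 0 ^ (m + 2)) = s * y 0" using bc(1) by (simp only: minus_divide_left)
      then have "z 0 / h 0 ^ (m + 2) = - (s * y 0)" by linarith
      then show ?thesis
        using d q(1) \<open>t = 0\<close> by (simp only: cyl_normal_deriv_def fst_conv snd_conv) simp
    next
      assume "t = L"
      then show ?thesis
        using d[unfolded \<open>t = L\<close> bc(2)] q(1) ab by (simp only: cyl_normal_deriv_def fst_conv snd_conv) simp
    qed
  qed
  show ?thesis
    unfolding steklov_eigenspace_def DtN_def harmonic_extension_def
    using smooth harm bdry by blast
qed

text \<open>The constants are eigenfunctions for \<open>0\<close>, so that one further nonconstant eigenfunction is enough.\<close>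

lemma steklov_eigenvalue_1_le:
  fixes f :: "real \<times> (real^'n::finite) \<Rightarrow> real"
  assumes n: "CARD('n) = m + 3" and M: "hypersurface_of_revolution L h R1 R2"
    and f: "f \<in> steklov_eigenspace L h s" "0 \<le> s"
    and q: "q \<in> cyl_boundary L" "q' \<in> cyl_boundary L" "f q \<noteq> f q'"
  shows "steklov_eigenvalue TYPE('n) L h 1 \<le> ereal s"
proof -
  have L: "0 < L" using M by (simp add: hypersurface_of_revolution_def)
  obtain a b where ab: "a < 0" "L < b" "\<And>t. t \<in> {a..b} \<Longrightarrow> 0 < h t" "\<And>k. Ck_on k {a<..<b} h"
    using hypersurface_neighbourhood[OF M] by metis
  have const: "(\<lambda>q::real \<times> (real^'n). 1 * 1) \<in> steklov_eigenspace L h 0"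
  proof (rule steklov_eigenfunction[OF n ab(1) L ab(2) _ ab(4), where y = "\<lambda>_. 1" and z = "\<lambda>_. 0"
        and \<mu> = 0 and Z = "\<lambda>_. 1" and g = "\<lambda>x. 0"])
    show "angular (\<lambda>x::real^'n. 1) (\<lambda>x. 0) (\<lambda>x. - 0 / (norm x)\<^sup>2 * 1)"
      using angular_one by simp
  qed (use ab(3) in \<open>auto simp: radial_solution_def intro: Ck_on_const\<close>)
  let ?f = "\<lambda>i::nat. if i = 0 then (\<lambda>q. 1 * 1) else f"
  have ind: "lin_indep_upto (cyl_boundary L) 1 ?f"
    unfolding lin_indep_upto_def
  proof (intro allI impI)
    fix c :: "nat \<Rightarrow> real" and i :: nat
    assume "\<forall>x\<in>cyl_boundary L. (\<Sum>i\<le>1. c i * ?f i x) = 0" and i: "i \<le> 1"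
    then have "c 0 + c 1 * f q = 0" "c 0 + c 1 * f q' = 0" using q by (auto simp: atMost_Suc)
    then have "c 1 * f q = c 1 * f q'" by linarith
    then have "c 1 = 0" "c 0 = 0" using q(3) \<open>c 0 + c 1 * f q = 0\<close> by auto
    then show "c i = 0" using i by (cases i) auto
  qed
  show ?thesis
    unfolding steklov_eigenvalue_def kth_eigenvalue_def
  proof (rule Inf_lower, rule CollectI, intro exI conjI allI impI)
    show "(if i = 0 then 0 else s) \<le> s" for i :: nat using f by simp
    show "?f i \<in> steklov_eigenspace L h (if i = 0 then 0 else s)" for i using const f by simp
  qed (use ind in auto)
qed

text \<open>The nonconstant radial eigenfunction: \<open>S\<close> is a radial harmonic function, and the eigenfunction is
  the affine function of \<open>S\<close> selected by the boundary conditions.\<close>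

lemma steklov_eigenvalue_le_radial:
  assumes n: "CARD('n::finite) = m + 3" and M: "hypersurface_of_revolution L h R1 R2"
  obtains S where "S 0 = 0"
    "\<And>t. t \<in> {0..L} \<Longrightarrow> (S has_real_derivative 1 / h t ^ (m + 2)) (at t)"
    "0 < S L \<Longrightarrow> steklov_eigenvalue TYPE('n) L h 1 \<le> ereal ((1 / R1 ^ (m + 2) + 1 / R2 ^ (m + 2)) / S L)"
proof -
  have L: "0 < L" and R: "h 0 = R1" "h L = R2"
    using M by (auto simp: hypersurface_of_revolution_def)
  obtain a b where ab: "a < 0" "L < b" "\<And>t. t \<in> {a..b} \<Longrightarrow> 0 < h t" "continuous_on {a..b} h"
    "\<And>k. Ck_on k {a<..<b} h"
    using hypersurface_neighbourhood[OF M] by metis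
  have "a < b" using ab L by simp
  from radial_solution_exists[OF this ab(3,4), of m 0 0 1]
  obtain S z where sol: "radial_solution h m 0 {a<..<b} S z" and S0: "S 0 = 0" "z 0 = 1" by metis
  have z1: "z t = 1" if "t \<in> {a<..<b}" for t
  proof -
    have "\<exists>c. \<forall>x\<in>{a<..<b}. z x = c"
    proof (rule has_field_derivative_zero_constant)
      show "(z has_real_derivative 0) (at x within {a<..<b})" if "x \<in> {a<..<b}" for x
        using sol that by (auto simp: radial_solution_def intro: has_field_derivative_at_within)
    qed simp
    then show ?thesis using that S0(2) ab L by force
  qed
  have S': "(S has_real_derivative 1 / h t ^ (m + 2)) (at t)" if "t \<in> {a<..<b}" for t
  proof -
    have "(S has_real_derivative z t / h t ^ (m + 2)) (at t)"
      using sol that unfolding radial_solution_def by blast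
    then show ?thesis unfolding z1[OF that] .
  qed
  have R0: "0 < R1" "0 < R2" using ab(3)[of 0] ab(3)[of L] ab(1,2) L R by auto
  have sol1: "radial_solution h m 0 {a<..<b} (\<lambda>_. 1) (\<lambda>_. 0)"
    and solS: "radial_solution h m 0 {a<..<b} S (\<lambda>_. 1)"
    using S' unfolding radial_solution_def by auto
  have "steklov_eigenvalue TYPE('n) L h 1 \<le> ereal ((1 / R1 ^ (m + 2) + 1 / R2 ^ (m + 2)) / S L)"
    if SL: "0 < S L"
  proof -
    define s where "s = (1 / R1 ^ (m + 2) + 1 / R2 ^ (m + 2)) / S L"
    define y where "y t = 1 * 1 + (- s * R1 ^ (m + 2)) * S t" for t
    define x where "x = R1 ^ (m + 2)"
    define x' where "x' = R2 ^ (m + 2)"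
    have x: "0 < x" "0 < x'" using R0 by (simp_all add: x_def x'_def)
    have s: "s * S L = 1 / x + 1 / x'" "0 < s"
      using SL x by (simp_all add: s_def x_def x'_def add_pos_pos)
    have "y L = 1 - x * (s * S L)" by (simp add: y_def x_def)
    then have yL: "y L = - (x / x')" using x by (simp add: s field_simps)
    obtain p :: "real^'n" where p: "norm p = 1" using vector_choose_size[of 1] by auto
    let ?f = "\<lambda>q::real \<times> (real^'n). y (fst q) * 1"
    have "?f \<in> steklov_eigenspace L h s"
    proof (rule steklov_eigenfunction[OF n ab(1) L ab(2) _ ab(5), where \<mu> = 0 and g = "\<lambda>x. 0"])
      show "radial_solution h m 0 {a<..<b} y (\<lambda>_. 1 * 0 + (- s * R1 ^ (m + 2)) * 1)"
        unfolding y_def by (rule radial_solution_lincomb[OF sol1 solS])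
      show "angular (\<lambda>x::real^'n. 1) (\<lambda>x. 0) (\<lambda>x. - 0 / (norm x)\<^sup>2 * 1)"
        using angular_one by simp
      show "- (1 * 0 + - s * R1 ^ (m + 2) * 1) / h 0 ^ (m + 2) = s * y 0"
        using R0(1) by (simp add: y_def S0 R)
      show "(1 * 0 + - s * R1 ^ (m + 2) * 1) / h L ^ (m + 2) = s * y L"
        unfolding yL R by (simp add: x_def x'_def)
    qed (use ab(3) in \<open>auto intro: Ck_on_const\<close>)
    moreover have "?f (0, p) \<noteq> ?f (L, p)"
    proof -
      have "y 0 = 1" by (simp add: y_def S0)
      moreover have "y L < 0" unfolding yL using x by simp
      ultimately show ?thesis by simp
    qed
    ultimately have "steklov_eigenvalue TYPE('n) L h 1 \<le> ereal s"
      using s(2) p by (intro steklov_eigenvalue_1_le[OF n M, of ?f s "(0, p)" "(L, p)"])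
        (auto simp: cyl_boundary_def)
    then show ?thesis by (simp add: s_def)
  qed
  moreover have "(S has_real_derivative 1 / h t ^ (m + 2)) (at t)" if "t \<in> {0..L}" for t
    using S'[of t] that ab by auto
  ultimately show thesis using that S0(1) by blast
qed

lemma DERIV_nonneg_pos_imp_less:
  fixes F :: "real \<Rightarrow> real"
  assumes ab: "a < b" and F: "\<And>t. t \<in> {a..b} \<Longrightarrow> (F has_real_derivative F' t) (at t)"
    and nonneg: "\<And>t. t \<in> {a..b} \<Longrightarrow> 0 \<le> F' t" and c: "c \<in> {a..b}" "0 < F' c"
  shows "F a < F b"
proof -
  have mono: "F s \<le> F t" if "s \<le> t" "s \<in> {a..b}" "t \<in> {a..b}" for s t
  proof (rule DERIV_nonneg_imp_nondecreasing[OF that(1)])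
    fix u assume "s \<le> u" "u \<le> t"
    then have "u \<in> {a..b}" using that by auto
    then show "\<exists>y. (F has_real_derivative y) (at u) \<and> 0 \<le> y" using F nonneg by blast
  qed
  show ?thesis
  proof (cases "c < b")
    case True
    obtain d where d: "0 < d" "\<And>h. 0 < h \<Longrightarrow> h < d \<Longrightarrow> F c < F (c + h)"
      using DERIV_pos_inc_right[OF F[OF c(1)] c(2)] by auto
    define h where "h = min d (b - c) / 2"
    have h: "0 < h" "h < d" "c + h \<in> {a..b}" using d True c by (auto simp: h_def min_def field_simps)
    have "F a \<le> F c" using c by (intro mono) auto
    also have "\<dots> < F (c + h)" using d(2)[OF h(1,2)] .
    also have "\<dots> \<le> F b" using h(3) ab by (intro mono) auto
    finally show ?thesis .
  next
    case False
    then have cb: "c = b" using c by simp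
    obtain d where d: "0 < d" "\<And>h. 0 < h \<Longrightarrow> h < d \<Longrightarrow> F (c - h) < F c"
      using DERIV_pos_inc_left[OF F[OF c(1)] c(2)] by auto
    define h where "h = min d (b - a) / 2"
    have h: "0 < h" "h < d" "c - h \<in> {a..b}" using d ab cb by (auto simp: h_def min_def field_simps)
    have "F a \<le> F (c - h)" using h(3) by (intro mono) auto
    also have "\<dots> < F b" using d(2)[OF h(1,2)] cb by simp
    finally show ?thesis .
  qed
qed

text \<open>Shooting: the solution \<open>y\<^sub>s\<close> that starts with the boundary condition for the eigenvalue \<open>s\<close> at
  the first end satisfies the one at the second end when \<open>F s = 0\<close>. As \<open>F 0 > 0\<close>, it suffices to find
  a negative value of \<open>F\<close>. It is attained at \<open>s = \<Sigma>\<close> if \<open>y\<^sub>\<Sigma>\<close> is positive, and otherwise at the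
  \<open>s\<close> for which \<open>y\<^sub>s\<close> vanishes at the second end.\<close>

lemma steklov_eigenvalue_less_zonal:
  fixes \<Sigma> :: real
  assumes n: "CARD('n::finite) = m + 3" and M: "hypersurface_of_revolution L h R1 R2" and \<Sigma>: "0 < \<Sigma>"
    and crit: "\<And>y z. (\<And>t. t \<in> {0..L} \<Longrightarrow> 0 < y t) \<Longrightarrow> radial_solution h m (real m + 2) {0..L} y z \<Longrightarrow>
      z 0 = - \<Sigma> * h 0 ^ (m + 2) * y 0 \<Longrightarrow> z L < \<Sigma> * h L ^ (m + 2) * y L"
  shows "\<exists>s<\<Sigma>. steklov_eigenvalue TYPE('n) L h 1 \<le> ereal s"
proof -
  let ?\<mu> = "real m + 2"
  have L: "0 < L" using M by (simp add: hypersurface_of_revolution_def)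
  obtain a b where ab: "a < 0" "L < b" "\<And>t. t \<in> {a..b} \<Longrightarrow> 0 < h t" "continuous_on {a..b} h"
    "\<And>k. Ck_on k {a<..<b} h"
    using hypersurface_neighbourhood[OF M] by metis
  have "a < b" using ab L by simp
  note ex = radial_solution_exists[OF this ab(3,4), of m ?\<mu>]
  obtain c zc where c: "radial_solution h m ?\<mu> {a<..<b} c zc" "c 0 = 1" "zc 0 = 0"
    using ex[of 1 0] by metis
  obtain d zd where d: "radial_solution h m ?\<mu> {a<..<b} d zd" "d 0 = 0" "zd 0 = 1"
    using ex[of 0 1] by metis
  have V: "t \<in> {a<..<b}" if "t \<in> {0..L}" for t using that ab by auto
  have hp: "0 < h t ^ k" if "t \<in> {0..L}" for t k using that ab by (intro zero_less_power ab(3)) auto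
  have Dc: "(c has_real_derivative zc t / h t ^ (m + 2)) (at t)"
    "(zc has_real_derivative ?\<mu> * h t ^ m * c t) (at t)" if "t \<in> {0..L}" for t
    using c(1) V[OF that] unfolding radial_solution_def by blast+
  have Dd: "(d has_real_derivative zd t / h t ^ (m + 2)) (at t)"
    "(zd has_real_derivative ?\<mu> * h t ^ m * d t) (at t)" if "t \<in> {0..L}" for t
    using d(1) V[OF that] unfolding radial_solution_def by blast+
  have mono: "F 0 \<le> F t" if "t \<in> {0..L}" "\<And>s. s \<in> {0..L} \<Longrightarrow> (F has_real_derivative F' s) (at s)"
    "\<And>s. s \<in> {0..L} \<Longrightarrow> 0 \<le> F' s" for F F' :: "real \<Rightarrow> real" and t
  proof (rule DERIV_nonneg_imp_nondecreasing[of 0 t F])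
    fix u assume "0 \<le> u" "u \<le> t"
    then have "u \<in> {0..L}" using that(1) by auto
    then show "\<exists>y. (F has_real_derivative y) (at u) \<and> 0 \<le> y" using that(2,3) by blast
  qed (use that(1) in auto)
  \<comment> \<open>\<open>c\<close> stays positive because its square increases\<close>
  have czc: "0 \<le> c t * zc t" if t: "t \<in> {0..L}" for t
  proof -
    have "c 0 * zc 0 \<le> c t * zc t"
    proof (rule mono[where F = "\<lambda>s. c s * zc s", OF t])
      fix s assume s: "s \<in> {0..L}"
      show "((\<lambda>s. c s * zc s) has_real_derivative
          zc s / h s ^ (m + 2) * zc s + ?\<mu> * h s ^ m * c s * c s) (at s)"
        by (rule DERIV_mult[OF Dc[OF s]])
      have "0 \<le> (zc s * zc s) / h s ^ (m + 2)" "0 \<le> ?\<mu> * h s ^ m * (c s * c s)"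
        using hp[OF s, of "m + 2"] hp[OF s, of m] by (auto simp del: power_Suc intro!: mult_nonneg_nonneg)
      then show "0 \<le> zc s / h s ^ (m + 2) * zc s + ?\<mu> * h s ^ m * c s * c s" by (simp add: mult.assoc)
    qed
    then show ?thesis by (simp add: c)
  qed
  have cc: "1 \<le> c t * c t" if t: "t \<in> {0..L}" for t
  proof -
    have "c 0 * c 0 \<le> c t * c t"
    proof (rule mono[where F = "\<lambda>s. c s * c s", OF t])
      fix s assume s: "s \<in> {0..L}"
      show "((\<lambda>s. c s * c s) has_real_derivative
          zc s / h s ^ (m + 2) * c s + zc s / h s ^ (m + 2) * c s) (at s)"
        by (rule DERIV_mult[OF Dc(1)[OF s] Dc(1)[OF s]])
      have "0 \<le> (c s * zc s) / h s ^ (m + 2)"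
        using hp[OF s, of "m + 2"] czc[OF s] by (simp del: power_Suc add: divide_nonneg_pos)
      then show "0 \<le> zc s / h s ^ (m + 2) * c s + zc s / h s ^ (m + 2) * c s" by (simp add: mult.commute)
    qed
    then show ?thesis by (simp add: c)
  qed
  have cont_c: "continuous_on {0..L} c"
    using Dc(1) by (intro continuous_at_imp_continuous_on ballI DERIV_isCont) blast
  have cpos: "0 < c t" if t: "t \<in> {0..L}" for t
  proof (rule ccontr)
    assume "\<not> 0 < c t"
    then have "\<exists>x. 0 \<le> x \<and> x \<le> t \<and> c x = 0"
      using t c(2) continuous_on_subset[OF cont_c] by (intro IVT2') auto
    then obtain x where "0 \<le> x" "x \<le> t" "c x = 0" by blast
    then show False using cc[of x] t by simp
  qed
  \<comment> \<open>this is the value \<open>F 0\<close> in the intermediate value argument below\<close>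
  have zcL: "0 < zc L"
  proof -
    have "zc 0 < zc L"
    proof (rule DERIV_pos_imp_increasing[OF L])
      fix s assume "0 \<le> s" "s \<le> L"
      then have s: "s \<in> {0..L}" by simp
      have "0 < ?\<mu> * h s ^ m * c s" using hp[OF s, of m] cpos[OF s] by (intro mult_pos_pos) auto
      then show "\<exists>y. (zc has_real_derivative y) (at s) \<and> 0 < y" using Dc(2)[OF s] by blast
    qed
    then show ?thesis by (simp add: c)
  qed
  \<comment> \<open>the Wronskian: it shows that \<open>d / c\<close> increases, hence that \<open>y\<^sub>s\<close> is positive if it is so at \<open>L\<close>\<close>
  have wronski: "c t * zd t - d t * zc t = 1" if t: "t \<in> {0..L}" for t
  proof -
    have "\<exists>k. \<forall>x\<in>{0..L}. c x * zd x - d x * zc x = k"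
    proof (rule has_field_derivative_zero_constant)
      fix s assume s: "s \<in> {0..L}"
      have "((\<lambda>x. c x * zd x - d x * zc x) has_real_derivative
          (zc s / h s ^ (m + 2) * zd s + ?\<mu> * h s ^ m * d s * c s)
          - (zd s / h s ^ (m + 2) * zc s + ?\<mu> * h s ^ m * c s * d s)) (at s)"
        by (rule DERIV_diff[OF DERIV_mult[OF Dc(1)[OF s] Dd(2)[OF s]] DERIV_mult[OF Dd(1)[OF s] Dc(2)[OF s]]])
      then have "((\<lambda>x. c x * zd x - d x * zc x) has_real_derivative 0) (at s)"
        by (simp add: mult_ac)
      then show "((\<lambda>x. c x * zd x - d x * zc x) has_real_derivative 0) (at s within {0..L})"
        by (rule has_field_derivative_at_within)
    qed simp
    then obtain k where k: "\<And>x. x \<in> {0..L} \<Longrightarrow> c x * zd x - d x * zc x = k" by blast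
    from k[OF t] k[of 0] L show ?thesis by (simp add: c d)
  qed
  have Ddc: "((\<lambda>s. d s / c s) has_real_derivative 1 / (h s ^ (m + 2) * (c s * c s))) (at s)"
    if s: "s \<in> {0..L}" for s
  proof -
    have "c s \<noteq> 0" "h s ^ (m + 2) \<noteq> 0" using cpos[OF s] hp[OF s, of "m + 2"] by auto
    note D = DERIV_divide[OF Dd(1)[OF s] Dc(1)[OF s] this(1)]
    have "(zd s / h s ^ (m + 2) * c s - d s * (zc s / h s ^ (m + 2))) =
        (c s * zd s - d s * zc s) / h s ^ (m + 2)"
      by (simp add: diff_divide_distrib mult.commute)
    with D wronski[OF s] show ?thesis by simp
  qed
  have Ddc_pos: "0 < 1 / (h s ^ (m + 2) * (c s * c s))" if s: "s \<in> {0..L}" for s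
    using cpos[OF s] hp[OF s, of "m + 2"] by (intro divide_pos_pos mult_pos_pos) auto
  have dc_le: "d t / c t \<le> d L / c L" if t: "t \<in> {0..L}" for t
  proof (rule DERIV_nonneg_imp_nondecreasing[of t L "\<lambda>s. d s / c s"])
    show "t \<le> L" using t by simp
    fix s assume "t \<le> s" "s \<le> L"
    then have "s \<in> {0..L}" using t by simp
    then show "\<exists>y. ((\<lambda>s. d s / c s) has_real_derivative y) (at s) \<and> 0 \<le> y"
      using Ddc[of s] Ddc_pos[of s] by (blast intro: less_imp_le)
  qed
  have "d 0 / c 0 < d L / c L"
  proof (rule DERIV_pos_imp_increasing[OF L, of "\<lambda>s. d s / c s"])
    fix s assume "0 \<le> s" "s \<le> L"
    then have "s \<in> {0..L}" by simp
    then show "\<exists>y. ((\<lambda>s. d s / c s) has_real_derivative y) (at s) \<and> 0 < y"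
      using Ddc[of s] Ddc_pos[of s] by blast
  qed
  then have "0 < d L / c L" by (simp add: d)
  moreover have cL: "0 < c L" using cpos[of L] L by simp
  ultimately have dL: "0 < d L" by (simp add: zero_less_divide_iff)
  define H0 where "H0 = h 0 ^ (m + 2)"
  define HL where "HL = h L ^ (m + 2)"
  have H: "0 < H0" "0 < HL" unfolding H0_def HL_def by (rule hp, use L in simp)+
  define y where "y s t = 1 * c t + (- s * H0) * d t" for s t
  define z where "z s t = 1 * zc t + (- s * H0) * zd t" for s t
  define F where "F s = z s L - s * HL * y s L" for s
  define s0 where "s0 = c L / (H0 * d L)"
  have s0: "0 < s0" using cL dL H by (simp add: s0_def)
  have ysol: "radial_solution h m ?\<mu> {a<..<b} (y s) (z s)" for s
    unfolding y_def z_def by (rule radial_solution_lincomb[OF c(1) d(1)])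
  have Fneg: "F (min \<Sigma> s0) < 0"
  proof (cases "s0 \<le> \<Sigma>")
    case True
    have "s0 * H0 = c L / d L" using H dL by (simp add: s0_def)
    then have "y s0 L = 0" "z s0 L = (d L * zc L - c L * zd L) / d L"
      using dL by (simp_all add: y_def z_def field_simps)
    moreover have "d L * zc L - c L * zd L = - 1" using wronski[of L] L by simp
    ultimately have "F s0 = - 1 / d L" by (simp add: F_def)
    then show ?thesis using True dL by simp
  next
    case False
    have ypos: "0 < y \<Sigma> t" if t: "t \<in> {0..L}" for t
    proof -
      have "d t \<le> d L / c L * c t" using dc_le[OF t] cpos[OF t] by (simp add: pos_divide_le_eq)
      then have "\<Sigma> * H0 * d t \<le> \<Sigma> * H0 * (d L / c L * c t)" using \<Sigma> H by (intro mult_left_mono) auto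
      also have "\<dots> = (\<Sigma> * (H0 * d L / c L)) * c t" by simp
      also have "\<Sigma> * (H0 * d L / c L) < 1"
        using False H dL cL by (simp add: s0_def pos_less_divide_eq field_simps)
      then have "(\<Sigma> * (H0 * d L / c L)) * c t < 1 * c t" using cpos[OF t] by (rule mult_strict_right_mono)
      finally show ?thesis by (simp add: y_def)
    qed
    have "z \<Sigma> L < \<Sigma> * h L ^ (m + 2) * y \<Sigma> L"
    proof (rule crit[OF ypos])
      show "radial_solution h m ?\<mu> {0..L} (y \<Sigma>) (z \<Sigma>)"
        using ysol[of \<Sigma>] V unfolding radial_solution_def by blast
      show "z \<Sigma> 0 = - \<Sigma> * h 0 ^ (m + 2) * y \<Sigma> 0" by (simp add: y_def z_def c d H0_def)
    qed
    then show ?thesis using False by (simp add: F_def HL_def)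
  qed
  have "\<exists>s. 0 \<le> s \<and> s \<le> min \<Sigma> s0 \<and> F s = 0"
  proof (rule IVT2')
    show "0 \<le> F 0" using zcL by (simp add: F_def z_def)
    show "continuous_on {0..min \<Sigma> s0} F"
      unfolding F_def[abs_def] y_def z_def by (intro continuous_intros)
  qed (use Fneg s0 \<Sigma> in auto)
  then obtain s where s: "0 \<le> s" "s \<le> min \<Sigma> s0" "F s = 0" by blast
  have "s \<noteq> min \<Sigma> s0" using s(3) Fneg by auto
  then have s\<Sigma>: "s < \<Sigma>" using s(2) by auto
  obtain e :: "real^'n" where e: "norm e = 1" using vector_choose_size[of 1] by auto
  let ?f = "\<lambda>q::real \<times> (real^'n). y s (fst q) * zonal e (snd q)"
  have ang: "angular (zonal e) (zonal_gradient e) (\<lambda>x. - ?\<mu> / (norm x)\<^sup>2 * zonal e x)"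
  proof -
    have "real CARD('n) - 1 = ?\<mu>" using n by simp
    then show ?thesis using angular_zonal[of e] by metis
  qed
  have "?f \<in> steklov_eigenspace L h s"
  proof (rule steklov_eigenfunction[OF n ab(1) L ab(2) _ ab(5) ysol ang Ck_on_zonal])
    show "zonal e (x /\<^sub>R norm x) = zonal e x" for x by (cases "x = 0") (auto simp: zonal_def divide_inverse)
    show "- z s 0 / h 0 ^ (m + 2) = s * y s 0"
      unfolding H0_def[symmetric] using H(1) by (simp add: z_def y_def c d)
    show "z s L / h L ^ (m + 2) = s * y s L"
      unfolding HL_def[symmetric] using H(2) s(3) by (simp add: F_def field_simps)
  qed (use ab(3) in auto)
  moreover have "?f (0, e) \<noteq> ?f (0, - e)"
    using e by (simp add: y_def c d zonal_def dot_square_norm)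
  ultimately have "steklov_eigenvalue TYPE('n) L h 1 \<le> ereal s"
    using s(1) e by (intro steklov_eigenvalue_1_le[OF n M, of ?f s "(0, e)" "(0, - e)"])
      (auto simp: cyl_boundary_def)
  then show ?thesis using s\<Sigma> by blast
qed

section \<open>Comparison with the shells\<close>

lemma hypersurface_DERIV:
  assumes "hypersurface_of_revolution L h R1 R2" "t \<in> {0..L}"
  shows "(h has_real_derivative deriv h t) (at t)" "\<bar>deriv h t\<bar> \<le> 1"
proof -
  obtain U where "{0..L} \<subseteq> U" "\<And>k. Ck_on k U h"
    using assms(1) by (auto simp: hypersurface_of_revolution_def smooth_near_def)
  then have "Ck_on (Suc 0) U h" "t \<in> U" using assms(2) by auto
  then have "h differentiable (at t)" by simp
  then show "(h has_real_derivative deriv h t) (at t)" by (simp add: DERIV_deriv_iff_real_differentiable)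
  show "\<bar>deriv h t\<bar> \<le> 1" using assms by (auto simp: hypersurface_of_revolution_def)
qed

text \<open>As \<open>|h'| \<le> 1\<close>, the profile lies below the two cones that start at its ends. Being
  differentiable, it stays strictly below the point where these cones meet.\<close>

lemma hypersurface_below_cones:
  assumes M: "hypersurface_of_revolution L h R1 R2"
  shows "t \<in> {0..L} \<Longrightarrow> h t \<le> R1 + t" "t \<in> {0..L} \<Longrightarrow> h t \<le> R2 + L - t"
    and "0 < L1 \<Longrightarrow> L1 < L \<Longrightarrow> R1 + L1 = R2 + L - L1 \<Longrightarrow> h L1 < R1 + L1"
proof -
  have L: "0 < L" "h 0 = R1" "h L = R2" using M by (auto simp: hypersurface_of_revolution_def)
  have D1: "((\<lambda>t. t - h t) has_real_derivative 1 - deriv h t) (at t)" "0 \<le> 1 - deriv h t"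
    and D2: "((\<lambda>t. t + h t) has_real_derivative 1 + deriv h t) (at t)" "0 \<le> 1 + deriv h t"
    if "t \<in> {0..L}" for t
    using hypersurface_DERIV[OF M that] DERIV_diff[OF DERIV_ident, of h "deriv h t" t UNIV]
      DERIV_add[OF DERIV_ident, of h "deriv h t" t UNIV] by auto
  have mono: "F a \<le> F b" if "a \<le> b" "0 \<le> a" "b \<le> L"
    "\<And>t. t \<in> {0..L} \<Longrightarrow> (F has_real_derivative F' t) (at t)" "\<And>t. t \<in> {0..L} \<Longrightarrow> 0 \<le> F' t"
    for F F' :: "real \<Rightarrow> real" and a b
  proof (rule DERIV_nonneg_imp_nondecreasing[of a b F])
    fix u assume "a \<le> u" "u \<le> b"
    then have "u \<in> {0..L}" using that by auto
    then show "\<exists>y. (F has_real_derivative y) (at u) \<and> 0 \<le> y" using that(4,5) by blast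
  qed (use that in auto)
  show "h t \<le> R1 + t" if "t \<in> {0..L}"
    using mono[of 0 t, OF _ _ _ D1] that L by auto
  show "h t \<le> R2 + L - t" if "t \<in> {0..L}"
    using mono[of t L, OF _ _ _ D2] that L by auto
  show "h L1 < R1 + L1" if L1: "0 < L1" "L1 < L" "R1 + L1 = R2 + L - L1"
  proof (cases "deriv h L1 < 1")
    case True
    have "0 - h 0 < L1 - h L1"
      by (rule DERIV_nonneg_pos_imp_less[where F = "\<lambda>t. t - h t" and F' = "\<lambda>t. 1 - deriv h t" and c = L1])
        (use D1 True L1 in auto)
    then show ?thesis using L by simp
  next
    case False
    have "L1 + h L1 < L + h L"
      by (rule DERIV_nonneg_pos_imp_less[where F = "\<lambda>t. t + h t" and F' = "\<lambda>t. 1 + deriv h t" and c = L1])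
        (use D2 False L1 in auto)
    then show ?thesis using L L1 by simp
  qed
qed

text \<open>Here \<open>S L\<close> is the integral of \<open>h\<^sup>1\<^sup>-\<^sup>n\<close>, and \<open>J\<^sub>1\<close>, \<open>J\<^sub>2\<close> are the integrals of \<open>\<rho>\<^sup>1\<^sup>-\<^sup>n\<close> along the cones.\<close>

lemma steklov_less_dirichlet_combination:
  assumes n: "CARD('n::finite) = m + 3" and M: "hypersurface_of_revolution L h R1 R2"
    and L1: "0 < L1" "L1 < L" and B: "B = R1 + L1" "B = R2 + L - L1"
    and J1: "J1 = (1 / R1 ^ (m + 1) - 1 / B ^ (m + 1)) / (real m + 1)"
    and J2: "J2 = (1 / R2 ^ (m + 1) - 1 / B ^ (m + 1)) / (real m + 1)"
  shows "steklov_eigenvalue TYPE('n) L h 1 < ereal ((1 / R1 ^ (m + 2) + 1 / R2 ^ (m + 2)) / (J1 + J2))"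
proof -
  have L: "0 < L" "0 < h 0" "0 < h L" "h 0 = R1" "h L = R2" and hpos: "\<And>t. t \<in> {0..L} \<Longrightarrow> 0 < h t"
    using M by (auto simp: hypersurface_of_revolution_def)
  then have R: "0 < R1" "0 < R2" by auto
  have Bpos: "R1 < B" "R2 < B" using B L1 by auto
  obtain S where S: "S 0 = 0"
    "\<And>t. t \<in> {0..L} \<Longrightarrow> (S has_real_derivative 1 / h t ^ (m + 2)) (at t)"
    "0 < S L \<Longrightarrow> steklov_eigenvalue TYPE('n) L h 1 \<le> ereal ((1 / R1 ^ (m + 2) + 1 / R2 ^ (m + 2)) / S L)"
    using steklov_eigenvalue_le_radial[OF n M] by blast
  \<comment> \<open>an antiderivative of \<open>\<rho>\<^sup>-\<^sup>(\<^sup>m\<^sup>+\<^sup>2\<^sup>)\<close>, composed with the two cones\<close>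
  define P where "P \<rho> = (- 1 / (real m + 1)) / \<rho> ^ (m + 1)" for \<rho> :: real
  have P: "(P has_real_derivative 1 / \<rho> ^ (m + 2)) (at \<rho>)" if "0 < \<rho>" for \<rho>
  proof -
    have e: "- (real (m + 1) * (- 1 / (real m + 1))) = 1" by (simp add: field_simps)
    from DERIV_inverse_power[of \<rho> "- 1 / (real m + 1)" "m + 1", unfolded e] that
    show ?thesis by (simp add: P_def[abs_def])
  qed
  have inv_le: "1 / \<rho> ^ (m + 2) \<le> 1 / h t ^ (m + 2)" if "t \<in> {0..L}" "h t \<le> \<rho>" for t \<rho>
    using hpos[OF that(1)] that(2) by (intro frac_le zero_less_power power_mono) auto
  have "S 0 - P (R1 + 0) < S L1 - P (R1 + L1)"
  proof (rule DERIV_nonneg_pos_imp_less[where F = "\<lambda>t. S t - P (R1 + t)"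
        and F' = "\<lambda>t. 1 / h t ^ (m + 2) - 1 / (R1 + t) ^ (m + 2)" and c = L1])
    fix t assume "t \<in> {0..L1}"
    then have t: "t \<in> {0..L}" "0 < R1 + t" using L1 R by auto
    have "((\<lambda>t. P (R1 + t)) has_real_derivative 1 / (R1 + t) ^ (m + 2) * 1) (at t)"
      by (rule DERIV_chain2[where f = P and g = "\<lambda>t. R1 + t", OF P[OF t(2)]]) (auto intro!: derivative_eq_intros)
    from DERIV_diff[OF S(2)[OF t(1)] this]
    show "((\<lambda>t. S t - P (R1 + t)) has_real_derivative 1 / h t ^ (m + 2) - 1 / (R1 + t) ^ (m + 2)) (at t)"
      by simp
    show "0 \<le> 1 / h t ^ (m + 2) - 1 / (R1 + t) ^ (m + 2)"
      using inv_le[OF t(1) hypersurface_below_cones(1)[OF M t(1)]] by simp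
  next
    have "h L1 ^ (m + 2) < (R1 + L1) ^ (m + 2)"
      using hypersurface_below_cones(3)[OF M L1] B hpos[of L1] L1 by (intro power_strict_mono) auto
    then show "0 < 1 / h L1 ^ (m + 2) - 1 / (R1 + L1) ^ (m + 2)"
      using hpos[of L1] L1 by (simp add: frac_less2 del: power_Suc add_2_eq_Suc')
  qed (use L1 in auto)
  moreover have "S L1 + P (R2 + L - L1) \<le> S L + P (R2 + L - L)"
  proof (rule DERIV_nonneg_imp_nondecreasing[of L1 L "\<lambda>t. S t + P (R2 + L - t)"])
    fix t assume "L1 \<le> t" "t \<le> L"
    then have t: "t \<in> {0..L}" "0 < R2 + L - t" using L1 R by auto
    have "((\<lambda>t. P (R2 + L - t)) has_real_derivative 1 / (R2 + L - t) ^ (m + 2) * (- 1)) (at t)"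
      by (rule DERIV_chain2[where f = P and g = "\<lambda>t. R2 + L - t", OF P[OF t(2)]]) (auto intro!: derivative_eq_intros)
    from DERIV_add[OF S(2)[OF t(1)] this]
    have "((\<lambda>t. S t + P (R2 + L - t)) has_real_derivative 1 / h t ^ (m + 2) - 1 / (R2 + L - t) ^ (m + 2)) (at t)"
      by simp
    moreover have "0 \<le> 1 / h t ^ (m + 2) - 1 / (R2 + L - t) ^ (m + 2)"
      using inv_le[OF t(1) hypersurface_below_cones(2)[OF M t(1)]] by simp
    ultimately show "\<exists>y. ((\<lambda>t. S t + P (R2 + L - t)) has_real_derivative y) (at t) \<and> 0 \<le> y" by blast
  qed (use L1 in auto)
  moreover have "P (R1 + L1) - P (R1 + 0) = J1" "P (R2 + L - L1) - P (R2 + L - L) = J2"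
    unfolding B(1)[symmetric] B(2)[symmetric] by (simp_all add: P_def J1 J2 diff_divide_distrib mult.commute)
  ultimately have SL: "J1 + J2 < S L" using S(1) by simp
  have J: "0 < J1" "0 < J2"
    using R Bpos by (auto simp: J1 J2 simp del: power_Suc add_2_eq_Suc' intro!: frac_less2 power_strict_mono divide_pos_pos)
  have "steklov_eigenvalue TYPE('n) L h 1 \<le> ereal ((1 / R1 ^ (m + 2) + 1 / R2 ^ (m + 2)) / S L)"
    using S(3) SL J by simp
  also have "\<dots> < ereal ((1 / R1 ^ (m + 2) + 1 / R2 ^ (m + 2)) / (J1 + J2))"
    unfolding less_ereal.simps using SL J R
    by (intro divide_strict_left_mono add_pos_pos mult_pos_pos) auto
  finally show ?thesis .
qed

text \<open>The integrand of the comparison: \<open>w' U\<^sup>2 + 2 w U U'\<close>, with the Riccati equation for \<open>w\<close>, minus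
  the energy density of \<open>U\<close> on the shell. Completing the square in \<open>D\<close> shows its sign.\<close>

lemma riccati_density:
  fixes H P G Q w U D \<mu> :: real
  assumes "0 < H" "H \<le> P" "G \<le> Q" "0 \<le> \<mu>"
  shows "(\<mu> * G - w\<^sup>2 / H) * U\<^sup>2 + 2 * w * U * D - (P * D\<^sup>2 + \<mu> * Q * U\<^sup>2) \<le> 0"
    and "H < P \<and> D \<noteq> 0 \<or> D = 0 \<and> w \<noteq> 0 \<and> U \<noteq> 0 \<Longrightarrow>
      (\<mu> * G - w\<^sup>2 / H) * U\<^sup>2 + 2 * w * U * D - (P * D\<^sup>2 + \<mu> * Q * U\<^sup>2) < 0"
proof -
  have eq: "(\<mu> * G - w\<^sup>2 / H) * U\<^sup>2 + 2 * w * U * D - (P * D\<^sup>2 + \<mu> * Q * U\<^sup>2)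
      = - (\<mu> * (Q - G) * U\<^sup>2) - (P - H) * D\<^sup>2 - (H * D - w * U)\<^sup>2 / H"
    using assms(1) by (simp add: power2_eq_square field_simps)
  have nn: "0 \<le> \<mu> * (Q - G) * U\<^sup>2" "0 \<le> (P - H) * D\<^sup>2" "0 \<le> (H * D - w * U)\<^sup>2 / H"
    using assms by (auto intro!: mult_nonneg_nonneg divide_nonneg_pos)
  show "(\<mu> * G - w\<^sup>2 / H) * U\<^sup>2 + 2 * w * U * D - (P * D\<^sup>2 + \<mu> * Q * U\<^sup>2) \<le> 0"
    unfolding eq using nn by linarith
  assume "H < P \<and> D \<noteq> 0 \<or> D = 0 \<and> w \<noteq> 0 \<and> U \<noteq> 0"
  then have "0 < (P - H) * D\<^sup>2 \<or> 0 < (H * D - w * U)\<^sup>2 / H" using assms(1) by auto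
  then show "(\<mu> * G - w\<^sup>2 / H) * U\<^sup>2 + 2 * w * U * D - (P * D\<^sup>2 + \<mu> * Q * U\<^sup>2) < 0"
    unfolding eq using nn by linarith
qed

text \<open>The flux \<open>\<rho>\<^sup>n\<^sup>-\<^sup>1 a a'\<close> of the profile \<open>a\<close>; its derivative is the energy density on the shell.\<close>

definition neumann_flux :: "nat \<Rightarrow> real \<Rightarrow> real \<Rightarrow> real"
where "neumann_flux m B \<rho> = neumann_profile (m + 3) B \<rho> * (\<rho> ^ (m + 2) - B ^ (m + 3) / \<rho> ^ 1)"

lemma DERIV_neumann_flux:
  assumes "0 < \<rho>"
  shows "(neumann_flux m B has_real_derivative \<rho> ^ (m + 2) * (1 - B ^ (m + 3) / \<rho> ^ (m + 3))\<^sup>2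
    + (real m + 2) * \<rho> ^ m * (neumann_profile (m + 3) B \<rho>)\<^sup>2) (at \<rho>)"
proof -
  let ?a = "neumann_profile (m + 3) B" and ?c = "B ^ (m + 3)"
  have "((\<lambda>\<rho>. \<rho> ^ Suc (m + 1)) has_real_derivative real (Suc (m + 1)) * \<rho> ^ (m + 1)) (at \<rho>)"
    using DERIV_power[OF DERIV_ident, of "Suc (m + 1)" \<rho> UNIV] by simp
  then have "((\<lambda>\<rho>. \<rho> ^ (m + 2)) has_real_derivative (real m + 2) * \<rho> ^ (m + 1)) (at \<rho>)"
    by (simp add: add.commute)
  from DERIV_diff[OF this DERIV_inverse_power[of \<rho> ?c 1]] assms
  have "((\<lambda>\<rho>. \<rho> ^ (m + 2) - ?c / \<rho> ^ 1) has_real_derivative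
      (real m + 2) * \<rho> ^ (m + 1) - - (real 1 * ?c) / \<rho> ^ Suc 1) (at \<rho>)" by blast
  from DERIV_mult[OF DERIV_neumann_profile[of "m + 3" \<rho> B] this] assms
  have D: "(neumann_flux m B has_real_derivative (1 - ?c / \<rho> ^ (m + 3)) * (\<rho> ^ (m + 2) - ?c / \<rho> ^ 1)
      + ((real m + 2) * \<rho> ^ (m + 1) - - (real 1 * ?c) / \<rho> ^ Suc 1) * ?a \<rho>) (at \<rho>)"
    unfolding neumann_flux_def[abs_def] by simp
  define q where "q = ?c / \<rho> ^ (m + 3)"
  have c: "?c = q * \<rho> ^ m * \<rho> * \<rho> * \<rho>" using assms by (simp add: q_def power_add power3_eq_cube field_simps)
  have "?a \<rho> = \<rho> + ?c / (real m + 2) / \<rho> ^ (m + 2)" by (simp add: neumann_profile_def)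
  then have a: "?a \<rho> = \<rho> + q * \<rho> / (real m + 2)"
  proof -
    have "?c = \<rho> ^ (m + 2) * (q * \<rho>)" unfolding c by (simp add: power_add power2_eq_square)
    moreover have "\<rho> ^ (m + 2) \<noteq> 0" using assms by simp
    ultimately show ?thesis unfolding \<open>?a \<rho> = _\<close> by (simp del: power_Suc add_2_eq_Suc')
  qed
  define v where "v = q / (real m + 2)"
  have q: "q = (real m + 2) * v" by (simp add: v_def)
  have a': "?a \<rho> = \<rho> * (1 + v)" unfolding a by (simp add: v_def algebra_simps)
  have c1: "?c / \<rho> ^ 1 = q * \<rho> ^ m * \<rho> * \<rho>" and c2: "(real 1 * ?c) / \<rho> ^ Suc 1 = q * \<rho> ^ m * \<rho>"
    unfolding c using assms by simp_all
  have "(1 - q) * (\<rho> ^ (m + 2) - ?c / \<rho> ^ 1)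
      + ((real m + 2) * \<rho> ^ (m + 1) - - (real 1 * ?c) / \<rho> ^ Suc 1) * ?a \<rho>
    = \<rho> ^ (m + 2) * (1 - q)\<^sup>2 + (real m + 2) * \<rho> ^ m * (?a \<rho>)\<^sup>2"
    unfolding a' c1 minus_divide_left[symmetric] c2 unfolding q
    by (simp add: power_add power2_eq_square algebra_simps)
  with D show ?thesis unfolding q_def[symmetric] by simp
qed

text \<open>One half of the comparison; \<open>\<epsilon> = 1\<close> and \<open>\<epsilon> = -1\<close> are the cones at the two ends. With \<open>w = z / y\<close>
  and \<open>U = a(k + \<epsilon> t)\<close>, the derivative of \<open>w U\<^sup>2\<close> is the energy density of \<open>U\<close> on \<open>M\<close> minus a square,
  and the derivative of \<open>\<epsilon>\<close> times the flux is the energy density on the shell, which is at least as large. The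
  inequality is strict if at some point either \<open>h\<close> is below the cone and \<open>U' \<noteq> 0\<close>, or \<open>U' = 0 \<noteq> w\<close>, so
  that the square does not vanish; \<open>U' = 0\<close> holds exactly at the radius \<open>B\<close>.\<close>

lemma riccati_comparison:
  fixes \<epsilon> k :: real
  assumes ts: "t0 \<le> t1" and \<epsilon>: "\<epsilon> = 1 \<or> \<epsilon> = -1"
    and sol: "radial_solution h m (real m + 2) {t0..t1} y z"
    and y: "\<And>t. t \<in> {t0..t1} \<Longrightarrow> 0 < y t"
    and h: "\<And>t. t \<in> {t0..t1} \<Longrightarrow> 0 < h t" "\<And>t. t \<in> {t0..t1} \<Longrightarrow> h t \<le> k + \<epsilon> * t"
    and B: "0 < B"
  defines "\<Phi> \<equiv> \<lambda>t. z t / y t * (neumann_profile (m + 3) B (k + \<epsilon> * t))\<^sup>2 - \<epsilon> * neumann_flux m B (k + \<epsilon> * t)"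
  shows "\<Phi> t1 \<le> \<Phi> t0"
    and "t0 < t1 \<Longrightarrow> s \<in> {t0..t1} \<Longrightarrow> h s < k + \<epsilon> * s \<and> k + \<epsilon> * s \<noteq> B \<or> k + \<epsilon> * s = B \<and> z s \<noteq> 0
      \<Longrightarrow> \<Phi> t1 < \<Phi> t0"
proof -
  let ?a = "neumann_profile (m + 3) B"
  define \<rho> where "\<rho> t = k + \<epsilon> * t" for t
  define w where "w t = z t / y t" for t
  define D where "D t = \<epsilon> * (1 - B ^ (m + 3) / \<rho> t ^ (m + 3))" for t
  define \<Phi>' where "\<Phi>' t = ((real m + 2) * h t ^ m - (w t)\<^sup>2 / h t ^ (m + 2)) * (?a (\<rho> t))\<^sup>2
    + 2 * w t * ?a (\<rho> t) * D t - (\<rho> t ^ (m + 2) * (D t)\<^sup>2 + (real m + 2) * \<rho> t ^ m * (?a (\<rho> t))\<^sup>2)" for t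
  have \<rho>pos: "0 < \<rho> t" if "t \<in> {t0..t1}" for t using h[OF that] by (simp add: \<rho>_def)
  have \<epsilon>2: "\<epsilon> * \<epsilon> = 1" using \<epsilon> by auto
  have D\<Phi>: "(\<Phi> has_real_derivative \<Phi>' t) (at t)" if t: "t \<in> {t0..t1}" for t
  proof -
    have Dy: "(y has_real_derivative z t / h t ^ (m + 2)) (at t)"
      and Dz: "(z has_real_derivative (real m + 2) * h t ^ m * y t) (at t)"
      using sol t unfolding radial_solution_def by blast+
    have yt: "y t \<noteq> 0" "h t ^ (m + 2) \<noteq> 0" using y[OF t] h(1)[OF t] by auto
    have "((\<lambda>t. z t / y t) has_real_derivative
        ((real m + 2) * h t ^ m * y t * y t - z t * (z t / h t ^ (m + 2))) / (y t * y t)) (at t)"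
      by (rule DERIV_divide[OF Dz Dy yt(1)])
    also have "((real m + 2) * h t ^ m * y t * y t - z t * (z t / h t ^ (m + 2))) / (y t * y t)
        = (real m + 2) * h t ^ m - (w t)\<^sup>2 / h t ^ (m + 2)"
      using yt(1) by (simp add: w_def diff_divide_distrib power2_eq_square)
    finally have Dw: "(w has_real_derivative (real m + 2) * h t ^ m - (w t)\<^sup>2 / h t ^ (m + 2)) (at t)"
      by (simp add: w_def[abs_def])
    have D\<rho>: "(\<rho> has_real_derivative \<epsilon>) (at t)"
      unfolding \<rho>_def by (auto intro!: derivative_eq_intros)
    have "((\<lambda>t. ?a (\<rho> t)) has_real_derivative (1 - B ^ (m + 3) / \<rho> t ^ (m + 3)) * \<epsilon>) (at t)"
      by (rule DERIV_chain2[where f = ?a and g = \<rho>, OF DERIV_neumann_profile D\<rho>]) (use \<rho>pos[OF t] in auto)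
    then have Da: "((\<lambda>t. ?a (\<rho> t)) has_real_derivative D t) (at t)" by (simp add: D_def mult.commute)
    note Df = DERIV_chain2[where f = "neumann_flux m B" and g = \<rho>, OF DERIV_neumann_flux[OF \<rho>pos[OF t]] D\<rho>]
    have sq: "(1 - B ^ (m + 3) / \<rho> t ^ (m + 3))\<^sup>2 = (D t)\<^sup>2"
      using \<epsilon> by (auto simp: D_def power2_eq_square)
    have \<epsilon>X: "\<epsilon> * (X * \<epsilon>) = X" for X using \<epsilon>2 by (metis mult.assoc mult.commute mult_1_right)
    have "((\<lambda>t. w t * (?a (\<rho> t) * ?a (\<rho> t)) - \<epsilon> * neumann_flux m B (\<rho> t)) has_real_derivative
        ((real m + 2) * h t ^ m - (w t)\<^sup>2 / h t ^ (m + 2)) * (?a (\<rho> t) * ?a (\<rho> t))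
        + (D t * ?a (\<rho> t) + D t * ?a (\<rho> t)) * w t
        - \<epsilon> * ((\<rho> t ^ (m + 2) * (1 - B ^ (m + 3) / \<rho> t ^ (m + 3))\<^sup>2
            + (real m + 2) * \<rho> t ^ m * (?a (\<rho> t))\<^sup>2) * \<epsilon>)) (at t)"
      by (rule DERIV_diff[OF DERIV_mult[OF Dw DERIV_mult[OF Da Da]] DERIV_cmult[OF Df]])
    moreover have "\<Phi> = (\<lambda>t. w t * (?a (\<rho> t) * ?a (\<rho> t)) - \<epsilon> * neumann_flux m B (\<rho> t))"
      by (simp add: \<Phi>_def w_def \<rho>_def power2_eq_square fun_eq_iff)
    moreover have "((real m + 2) * h t ^ m - (w t)\<^sup>2 / h t ^ (m + 2)) * (?a (\<rho> t) * ?a (\<rho> t))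
        + (D t * ?a (\<rho> t) + D t * ?a (\<rho> t)) * w t
        - \<epsilon> * ((\<rho> t ^ (m + 2) * (1 - B ^ (m + 3) / \<rho> t ^ (m + 3))\<^sup>2
            + (real m + 2) * \<rho> t ^ m * (?a (\<rho> t))\<^sup>2) * \<epsilon>) = \<Phi>' t"
      unfolding sq \<epsilon>X \<Phi>'_def by (simp add: power2_eq_square algebra_simps)
    ultimately show ?thesis by (simp only:)
  qed
  have pre: "0 < h t ^ (m + 2)" "h t ^ (m + 2) \<le> \<rho> t ^ (m + 2)" "h t ^ m \<le> \<rho> t ^ m" "(0::real) \<le> real m + 2"
    if t: "t \<in> {t0..t1}" for t
    using h(1)[OF t] h(2)[OF t]
    by (auto simp: \<rho>_def simp del: power_Suc add_2_eq_Suc' intro!: power_mono zero_less_power)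
  have nonpos: "\<Phi>' t \<le> 0" if t: "t \<in> {t0..t1}" for t
    unfolding \<Phi>'_def by (rule riccati_density(1)[OF pre[OF t]])
  have "- \<Phi> t0 \<le> - \<Phi> t1"
  proof (rule DERIV_nonneg_imp_nondecreasing[OF ts, of "\<lambda>t. - \<Phi> t"])
    fix t assume "t0 \<le> t" "t \<le> t1"
    then have t: "t \<in> {t0..t1}" by simp
    show "\<exists>y. ((\<lambda>t. - \<Phi> t) has_real_derivative y) (at t) \<and> 0 \<le> y"
      using DERIV_minus[OF D\<Phi>[OF t]] nonpos[OF t] by (intro exI[of _ "- \<Phi>' t"]) auto
  qed
  then show "\<Phi> t1 \<le> \<Phi> t0" by simp
  assume lt: "t0 < t1" and s: "s \<in> {t0..t1}"
    and str: "h s < k + \<epsilon> * s \<and> k + \<epsilon> * s \<noteq> B \<or> k + \<epsilon> * s = B \<and> z s \<noteq> 0"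
  have Diff: "D s = 0 \<longleftrightarrow> \<rho> s = B"
  proof -
    have "D s = 0 \<longleftrightarrow> B ^ (m + 3) = \<rho> s ^ (m + 3)" using \<epsilon> \<rho>pos[OF s] by (auto simp: D_def field_simps)
    also have "\<dots> \<longleftrightarrow> B = \<rho> s" using \<rho>pos[OF s] B by (intro power_eq_iff_eq_base) auto
    finally show ?thesis by auto
  qed
  have "\<Phi>' s < 0"
    unfolding \<Phi>'_def
  proof (rule riccati_density(2)[OF pre[OF s]])
    have "?a (\<rho> s) \<noteq> 0" using neumann_profile_pos[of "m + 3" "\<rho> s" B] \<rho>pos[OF s] B by simp
    moreover have "w s \<noteq> 0" if "z s \<noteq> 0" using that y[OF s] by (simp add: w_def)
    moreover have "h s ^ (m + 2) < \<rho> s ^ (m + 2)" if "h s < \<rho> s"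
      using that h(1)[OF s] by (intro power_strict_mono) auto
    ultimately show "h s ^ (m + 2) < \<rho> s ^ (m + 2) \<and> D s \<noteq> 0 \<or> D s = 0 \<and> w s \<noteq> 0 \<and> ?a (\<rho> s) \<noteq> 0"
      using str unfolding Diff \<rho>_def[symmetric] by blast
  qed
  have "- \<Phi> t0 < - \<Phi> t1"
    by (rule DERIV_nonneg_pos_imp_less[OF lt, where F = "\<lambda>t. - \<Phi> t" and F' = "\<lambda>t. - \<Phi>' t" and c = s])
      (use DERIV_minus[OF D\<Phi>] nonpos s \<open>\<Phi>' s < 0\<close> in auto)
  then show "\<Phi> t1 < \<Phi> t0" by simp
qed

text \<open>The boundary terms of the comparison: the right-hand side is \<open>- \<sigma> Q\<close> for the shell with radii \<open>R\<close>
  and \<open>B\<close>.\<close>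

lemma neumann_flux_eq:
  assumes "0 < R" "0 < B"
  shows "neumann_flux m B R = - (neumann_value (m + 3) R B * (R ^ (m + 2) * (neumann_profile (m + 3) B R)\<^sup>2))"
proof -
  let ?a = "neumann_profile (m + 3) B R"
  have a: "?a \<noteq> 0" using neumann_profile_pos[of "m + 3" R B] assms by simp
  have "R ^ (m + 2) - B ^ (m + 3) / R ^ 1 = - (R ^ (m + 2) * (B ^ (m + 3) / R ^ (m + 3) - 1))"
    using assms by (simp add: power_add power2_eq_square power3_eq_cube field_simps)
  then show ?thesis using a by (simp add: neumann_flux_def neumann_value_def power2_eq_square del: power_Suc add_2_eq_Suc')
qed

text \<open>For the bound \<open>\<Sigma>\<close> and \<open>w = z / y\<close>, the comparison along the two cones gives \<open>w L \<le> \<Sigma> h\<^sup>n\<^sup>-\<^sup>1(L)\<close> for the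
  solution that starts with \<open>w 0 = - \<Sigma> h\<^sup>n\<^sup>-\<^sup>1(0)\<close>. It is strict by the kink of the cones, unless one
  of the shells is degenerate. In that case \<open>B\<close> is attained at an end of the interval, where
  \<open>w \<noteq> 0 = U'\<close>.\<close>

lemma steklov_less_neumann_combination:
  assumes n: "CARD('n::finite) = m + 3" and M: "hypersurface_of_revolution L h R1 R2"
    and L1: "0 \<le> L1" "L1 \<le> L" and B: "B = R1 + L1" "B = R2 + L - L1"
    and Q1: "Q1 = R1 ^ (m + 2) * (neumann_profile (m + 3) B R1)\<^sup>2"
    and Q2: "Q2 = R2 ^ (m + 2) * (neumann_profile (m + 3) B R2)\<^sup>2"
  shows "steklov_eigenvalue TYPE('n) L h 1 <
    ereal ((Q1 * neumann_value (m + 3) R1 B + Q2 * neumann_value (m + 3) R2 B) / (Q1 + Q2))"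
proof -
  let ?a = "neumann_profile (m + 3) B"
  define \<sigma>1 where "\<sigma>1 = neumann_value (m + 3) R1 B"
  define \<sigma>2 where "\<sigma>2 = neumann_value (m + 3) R2 B"
  define \<Sigma> where "\<Sigma> = (Q1 * \<sigma>1 + Q2 * \<sigma>2) / (Q1 + Q2)"
  have L: "0 < L" "h 0 = R1" "h L = R2" and hpos: "\<And>t. t \<in> {0..L} \<Longrightarrow> 0 < h t"
    using M by (auto simp: hypersurface_of_revolution_def)
  have R: "0 < R1" "0 < R2" using hpos[of 0] hpos[of L] L by auto
  have Bpos: "0 < B" "R1 \<le> B" "R2 \<le> B" "R1 < B \<or> R2 < B" using B L1 L(1) R by auto
  have a: "0 < ?a R1" "0 < ?a R2" "0 < ?a B" using R Bpos by (auto intro!: neumann_profile_pos)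
  have Q: "0 < Q1" "0 < Q2" using R a by (auto simp: Q1 Q2 simp del: power_Suc add_2_eq_Suc')
  have val_nonneg: "0 \<le> neumann_value (m + 3) R B" if "0 < R" "R \<le> B" for R
  proof -
    have "R ^ (m + 3) \<le> B ^ (m + 3)" using that by (intro power_mono) auto
    then have "1 \<le> B ^ (m + 3) / R ^ (m + 3)" using that by (simp add: le_divide_eq)
    moreover have "0 < ?a R" using that by (intro neumann_profile_pos) auto
    ultimately show ?thesis by (simp add: neumann_value_def)
  qed
  have val_pos: "0 < neumann_value (m + 3) R B" if "0 < R" "R < B" for R
  proof -
    have "R ^ (m + 3) < B ^ (m + 3)" using that by (intro power_strict_mono) auto
    then have "1 < B ^ (m + 3) / R ^ (m + 3)" using that by (simp add: less_divide_eq)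
    moreover have "0 < ?a R" using that by (intro neumann_profile_pos) auto
    ultimately show ?thesis by (simp add: neumann_value_def)
  qed
  have "0 \<le> \<sigma>1" "0 \<le> \<sigma>2" "0 < \<sigma>1 \<or> 0 < \<sigma>2"
    using val_nonneg[of R1] val_nonneg[of R2] val_pos[of R1] val_pos[of R2] R Bpos
    by (auto simp: \<sigma>1_def \<sigma>2_def)
  then have "0 < Q1 * \<sigma>1 + Q2 * \<sigma>2"
    using Q by (auto intro: add_pos_nonneg add_nonneg_pos)
  then have \<Sigma>: "0 < \<Sigma>" using Q by (simp add: \<Sigma>_def)
  have \<Sigma>Q: "\<Sigma> * Q1 + \<Sigma> * Q2 = Q1 * \<sigma>1 + Q2 * \<sigma>2"
  proof -
    have "\<Sigma> * (Q1 + Q2) = Q1 * \<sigma>1 + Q2 * \<sigma>2" using Q by (simp add: \<Sigma>_def)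
    then show ?thesis by (simp add: distrib_left)
  qed
  have flux: "neumann_flux m B R1 = - (\<sigma>1 * Q1)" "neumann_flux m B R2 = - (\<sigma>2 * Q2)"
    unfolding \<sigma>1_def \<sigma>2_def Q1 Q2
    by (rule neumann_flux_eq[OF R(1) Bpos(1)], rule neumann_flux_eq[OF R(2) Bpos(1)])
  have fluxB: "neumann_flux m B B = 0"
  proof -
    have "B ^ (m + 3) / B ^ 1 = B ^ (m + 2)" using Bpos by (simp add: power_add power2_eq_square power3_eq_cube)
    then show ?thesis unfolding neumann_flux_def by simp
  qed
  have crit: "z L < \<Sigma> * h L ^ (m + 2) * y L"
    if y: "\<And>t. t \<in> {0..L} \<Longrightarrow> 0 < y t" and sol: "radial_solution h m (real m + 2) {0..L} y z"
      and z0: "z 0 = - \<Sigma> * h 0 ^ (m + 2) * y 0" for y z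
  proof (rule ccontr)
    assume "\<not> ?thesis"
    then have zL: "\<Sigma> * R2 ^ (m + 2) * y L \<le> z L" using L by simp
    have yp: "0 < y 0" "0 < y L" using y[of 0] y[of L] L by auto
    define \<Phi>1 where "\<Phi>1 t = z t / y t * (?a (R1 + 1 * t))\<^sup>2 - 1 * neumann_flux m B (R1 + 1 * t)" for t
    define \<Phi>2 where "\<Phi>2 t = z t / y t * (?a (R2 + L + (- 1) * t))\<^sup>2
      - (- 1) * neumann_flux m B (R2 + L + (- 1) * t)" for t
    have sub: "{0..L1} \<subseteq> {0..L}" "{L1..L} \<subseteq> {0..L}" using L1 by auto
    have sols: "radial_solution h m (real m + 2) {0..L1} y z" "radial_solution h m (real m + 2) {L1..L} y z"
      using sol sub unfolding radial_solution_def by blast+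
    have h1: "h t \<le> R1 + 1 * t" "0 < h t" "0 < y t" if "t \<in> {0..L1}" for t
      using hypersurface_below_cones(1)[OF M, of t] hpos[of t] y[of t] that sub by auto
    have h2: "h t \<le> R2 + L + (- 1) * t" "0 < h t" "0 < y t" if "t \<in> {L1..L}" for t
      using hypersurface_below_cones(2)[OF M, of t] hpos[of t] y[of t] that sub by auto
    have le1: "\<Phi>1 L1 \<le> \<Phi>1 0"
      unfolding \<Phi>1_def by (rule riccati_comparison(1)[OF L1(1) _ sols(1) h1(3) h1(2) h1(1) Bpos(1)]) auto
    have le2: "\<Phi>2 L \<le> \<Phi>2 L1"
      unfolding \<Phi>2_def by (rule riccati_comparison(1)[OF L1(2) _ sols(2) h2(3) h2(2) h2(1) Bpos(1)]) auto
    have mid: "\<Phi>1 L1 = \<Phi>2 L1"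
      using fluxB by (simp add: \<Phi>1_def \<Phi>2_def B(1)[symmetric] B(2)[symmetric])
    have z0': "z 0 / y 0 = - \<Sigma> * R1 ^ (m + 2)" using z0 yp L by simp
    have start: "\<Phi>1 0 = - (\<Sigma> * Q1) + \<sigma>1 * Q1"
      unfolding \<Phi>1_def z0' by (simp add: flux Q1 mult.assoc del: power_Suc add_2_eq_Suc')
    have "\<Sigma> * R2 ^ (m + 2) \<le> z L / y L" using zL yp by (simp add: pos_le_divide_eq)
    then have "\<Sigma> * R2 ^ (m + 2) * (?a R2)\<^sup>2 \<le> z L / y L * (?a R2)\<^sup>2" by (rule mult_right_mono) simp
    then have final: "\<Sigma> * Q2 - \<sigma>2 * Q2 \<le> \<Phi>2 L"
      by (simp add: \<Phi>2_def flux Q2 mult.assoc del: power_Suc add_2_eq_Suc')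
    have eq: "- (\<Sigma> * Q1) + \<sigma>1 * Q1 = \<Sigma> * Q2 - \<sigma>2 * Q2" using \<Sigma>Q by (simp add: algebra_simps)
    have "\<Phi>1 L1 < \<Phi>1 0 \<or> \<Phi>2 L < \<Phi>2 L1"
    proof -
      consider "L1 = 0" | "L1 = L" | "0 < L1" "L1 < L" using L1 by linarith
      then show ?thesis
      proof cases
        case 1
        have "z 0 \<noteq> 0" using z0 \<Sigma> yp R L by simp
        then have "\<Phi>2 L < \<Phi>2 L1"
          unfolding \<Phi>2_def using 1 L(1) B
          by (intro riccati_comparison(2)[OF L1(2) _ sols(2) h2(3) h2(2) h2(1) Bpos(1), where s = 0]) auto
        then show ?thesis ..
      next
        case 2
        have "0 < \<Sigma> * R2 ^ (m + 2) * y L" using \<Sigma> R yp by (intro mult_pos_pos zero_less_power)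
        then have "z L \<noteq> 0" using zL by simp
        then have "\<Phi>1 L1 < \<Phi>1 0"
          unfolding \<Phi>1_def using 2 L(1) B
          by (intro riccati_comparison(2)[OF L1(1) _ sols(1) h1(3) h1(2) h1(1) Bpos(1), where s = L]) auto
        then show ?thesis ..
      next
        case 3
        have "h L1 < R1 + L1" using hypersurface_below_cones(3)[OF M 3] B by simp
        then have pos: "0 < R1 + L1 - h L1" by simp
        have "isCont (\<lambda>t. R1 + t - h t) L1"
          using hypersurface_DERIV(1)[OF M, of L1] 3 by (intro continuous_intros DERIV_isCont) auto
        then have "\<forall>\<^sub>F t in at L1. 0 < R1 + t - h t"
          using order_tendstoD(1)[OF _ pos] unfolding isCont_def by blast
        then obtain d where d: "0 < d" "\<And>t. t \<noteq> L1 \<Longrightarrow> dist t L1 < d \<Longrightarrow> 0 < R1 + t - h t"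
          unfolding eventually_at by blast
        \<comment> \<open>\<open>h\<close> is below the cone at \<open>L1\<close>, but \<open>U'\<close> vanishes there; a point slightly before \<open>L1\<close> has both properties\<close>
        define s where "s = L1 - min d L1 / 2"
        have s: "0 \<le> s" "s < L1" "L1 - s < d" using d(1) 3(1) by (auto simp: s_def min_def)
        then have "h s < R1 + s" using d(2)[of s] by (simp add: dist_real_def)
        then have "\<Phi>1 L1 < \<Phi>1 0"
          unfolding \<Phi>1_def using 3 s B
          by (intro riccati_comparison(2)[OF L1(1) _ sols(1) h1(3) h1(2) h1(1) Bpos(1), where s = s]) auto
        then show ?thesis ..
      qed
    qed
    then show False using le1 le2 mid start final eq by linarith
  qed
  obtain s where "s < \<Sigma>" "steklov_eigenvalue TYPE('n) L h 1 \<le> ereal s"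
    using steklov_eigenvalue_less_zonal[OF n M \<Sigma>] crit by blast
  then have "steklov_eigenvalue TYPE('n) L h 1 < ereal \<Sigma>" by (meson ereal_less(2) le_less_trans less_ereal.simps(1))
  then show ?thesis by (simp add: \<Sigma>_def \<sigma>1_def \<sigma>2_def)
qed

theorem theorem2:
  fixes n :: nat and h :: "real \<Rightarrow> real" and L R1 R2 L1 Q1 Q2 \<alpha> \<beta> :: real
  assumes n: "n = CARD('n::finite)" "n \<ge> 3"
    and M: "hypersurface_of_revolution L h R1 R2"
    and L1: "L1 = (- R1 + R2 + L) / 2"
    and Q1: "Q1 = R1 ^ (n - 1) *
          (R1 + 1 / ((real n - 1) * 2 ^ n) * (R1 + R2 + L) ^ n * R1 powi (1 - int n))\<^sup>2"
    and Q2: "Q2 = R2 ^ (n - 1) *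
          (R2 + 1 / ((real n - 1) * 2 ^ n) * (R1 + R2 + L) ^ n * R2 powi (1 - int n))\<^sup>2"
    and \<alpha>: "\<alpha> = Q1 / (Q1 + Q2)"
    and \<beta>: "\<beta> = Q2 / (Q1 + Q2)"
  shows "steklov_eigenvalue TYPE('n) L h 1 <
    min (ereal \<alpha> * sigmaN TYPE('n) R1 L1 1 + ereal \<beta> * sigmaN TYPE('n) R2 (L - L1) 1)
        (ereal (1 / (1 + (R1 / R2) ^ (n - 1))) * sigmaD TYPE('n) R1 L1 0 +
         ereal (1 / (1 + (R2 / R1) ^ (n - 1))) * sigmaD TYPE('n) R2 (L - L1) 0)"
proof -
  define m where "m = n - 3"
  have nm: "n = m + 3" "CARD('n) = m + 3" "n - 1 = m + 2" using n by (auto simp: m_def)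
  define B where "B = (R1 + R2 + L) / 2"
  have L: "0 < L" "h 0 = R1" "h L = R2" and hpos: "\<And>t. t \<in> {0..L} \<Longrightarrow> 0 < h t"
    using M by (auto simp: hypersurface_of_revolution_def)
  have R: "0 < R1" "0 < R2" using hpos[of 0] hpos[of L] L by auto
  have "R2 \<le> R1 + L" "R1 \<le> R2 + L"
    using hypersurface_below_cones(1)[OF M, of L] hypersurface_below_cones(2)[OF M, of 0] L by auto
  then have L1b: "0 \<le> L1" "L1 \<le> L" unfolding L1 by auto
  have B: "B = R1 + L1" "B = R2 + L - L1" "B = R2 + (L - L1)" "0 < B"
    using R L by (auto simp: B_def L1 field_simps)
  let ?S = "steklov_eigenvalue TYPE('n) L h 1"
  have profile: "R + 1 / ((real n - 1) * 2 ^ n) * (R1 + R2 + L) ^ n * R powi (1 - int n)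
      = neumann_profile (m + 3) B R" if "0 < R" for R
  proof -
    have e: "1 - int n = - int (m + 2)" using nm by simp
    have "R powi (1 - int n) = 1 / R ^ (m + 2)"
      unfolding e power_int_minus power_int_of_nat by (simp add: inverse_eq_divide)
    then show ?thesis
      by (simp add: neumann_profile_def B_def nm(1) power_divide)
  qed
  have Q: "Q1 = R1 ^ (m + 2) * (neumann_profile (m + 3) B R1)\<^sup>2"
    "Q2 = R2 ^ (m + 2) * (neumann_profile (m + 3) B R2)\<^sup>2"
    unfolding Q1 Q2 profile[OF R(1)] profile[OF R(2)] nm(3) by simp_all
  have Qpos: "0 < Q1" "0 < Q2"
    unfolding Q using R B(4) by (auto intro!: mult_pos_pos zero_less_power neumann_profile_pos simp del: power_Suc add_2_eq_Suc' zero_less_power2)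
  have N: "?S < ereal \<alpha> * sigmaN TYPE('n) R1 L1 1 + ereal \<beta> * sigmaN TYPE('n) R2 (L - L1) 1"
  proof -
    define \<sigma>1 where "\<sigma>1 = neumann_value (m + 3) R1 B"
    define \<sigma>2 where "\<sigma>2 = neumann_value (m + 3) R2 B"
    have "?S < ereal ((Q1 * \<sigma>1 + Q2 * \<sigma>2) / (Q1 + Q2))"
      unfolding \<sigma>1_def \<sigma>2_def by (rule steklov_less_neumann_combination[OF nm(2) M L1b B(1,2) Q])
    also have "\<dots> = ereal \<alpha> * ereal \<sigma>1 + ereal \<beta> * ereal \<sigma>2"
      by (simp add: \<alpha> \<beta> add_divide_distrib)
    also have "\<dots> \<le> ereal \<alpha> * sigmaN TYPE('n) R1 L1 1 + ereal \<beta> * sigmaN TYPE('n) R2 (L - L1) 1"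
      using sigmaN_ge[OF nm(2) R(1) L1b(1)] sigmaN_ge[OF nm(2) R(2), of "L - L1"] L1b Qpos
      by (intro add_mono ereal_mult_left_mono)
        (auto simp: \<sigma>1_def \<sigma>2_def nm(2) B(1)[symmetric] B(3)[symmetric] \<alpha> \<beta>)
    finally show ?thesis .
  qed
  have D: "?S < ereal (1 / (1 + (R1 / R2) ^ (n - 1))) * sigmaD TYPE('n) R1 L1 0 +
         ereal (1 / (1 + (R2 / R1) ^ (n - 1))) * sigmaD TYPE('n) R2 (L - L1) 0"
  proof -
    define x1 where "x1 = 1 / R1 ^ (m + 2)"
    define x2 where "x2 = 1 / R2 ^ (m + 2)"
    have x: "0 < x1" "0 < x2" using R by (simp_all add: x1_def x2_def del: power_Suc add_2_eq_Suc')
    have w: "1 / (1 + (R1 / R2) ^ (n - 1)) = x1 / (x1 + x2)" "1 / (1 + (R2 / R1) ^ (n - 1)) = x2 / (x1 + x2)"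
      unfolding nm(3) x1_def x2_def power_divide
      using R by (simp_all add: field_simps del: power_Suc add_2_eq_Suc')
    have wpos: "0 < x1 / (x1 + x2)" "0 < x2 / (x1 + x2)" using x by simp_all
    have dval: "dirichlet_value (m + 3) R B = (real m + 1) * (1 / R ^ (m + 2)) / (1 / R ^ (m + 1) - 1 / B ^ (m + 1))" for R
      by (simp add: dirichlet_value_def numeral_3_eq_3 del: power_Suc)
    have dval_pos: "0 < dirichlet_value (m + 3) R B" if "0 < R" "R < B" for R
      unfolding dval using that
      by (intro divide_pos_pos mult_pos_pos) (auto simp del: power_Suc intro!: frac_less2 power_strict_mono)
    have sD: "ereal (dirichlet_value (m + 3) R B) \<le> sigmaD TYPE('n) R l 0" if "0 < R" "0 < l" "B = R + l" for R l
      using sigmaD_ge[OF nm(2) that(1,2)] that(3) nm(2) by simp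
    have S_fin: "?S < \<infinity>" using N by (cases ?S) auto
    have cinf: "ereal c * \<infinity> = \<infinity>" if "0 < c" for c using that by simp
    have infX: "\<infinity> + X = \<infinity>" and Xinf: "X \<noteq> - \<infinity> \<Longrightarrow> X + \<infinity> = \<infinity>" for X :: ereal by auto
    \<comment> \<open>a degenerate shell has \<open>\<sigma>\<^sub>0\<^sup>D = \<infinity>\<close>\<close>
    consider "L1 = 0" | "L1 = L" | "0 < L1" "L1 < L" using L1b by linarith
    then show ?thesis
    proof cases
      case 1
      have "sigmaD TYPE('n) R1 L1 0 = \<infinity>" using sigmaD_degenerate[OF R(1)] 1 by simp
      then show ?thesis unfolding w by (simp only: cinf[OF wpos(1)] infX S_fin)
    next
      case 2
      have "R1 < B" using B L 2 by simp
      then have "0 \<le> ereal (dirichlet_value (m + 3) R1 B)" using dval_pos[OF R(1)] by simp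
      also have "\<dots> \<le> sigmaD TYPE('n) R1 L1 0" using sD[OF R(1) _ B(1)] L 2 by simp
      finally have "ereal (x1 / (x1 + x2)) * sigmaD TYPE('n) R1 L1 0 \<noteq> - \<infinity>"
        using wpos(1) by (auto simp: ereal_mult_eq_MInfty)
      moreover have "sigmaD TYPE('n) R2 (L - L1) 0 = \<infinity>" using sigmaD_degenerate[OF R(2)] 2 by simp
      ultimately show ?thesis unfolding w by (simp only: cinf[OF wpos(2)] Xinf S_fin not_False_eq_True)
    next
      case 3
      define J1 where "J1 = (1 / R1 ^ (m + 1) - 1 / B ^ (m + 1)) / (real m + 1)"
      define J2 where "J2 = (1 / R2 ^ (m + 1) - 1 / B ^ (m + 1)) / (real m + 1)"
      have RB: "R1 < B" "R2 < B" using B 3 by auto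
      have J: "0 < J1" "0 < J2"
        unfolding J1_def J2_def using R RB
        by (auto simp del: power_Suc add_2_eq_Suc' intro!: frac_less2 power_strict_mono divide_pos_pos)
      have d: "dirichlet_value (m + 3) R1 B = x1 / J1" "dirichlet_value (m + 3) R2 B = x2 / J2"
        unfolding dval J1_def J2_def x1_def x2_def by simp_all
      have cs: "(x1 + x2) / (J1 + J2) \<le> (x1\<^sup>2 / J1 + x2\<^sup>2 / J2) / (x1 + x2)"
      proof -
        \<comment> \<open>the Cauchy--Schwarz inequality in the form of a sum of squares\<close>
        have "(x1\<^sup>2 / J1 + x2\<^sup>2 / J2) * (J1 + J2) - (x1 + x2)\<^sup>2 = (x1 * J2 - x2 * J1)\<^sup>2 / (J1 * J2)"
          using J by (simp add: power2_eq_square field_simps)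
        also have "\<dots> \<ge> 0" using J by simp
        finally have "(x1 + x2) * (x1 + x2) \<le> (x1\<^sup>2 / J1 + x2\<^sup>2 / J2) * (J1 + J2)" by (simp add: power2_eq_square)
        then show ?thesis using J x by (simp add: pos_divide_le_eq pos_le_divide_eq)
      qed
      have "?S < ereal ((x1 + x2) / (J1 + J2))"
        unfolding x1_def x2_def
        by (rule steklov_less_dirichlet_combination[OF nm(2) M 3 B(1,2) J1_def J2_def])
      also have "\<dots> \<le> ereal ((x1\<^sup>2 / J1 + x2\<^sup>2 / J2) / (x1 + x2))" using cs by simp
      also have "(x1\<^sup>2 / J1 + x2\<^sup>2 / J2) / (x1 + x2) = x1 / (x1 + x2) * (x1 / J1) + x2 / (x1 + x2) * (x2 / J2)"
        by (simp add: power2_eq_square add_divide_distrib mult.commute[of "x1 + x2"])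
      also have "ereal \<dots> = ereal (x1 / (x1 + x2)) * ereal (x1 / J1) + ereal (x2 / (x1 + x2)) * ereal (x2 / J2)"
        by simp
      also have "\<dots> \<le> ereal (x1 / (x1 + x2)) * sigmaD TYPE('n) R1 L1 0 +
          ereal (x2 / (x1 + x2)) * sigmaD TYPE('n) R2 (L - L1) 0"
        using sD[OF R(1) 3(1) B(1)] sD[OF R(2) _ B(3)] 3 wpos unfolding d
        by (intro add_mono ereal_mult_left_mono) auto
      finally show ?thesis unfolding w by simp
    qed
  qed
  show ?thesis using N D by simp
qed

end
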